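(* Let $s\in(0,1)$ and let $A_0:L^2([2,3])\to L^2([-1,1])$ be the operator mapping $g\in L^2([2,3])$ to $u|_{[-1,1]}$, where $u$ is the solution of $(-\Delta)^su=0$ in $[-1,1]$, $u=g\chi_{[2,3]}$ in $\mathbb{R}\setminus[-1,1]$. Then for all $g\in L^2([2,3])$ and all $x\in[-1,1]$ $$A_0g(x)=-c(s)\,(1-x^2)^s\,H_{[2,3]}\big((\cdot^2-1)^{-s}g\big)(x).$$
   Context: $(-\Delta)^s$ is the fractional Laplacian on $\mathbb{R}$ (Fourier multiplier $|\xi|^{2s}$). The solution $u$ with exterior data $g\in L^2([2,3])$ is $u=E_0g+v$, where $E_0g$ is the extension of $g$ by zero to $\mathbb{R}$ and $v\in\widetilde{H}^s((-1,1))$ (closure of $C_c^\infty((-1,1))$ in $H^s(\mathbb{R})$) is the unique weak solution of $(-\Delta)^sv=-((-\Delta)^sE_0g)|_{(-1,1)}$ in $(-1,1)$. The constant $c(s)>0$ depends only on $s$ and is the constant in the Poisson kernel $c(s)\left(\frac{1-|x|^2}{|y|^2-1}\right)^s\frac{1}{|x-y|}$ ($|x|<1<|y|$) of the fractional Laplacian on the interval $(-1,1)$. The Hilbert transform is $H:L^2(\mathbb{R})\to L^2(\mathbb{R})$, $H(f)(t):=\mathrm{p.v.}\int_{\mathbb{R}}\frac{f(y)}{t-y}\,dy$ (without a factor $1/\pi$), and the truncated Hilbert transform is $H_{[2,3]}:L^2([2,3])\to L^2([-1,1])$, $H_{[2,3]}f:=H(E_0f)|_{[-1,1]}$. The notation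 $(\cdot^2-1)^{-s}g$ stands for the function $y\mapsto(y^2-1)^{-s}g(y)$ on $[2,3]$. *)

theory Defs
  imports "HOL-Analysis.Analysis"
begin

text \<open>
  Elements of \<open>L\<^sup>2\<close> are represented by Borel functions \<^typ>\<open>real \<Rightarrow> complex\<close>; two of them are
  the same element if they agree almost everywhere. Every class has a Borel representative.
  A function representing an element of \<open>L\<^sup>2(S)\<close> may take arbitrary values outside \<open>S\<close>.
\<close>

definition L2 :: "real set \<Rightarrow> (real \<Rightarrow> complex) set" where
  "L2 S = {f. set_borel_measurable lborel S f \<and> set_integrable lborel S (\<lambda>x. (cmod (f x))\<^sup>2)}"

definition zero_ext :: "real set \<Rightarrow> (real \<Rightarrow> complex) \<Rightarrow> real \<Rightarrow> complex" where
  "zero_ext S f = (\<lambda>x. if x \<in> S then f x else 0)"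


text \<open>The frequency variable is scaled so that \<open>-\<Delta>\<close> is the multiplier \<open>\<bar>\<xi>\<bar>\<^sup>2\<close>.\<close>

definition fourier :: "(real \<Rightarrow> complex) \<Rightarrow> real \<Rightarrow> complex" where
  "fourier f \<xi> = (LINT x|lborel. exp (- \<i> * complex_of_real (\<xi> * x)) * f x)"

text \<open>
  The Plancherel extension to \<open>L\<^sup>2(\<real>)\<close>: the \<open>L\<^sup>2\<close>-limit of the transforms of the truncations
  of \<open>f\<close>. It is determined up to a null set, and \<open>SOME\<close> picks a representative.
\<close>

definition fourier_L2 :: "(real \<Rightarrow> complex) \<Rightarrow> real \<Rightarrow> complex" where
  "fourier_L2 f = (SOME F. F \<in> L2 UNIV \<and>
     (\<lambda>n::nat. \<integral>\<^sup>+ \<xi>. ennreal ((cmod (fourier (zero_ext {- real n..real n} f) \<xi> - F \<xi>))\<^sup>2) \<partial>lborel)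
       \<longlonglongrightarrow> 0)"


definition Hs_norm_sq :: "real \<Rightarrow> (real \<Rightarrow> complex) \<Rightarrow> ennreal" where
  "Hs_norm_sq s f = (\<integral>\<^sup>+ \<xi>. ennreal ((1 + \<xi>\<^sup>2) powr s * (cmod (fourier_L2 f \<xi>))\<^sup>2) \<partial>lborel)"

text \<open>\<open>H\<^sup>s(\<real>)\<close> for \<open>s \<ge> 0\<close>.\<close>

definition Hs :: "real \<Rightarrow> (real \<Rightarrow> complex) set" where
  "Hs s = {f \<in> L2 UNIV. Hs_norm_sq s f < \<infinity>}"

text \<open>\<open>C\<^sub>c\<^sup>\<infinity>(\<Omega>)\<close>; the sequence \<open>D\<close> lists the derivatives of \<open>\<phi>\<close> of all orders.\<close>

definition test_functions :: "real set \<Rightarrow> (real \<Rightarrow> complex) set" where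
  "test_functions \<Omega> = {\<phi>.
     (\<exists>D :: nat \<Rightarrow> real \<Rightarrow> complex. D 0 = \<phi> \<and>
        (\<forall>k x. (D k has_vector_derivative D (Suc k) x) (at x))) \<and>
     compact (closure {x. \<phi> x \<noteq> 0}) \<and> closure {x. \<phi> x \<noteq> 0} \<subseteq> \<Omega>}"

text \<open>The closure of \<open>C\<^sub>c\<^sup>\<infinity>(\<Omega>)\<close> in \<open>H\<^sup>s(\<real>)\<close>.\<close>

definition Hs_tilde :: "real \<Rightarrow> real set \<Rightarrow> (real \<Rightarrow> complex) set" where
  "Hs_tilde s \<Omega> = {v \<in> Hs s. \<exists>\<phi> :: nat \<Rightarrow> real \<Rightarrow> complex.
     (\<forall>n. \<phi> n \<in> test_functions \<Omega>) \<and>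
     (\<lambda>n. Hs_norm_sq s (\<lambda>x. \<phi> n x - v x)) \<longlonglongrightarrow> 0}"


text \<open>
  For \<open>f \<in> L\<^sup>2(\<real>)\<close>, \<open>(-\<Delta>)\<^sup>s f\<close> is in general only a tempered distribution, so it is given by
  its pairing (bilinear, without conjugation) with test functions. By Parseval,
  \<open>\<langle>T, \<phi>\<rangle> = (2\<pi>)\<^sup>-\<^sup>1 \<integral> T\<^sup>^(\<xi>) \<phi>\<^sup>^(-\<xi>) d\<xi>\<close>, where \<open>\<^sup>^\<close> is the Fourier transform.
\<close>

definition frac_laplacian :: "real \<Rightarrow> (real \<Rightarrow> complex) \<Rightarrow> (real \<Rightarrow> complex) \<Rightarrow> complex" where
  "frac_laplacian s f \<phi> =
     (LINT \<xi>|lborel. complex_of_real (\<bar>\<xi>\<bar> powr (2 * s)) * fourier_L2 f \<xi> * fourier \<phi> (- \<xi>))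
       / complex_of_real (2 * pi)"

text \<open>
  Both sides of the equation for \<open>v\<close> are distributions restricted to \<open>(-1,1)\<close>, that is, to test
  functions supported there.
\<close>

definition is_solution :: "real \<Rightarrow> (real \<Rightarrow> complex) \<Rightarrow> (real \<Rightarrow> complex) \<Rightarrow> bool" where
  "is_solution s g u \<longleftrightarrow> (\<exists>v \<in> Hs_tilde s {-1<..<1}.
     u = (\<lambda>x. zero_ext {2..3} g x + v x) \<and>
     (\<forall>\<phi> \<in> test_functions {-1<..<1}.
        frac_laplacian s v \<phi> = - frac_laplacian s (zero_ext {2..3} g) \<phi>))"

text \<open>
  A solution is unique up to a null set; if there were none, nothing could be proved about the
  value of \<open>SOME\<close>.
\<close>

definition A0 :: "real \<Rightarrow> (real \<Rightarrow> complex) \<Rightarrow> real \<Rightarrow> complex" where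
  "A0 s g = restrict (SOME u. is_solution s g u) {-1..1}"


text \<open>The Hilbert transform without the factor \<open>1/\<pi>\<close>.\<close>

definition hilbert :: "(real \<Rightarrow> complex) \<Rightarrow> real \<Rightarrow> complex" where
  "hilbert f t = Lim (at_right 0)
     (\<lambda>\<epsilon>. LINT y:{y. \<bar>t - y\<bar> > \<epsilon>}|lborel. f y / complex_of_real (t - y))"

definition hilbert_trunc :: "(real \<Rightarrow> complex) \<Rightarrow> real \<Rightarrow> complex" where
  "hilbert_trunc f = restrict (hilbert (zero_ext {2..3} f)) {-1..1}"

text \<open>
  The constant of the Poisson kernel
  \<open>c(s) ((1 - x\<^sup>2) / (y\<^sup>2 - 1))\<^sup>s / \<bar>x - y\<bar>\<close>, \<open>\<bar>x\<bar> < 1 < \<bar>y\<bar>\<close>, of \<open>(-\<Delta>)\<^sup>s\<close> on \<open>(-1,1)\<close>: it is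
  \<open>\<Gamma>(n/2) \<pi>\<^bsup>-n/2-1\<^esup> sin(\<pi>s)\<close> on the unit ball of \<open>\<real>\<^sup>n\<close>, here with \<open>n = 1\<close>. It gives the kernel
  total mass 1 in \<open>y\<close>, since at \<open>x = 0\<close>
  \<open>\<integral>\<^bsub>\<bar>y\<bar>>1\<^esub> (y\<^sup>2 - 1)\<^bsup>-s\<^esup> / \<bar>y\<bar> dy = \<integral>\<^bsub>t>0\<^esub> t\<^bsup>-s\<^esup> / (1 + t) dt = \<pi> / sin(\<pi>s)\<close>.
\<close>

definition poisson_const :: "real \<Rightarrow> real" where
  "poisson_const s = sin (pi * s) / pi"

end

theory Submission
  imports Defs "HOL-Complex_Analysis.Complex_Analysis"
begin

text \<open>
  Write \<open>\<phi>\<^sup>^\<close> for the Fourier transform. Since \<open>[2, 3]\<close> has distance \<open>1\<close> from \<open>[-1, 1]\<close>, the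
  truncated Hilbert transform is an ordinary integral, and the claim is that the solution agrees
  almost everywhere on \<open>[-1, 1]\<close> with
  \<open>v(x) = c(s) (1 - x\<^sup>2)\<^sub>+\<^bsup>s\<^esup> \<integral>\<^bsub>[2,3]\<^esub> (y\<^sup>2 - 1)\<^bsup>-s\<^esup> g(y) / (y - x) dy\<close>
  (\<open>ball_potential\<close> of \<open>poisson_density\<close>). Three facts give this: solutions are unique up to null sets,
  \<open>v\<close> lies in the closure of the test functions in \<open>H\<^sup>s\<close>, and \<open>v\<close> satisfies the equation.

  Uniqueness (\<open>Hs_tilde_frac_laplacian_unique\<close>) is the energy argument: the difference of two solutions
  is tested against its own approximations, so \<open>\<integral> \<bar>\<xi>\<bar>\<^bsup>2s\<^esup> \<bar>v\<^sub>1\<^sup>^ - v\<^sub>2\<^sup>^\<bar>\<^sup>2 d\<xi> = 0\<close>. It needs the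
  Fourier transform on \<open>L\<^sup>2\<close> to exist and to be injective. Existence follows from the inequality
  \<open>\<integral> \<bar>f\<^sup>^\<bar>\<^sup>2 \<le> 2\<pi> \<integral> \<bar>f\<bar>\<^sup>2\<close> (\<open>plancherel_le\<close>) and the completeness of \<open>L\<^sup>2\<close>; injectivity
  (\<open>fourier_L2_injective\<close>) from Parseval's formula against indicators of intervals. Both come from
  the Abel means of the inverse transform, which are convolutions with the Poisson kernel of the
  half plane.

  Membership (\<open>ball_potential_in_Hs_tilde\<close>) follows from the pointwise decay
  \<open>\<bar>v\<^sup>^(\<xi>)\<bar> \<le> C (1 + \<xi>\<^sup>2)\<^bsup>-(1+s)/2\<^esup>\<close>, which slightly dilated and mollified copies of \<open>v\<close> share up to a
  constant; these are test functions, and dominated convergence on the Fourier side makes them converge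
  to \<open>v\<close> in \<open>H\<^sup>s\<close>.

  The equation is proved by moving \<open>(-\<Delta>)\<^sup>s\<close> to the test function \<open>\<phi>\<close>. Put
  \<open>\<psi> = 2\<pi> (-\<Delta>)\<^sup>s \<phi>\<close> (\<open>two_sided_transform\<close>). By Fubini, the equation for all \<open>g\<close> amounts to
  \<open>(y\<^sup>2 - 1)\<^sup>s \<psi>(y) = - c(s) \<integral>\<^bsub>(-1,1)\<^esub> (1 - x\<^sup>2)\<^sup>s \<psi>(x) / (y - x) dx\<close> for \<open>y > 1\<close>
  (\<open>two_sided_transform_poisson\<close>). The positive frequencies of \<open>\<psi>\<close> extend to the upper half plane, where they are
  a multiple of \<open>\<integral> \<phi>(t) (-i (z - t))\<^bsup>-2s-1\<^esup> dt\<close>; the negative frequencies extend in the same way to the lower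
  half plane. Multiplied by the branches of \<open>(1 - z\<^sup>2)\<^sup>s\<close> that are real on \<open>(-1, 1)\<close>, the two boundary
  values cancel on \<open>\<bar>x\<bar> > 1\<close>, because the phases \<open>\<minusplus> \<pi> s\<close> of the power and \<open>\<plusminus> \<pi> (s + 1/2)\<close> of the
  Riesz integral add up to \<open>\<plusminus> \<pi> / 2\<close>, with opposite signs in the two half planes. Cauchy's theorem in the two half planes then
  leaves exactly the integral over \<open>(-1, 1)\<close> and the value at \<open>y\<close>, and
  \<open>2 cos (\<pi> (s + 1/2)) = - 2 sin (\<pi> s)\<close> produces the constant.
\<close>

section \<open>Square-integrable functions\<close>

definition sqnorm :: "(real \<Rightarrow> complex) \<Rightarrow> ennreal" where
  "sqnorm f = (\<integral>\<^sup>+ x. ennreal ((cmod (f x))\<^sup>2) \<partial>lborel)"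

lemma L2_UNIV_iff:
  "f \<in> L2 UNIV \<longleftrightarrow> f \<in> borel_measurable borel \<and> integrable lborel (\<lambda>x. (cmod (f x))\<^sup>2)"
  by (simp add: L2_def set_borel_measurable_def set_integrable_def)

lemma L2_UNIV_iff_sqnorm: "f \<in> L2 UNIV \<longleftrightarrow> f \<in> borel_measurable borel \<and> sqnorm f < \<infinity>"
proof -
  have "integrable lborel (\<lambda>x. (cmod (f x))\<^sup>2) \<longleftrightarrow> sqnorm f < \<infinity>" if "f \<in> borel_measurable borel"
    using that unfolding sqnorm_def by (simp add: integrable_iff_bounded)
  then show ?thesis
    by (auto simp: L2_UNIV_iff)
qed

lemma L2_measurable [measurable_dest]: "f \<in> L2 UNIV \<Longrightarrow> f \<in> borel_measurable borel"
  by (simp add: L2_UNIV_iff)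

lemma L2_sqnorm_finite: "f \<in> L2 UNIV \<Longrightarrow> sqnorm f < \<infinity>"
  by (simp add: L2_UNIV_iff_sqnorm)

lemma sqnorm_cong_AE: "AE x in lborel. f x = g x \<Longrightarrow> sqnorm f = sqnorm g"
  unfolding sqnorm_def by (intro nn_integral_cong_AE) auto

lemma sqnorm_minus_commute: "sqnorm (\<lambda>x. f x - g x) = sqnorm (\<lambda>x. g x - f x)"
  unfolding sqnorm_def by (simp add: norm_minus_commute)

lemma cmod_add_sq_le: "(cmod (a + b))\<^sup>2 \<le> 2 * (cmod a)\<^sup>2 + 2 * (cmod b)\<^sup>2"
proof -
  have "(cmod (a + b))\<^sup>2 \<le> (cmod a + cmod b)\<^sup>2"
    by (intro power_mono norm_triangle_ineq) auto
  also have "\<dots> \<le> 2 * (cmod a)\<^sup>2 + 2 * (cmod b)\<^sup>2"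
    using sum_squares_bound[of "cmod a" "cmod b"] by (simp add: power2_sum)
  finally show ?thesis .
qed

lemma sqnorm_add_le:
  assumes [measurable]: "f \<in> borel_measurable borel" "g \<in> borel_measurable borel"
  shows "sqnorm (\<lambda>x. f x + g x) \<le> 2 * sqnorm f + 2 * sqnorm g"
proof -
  have "sqnorm (\<lambda>x. f x + g x)
      \<le> (\<integral>\<^sup>+ x. 2 * ennreal ((cmod (f x))\<^sup>2) + 2 * ennreal ((cmod (g x))\<^sup>2) \<partial>lborel)"
    unfolding sqnorm_def
  proof (intro nn_integral_mono)
    fix x
    have "ennreal ((cmod (f x + g x))\<^sup>2) \<le> ennreal (2 * (cmod (f x))\<^sup>2 + 2 * (cmod (g x))\<^sup>2)"
      by (intro ennreal_leI cmod_add_sq_le)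
    then show "ennreal ((cmod (f x + g x))\<^sup>2) \<le> 2 * ennreal ((cmod (f x))\<^sup>2) + 2 * ennreal ((cmod (g x))\<^sup>2)"
      by (simp add: ennreal_plus ennreal_mult)
  qed
  also have "\<dots> = 2 * sqnorm f + 2 * sqnorm g"
    unfolding sqnorm_def by (simp add: nn_integral_add nn_integral_cmult)
  finally show ?thesis .
qed

lemma sqnorm_diff_le:
  assumes "f \<in> borel_measurable borel" "g \<in> borel_measurable borel"
  shows "sqnorm (\<lambda>x. f x - g x) \<le> 2 * sqnorm f + 2 * sqnorm g"
  using sqnorm_add_le[of f "\<lambda>x. - g x"] assms by (simp add: sqnorm_def)

lemma sqnorm_eq_0:
  assumes [measurable]: "f \<in> borel_measurable borel" and "sqnorm f = 0"
  shows "AE x in lborel. f x = 0"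
  using assms(2) unfolding sqnorm_def by (subst (asm) nn_integral_0_iff_AE) auto

lemma L2_diff: "f \<in> L2 UNIV \<Longrightarrow> g \<in> L2 UNIV \<Longrightarrow> (\<lambda>x. f x - g x) \<in> L2 UNIV"
  unfolding L2_UNIV_iff_sqnorm
  by (auto intro!: le_less_trans[OF sqnorm_diff_le] simp: ennreal_mult_less_top)

lemma L2_cnj: "f \<in> L2 UNIV \<Longrightarrow> (\<lambda>x. cnj (f x)) \<in> L2 UNIV"
  unfolding L2_UNIV_iff
  by (auto intro: measurable_compose[OF _ borel_measurable_continuous_onI[OF continuous_on_cnj[OF continuous_on_id]]])

lemma L2_dominated:
  assumes "f \<in> borel_measurable borel" and "g \<in> L2 UNIV" and "\<And>x. cmod (f x) \<le> C * cmod (g x)"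
  shows "f \<in> L2 UNIV"
  unfolding L2_UNIV_iff
proof (intro conjI assms(1))
  have "integrable lborel (\<lambda>x. C\<^sup>2 * (cmod (g x))\<^sup>2)"
    using assms(2) by (simp add: L2_UNIV_iff)
  then show "integrable lborel (\<lambda>x. (cmod (f x))\<^sup>2)"
  proof (rule Bochner_Integration.integrable_bound)
    show "(\<lambda>x. (cmod (f x))\<^sup>2) \<in> borel_measurable lborel"
      using assms(1) by simp
    show "AE x in lborel. norm ((cmod (f x))\<^sup>2) \<le> norm (C\<^sup>2 * (cmod (g x))\<^sup>2)"
    proof (intro AE_I2)
      fix x
      have "(cmod (f x))\<^sup>2 \<le> (C * cmod (g x))\<^sup>2"
        by (intro power_mono assms(3)) auto
      then show "norm ((cmod (f x))\<^sup>2) \<le> norm (C\<^sup>2 * (cmod (g x))\<^sup>2)"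
        by (simp add: power_mult_distrib)
    qed
  qed
qed

lemma L2_mult_integrable:
  assumes "f \<in> L2 UNIV" "g \<in> L2 UNIV"
  shows "integrable lborel (\<lambda>x. f x * g x)"
proof (rule Bochner_Integration.integrable_bound)
  show "integrable lborel (\<lambda>x. (cmod (f x))\<^sup>2 + (cmod (g x))\<^sup>2)"
    using assms by (auto simp: L2_UNIV_iff)
  show "(\<lambda>x. f x * g x) \<in> borel_measurable lborel"
    using assms by (auto simp: L2_UNIV_iff)
  show "AE x in lborel. norm (f x * g x) \<le> norm ((cmod (f x))\<^sup>2 + (cmod (g x))\<^sup>2)"
  proof (intro AE_I2)
    fix x
    have "norm (f x * g x) \<le> (cmod (f x))\<^sup>2 + (cmod (g x))\<^sup>2"
      using sum_squares_bound[of "cmod (f x)" "cmod (g x)"] norm_ge_zero[of "f x * g x"]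
      unfolding norm_mult by linarith
    then show "norm (f x * g x) \<le> norm ((cmod (f x))\<^sup>2 + (cmod (g x))\<^sup>2)"
      by simp
  qed
qed

lemma L2_integral_mult_le:
  assumes "f \<in> L2 UNIV" "g \<in> L2 UNIV"
  shows "ennreal ((cmod (LINT x|lborel. f x * g x))\<^sup>2) \<le> sqnorm f * sqnorm g"
proof -
  have [measurable]: "f \<in> borel_measurable borel" "g \<in> borel_measurable borel"
    using assms by auto
  have "ennreal (cmod (LINT x|lborel. f x * g x)) \<le> (\<integral>\<^sup>+ x. ennreal (cmod (f x * g x)) \<partial>lborel)"
    by (rule integral_norm_bound_ennreal[OF L2_mult_integrable[OF assms]])
  also have "\<dots> = (\<integral>\<^sup>+ x. ennreal (cmod (f x)) * ennreal (cmod (g x)) \<partial>lborel)"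
    by (simp add: norm_mult ennreal_mult)
  finally have "(ennreal (cmod (LINT x|lborel. f x * g x)))\<^sup>2
      \<le> (\<integral>\<^sup>+ x. ennreal (cmod (f x)) * ennreal (cmod (g x)) \<partial>lborel)\<^sup>2"
    by (rule power_mono) simp
  also have "\<dots> \<le> (\<integral>\<^sup>+ x. (ennreal (cmod (f x)))\<^sup>2 \<partial>lborel) * (\<integral>\<^sup>+ x. (ennreal (cmod (g x)))\<^sup>2 \<partial>lborel)"
    by (rule Cauchy_Schwarz_nn_integral) auto
  finally show ?thesis
    by (simp add: sqnorm_def ennreal_power)
qed

lemma L2_integral_mult_tendsto:
  assumes F: "\<And>n. F n \<in> L2 UNIV" and "f \<in> L2 UNIV" and "g \<in> L2 UNIV"
    and lim: "(\<lambda>n. sqnorm (\<lambda>x. F n x - f x)) \<longlonglongrightarrow> 0"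
  shows "(\<lambda>n. LINT x|lborel. F n x * g x) \<longlonglongrightarrow> (LINT x|lborel. f x * g x)"
proof -
  have "(\<lambda>n. sqnorm (\<lambda>x. F n x - f x) * sqnorm g) \<longlonglongrightarrow> 0 * sqnorm g"
    using L2_sqnorm_finite[OF assms(3)] by (intro tendsto_mult_ennreal lim tendsto_const) auto
  then have lim': "(\<lambda>n. sqnorm (\<lambda>x. F n x - f x) * sqnorm g) \<longlonglongrightarrow> 0"
    by simp
  have "(\<lambda>n. ennreal ((cmod ((LINT x|lborel. F n x * g x) - (LINT x|lborel. f x * g x)))\<^sup>2)) \<longlonglongrightarrow> 0"
  proof (rule tendsto_sandwich[OF _ _ tendsto_const lim'])
    show "\<forall>\<^sub>F n in sequentially. ennreal ((cmod ((LINT x|lborel. F n x * g x) - (LINT x|lborel. f x * g x)))\<^sup>2)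
       \<le> sqnorm (\<lambda>x. F n x - f x) * sqnorm g"
    proof (intro always_eventually allI)
      fix n
      have "(LINT x|lborel. F n x * g x) - (LINT x|lborel. f x * g x) = (LINT x|lborel. (F n x - f x) * g x)"
        using L2_mult_integrable[OF F[of n] assms(3)] L2_mult_integrable[OF assms(2,3)]
        by (simp add: left_diff_distrib)
      then show "ennreal ((cmod ((LINT x|lborel. F n x * g x) - (LINT x|lborel. f x * g x)))\<^sup>2)
       \<le> sqnorm (\<lambda>x. F n x - f x) * sqnorm g"
        using L2_integral_mult_le[OF L2_diff[OF F[of n] assms(2)] assms(3)] by simp
    qed
  qed auto
  then have "(\<lambda>n. (cmod ((LINT x|lborel. F n x * g x) - (LINT x|lborel. f x * g x)))\<^sup>2) \<longlonglongrightarrow> 0"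
    by (subst (asm) ennreal_0[symmetric], subst (asm) tendsto_ennreal_iff) auto
  then have "(\<lambda>n. sqrt ((cmod ((LINT x|lborel. F n x * g x) - (LINT x|lborel. f x * g x)))\<^sup>2)) \<longlonglongrightarrow> sqrt 0"
    by (rule tendsto_real_sqrt)
  then show ?thesis
    by (simp add: tendsto_norm_zero_iff LIM_zero_iff)
qed

section \<open>The Fourier transform of an integrable function\<close>

lemma norm_fourier_kernel [simp]: "cmod (exp (- \<i> * complex_of_real (\<xi> * x))) = 1"
  by (simp add: norm_exp_eq_Re)

lemma fourier_kernel_integrable:
  assumes "integrable lborel f"
  shows "integrable lborel (\<lambda>x. exp (- \<i> * complex_of_real (\<xi> * x)) * f x)"
  using assms
  by (rule Bochner_Integration.integrable_bound) (use assms in \<open>auto simp: norm_mult norm_exp_eq_Re\<close>)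

lemma fourier_norm_le:
  assumes "integrable lborel f"
  shows "cmod (fourier f \<xi>) \<le> (LINT x|lborel. cmod (f x))"
proof -
  have "cmod (fourier f \<xi>) \<le> (LINT x|lborel. cmod (exp (- \<i> * complex_of_real (\<xi> * x)) * f x))"
    unfolding fourier_def by (rule integral_norm_bound)
  then show ?thesis
    by (simp only: norm_mult norm_fourier_kernel mult_1)
qed

lemma fourier_diff:
  assumes "integrable lborel f" "integrable lborel g"
  shows "fourier (\<lambda>x. f x - g x) \<xi> = fourier f \<xi> - fourier g \<xi>"
  unfolding fourier_def right_diff_distrib
  using assms[THEN fourier_kernel_integrable, of \<xi>] by simp

lemma fourier_cnj: "fourier (\<lambda>x. cnj (f x)) \<xi> = cnj (fourier f (- \<xi>))"
  unfolding fourier_def by (subst Bochner_Integration.integral_cnj[symmetric]) (simp add: exp_cnj)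

lemma fourier_reflect: "fourier (\<lambda>x. f (- x)) \<xi> = fourier f (- \<xi>)"
  unfolding fourier_def by (subst lborel_integral_real_affine[where c = "-1" and t = 0]) auto

lemma fourier_isCont:
  assumes "integrable lborel f"
  shows "isCont (fourier f) \<xi>"
  unfolding continuous_at_sequentially comp_def
proof (intro allI impI)
  fix u :: "nat \<Rightarrow> real" assume u: "u \<longlonglongrightarrow> \<xi>"
  show "(\<lambda>n. fourier f (u n)) \<longlonglongrightarrow> fourier f \<xi>"
    unfolding fourier_def
  proof (rule integral_dominated_convergence[where w = "\<lambda>x. cmod (f x)"])
    show "AE x in lborel. (\<lambda>n. exp (- \<i> * complex_of_real (u n * x)) * f x)
        \<longlonglongrightarrow> exp (- \<i> * complex_of_real (\<xi> * x)) * f x"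
      by (intro AE_I2 tendsto_intros u)
  qed (use assms in \<open>auto simp: norm_mult norm_exp_eq_Re\<close>)
qed

lemma fourier_continuous_on: "integrable lborel f \<Longrightarrow> continuous_on S (fourier f)"
  by (simp add: continuous_at_imp_continuous_on fourier_isCont)

lemma fourier_measurable: "integrable lborel f \<Longrightarrow> fourier f \<in> borel_measurable borel"
  by (intro borel_measurable_continuous_onI fourier_continuous_on)

lemma lborel_product_integrable:
  fixes f g :: "real \<Rightarrow> complex"
  assumes f: "integrable lborel f" and g: "integrable lborel g"
  shows "integrable (lborel \<Otimes>\<^sub>M lborel) (\<lambda>(x, y). f x * g y)"
proof -
  have [measurable]: "f \<in> borel_measurable borel" "g \<in> borel_measurable borel"
    using f g by auto
  show ?thesis
    using f g by (intro lborel_pair.Fubini_integrable) (auto simp: norm_mult)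
qed

text \<open>Fubini moves the transform from one factor to the other.\<close>

lemma fourier_mult_formula:
  assumes f: "integrable lborel f" and g: "integrable lborel g"
  shows "(LINT \<xi>|lborel. fourier f \<xi> * g \<xi>) = (LINT x|lborel. f x * fourier g x)"
proof -
  have [measurable]: "f \<in> borel_measurable borel" "g \<in> borel_measurable borel"
    using f g by auto
  have int: "integrable (lborel \<Otimes>\<^sub>M lborel)
      (case_prod (\<lambda>x \<xi>. exp (- \<i> * complex_of_real (\<xi> * x)) * f x * g \<xi>))"
  proof (rule Bochner_Integration.integrable_bound)
    show "integrable (lborel \<Otimes>\<^sub>M lborel) (\<lambda>(x, \<xi>). f x * g \<xi>)"
      by (rule lborel_product_integrable[OF f g])
  qed (auto simp: norm_mult norm_exp_eq_Re)
  have "(LINT \<xi>|lborel. fourier f \<xi> * g \<xi>)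
      = (LINT \<xi>|lborel. LINT x|lborel. exp (- \<i> * complex_of_real (\<xi> * x)) * f x * g \<xi>)"
    unfolding fourier_def by simp
  also have "\<dots> = (LINT x|lborel. LINT \<xi>|lborel. exp (- \<i> * complex_of_real (\<xi> * x)) * f x * g \<xi>)"
    by (rule lborel_pair.Fubini_integral[OF int])
  also have "\<dots> = (LINT x|lborel. LINT \<xi>|lborel. f x * (exp (- \<i> * complex_of_real (x * \<xi>)) * g \<xi>))"
    by (simp add: ac_simps)
  also have "\<dots> = (LINT x|lborel. f x * fourier g x)"
    unfolding fourier_def by simp
  finally show ?thesis .
qed

section \<open>Abel means of the Fourier transform and the Plancherel inequality\<close>

text \<open>
  The Poisson kernel of the upper half plane at height \<open>d\<close>, normalized to total mass \<open>\<pi>\<close>. It serves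
  twice: for the summation of Fourier integrals, and for approaching the real axis from both sides.
\<close>

definition poisson_kernel :: "real \<Rightarrow> real \<Rightarrow> real" where
  "poisson_kernel d u = d / (u\<^sup>2 + d\<^sup>2)"

lemma poisson_kernel_nonneg: "d > 0 \<Longrightarrow> poisson_kernel d u \<ge> 0"
  by (simp add: poisson_kernel_def)

lemma poisson_kernel_measurable [measurable]: "poisson_kernel d \<in> borel_measurable borel"
  unfolding poisson_kernel_def by measurable

lemma poisson_kernel_minus: "poisson_kernel d (x - y) = poisson_kernel d (y - x)"
  by (simp add: poisson_kernel_def power2_commute)

lemma cauchy_density_integral:
  "has_bochner_integral lborel (\<lambda>t::real. 1 / (1 + t\<^sup>2)) pi"
proof -
  have einterval: "einterval (-\<infinity>) \<infinity> = (UNIV :: real set)"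
    by (auto simp: einterval_def)
  have t1: "((arctan \<circ> real_of_ereal) \<longlongrightarrow> - (pi / 2)) (at_right (-\<infinity>))"
    unfolding ereal_tendsto_simps by (rule tendsto_arctan_at_bot)
  have t2: "((arctan \<circ> real_of_ereal) \<longlongrightarrow> pi / 2) (at_left \<infinity>)"
    unfolding ereal_tendsto_simps by (rule tendsto_arctan_at_top)
  have d: "DERIV arctan x :> 1 / (1 + x\<^sup>2)" for x
    using DERIV_arctan[of x] by (simp add: field_simps)
  have ne: "1 + x\<^sup>2 \<noteq> 0" for x :: real
    using zero_le_power2[of x] by linarith
  have "set_integrable lborel (einterval (-\<infinity>) \<infinity>) (\<lambda>t::real. 1 / (1 + t\<^sup>2))"
    and "(LBINT t=-\<infinity>..\<infinity>. 1 / (1 + t\<^sup>2)) = pi / 2 - (- (pi / 2))"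
    using t1 t2 d ne
    by (intro interval_integral_FTC_nonneg[where F = arctan]; auto intro!: continuous_intros)+
  then show ?thesis
    by (simp add: einterval set_integrable_def interval_lebesgue_integral_def
        set_lebesgue_integral_def has_bochner_integral_iff)
qed

lemma poisson_kernel_scale:
  assumes "d > 0"
  shows "d * poisson_kernel d (d * t) = 1 / (1 + t\<^sup>2)"
proof -
  have "(d * t)\<^sup>2 + d\<^sup>2 = d\<^sup>2 * (1 + t\<^sup>2)"
    by (simp add: power2_eq_square algebra_simps)
  then have "d * poisson_kernel d (d * t) = (d\<^sup>2 * 1) / (d\<^sup>2 * (1 + t\<^sup>2))"
    by (simp add: poisson_kernel_def power2_eq_square)
  then show ?thesis
    using assms by simp
qed

lemma poisson_kernel_integral:
  assumes "d > 0"
  shows "has_bochner_integral lborel (\<lambda>x. poisson_kernel d (x - y)) pi"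
proof -
  have "has_bochner_integral lborel (\<lambda>t. poisson_kernel d (y + d * t - y)) (pi /\<^sub>R \<bar>d\<bar>)"
  proof -
    have "has_bochner_integral lborel (\<lambda>t. (1 / d) * (1 / (1 + t\<^sup>2))) ((1 / d) * pi)"
      by (rule has_bochner_integral_mult_right) (rule cauchy_density_integral)
    moreover have "poisson_kernel d (y + d * t - y) = (1 / d) * (1 / (1 + t\<^sup>2))" for t
    proof -
      have "poisson_kernel d (y + d * t - y) = (1 / d) * (d * poisson_kernel d (d * t))"
        using assms by simp
      then show ?thesis
        by (simp only: poisson_kernel_scale[OF assms])
    qed
    ultimately show ?thesis
      using assms by (simp add: divide_inverse_commute)
  qed
  then show ?thesis
    using assms by (subst lborel_has_bochner_integral_real_affine_iff[where c = d and t = y]) auto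
qed

lemma poisson_kernel_nn_integral:
  assumes "d > 0"
  shows "(\<integral>\<^sup>+ x. ennreal (poisson_kernel d (x - y)) \<partial>lborel) = ennreal pi"
  using poisson_kernel_integral[OF assms, of y] assms
  by (simp add: has_bochner_integral_iff nn_integral_eq_integral poisson_kernel_nonneg)

text \<open>
  The substitution \<open>x = y + d t\<close> freezes the kernel at \<open>1 / (1 + t\<^sup>2)\<close>; boundedness of \<open>D\<close> and continuity
  at the single point \<open>y\<close> then suffice for dominated convergence.
\<close>

lemma poisson_kernel_approx_identity:
  fixes D :: "real \<Rightarrow> complex"
  assumes [measurable]: "D \<in> borel_measurable borel" and bound: "\<And>x. cmod (D x) \<le> B"
    and cont: "isCont D y" and d: "\<And>n. d n > 0" "d \<longlonglongrightarrow> 0"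
  shows "(\<lambda>n. LINT x|lborel. of_real (poisson_kernel (d n) (x - y)) * D x) \<longlonglongrightarrow> of_real pi * D y"
proof -
  have eq: "(LINT x|lborel. of_real (poisson_kernel (d n) (x - y)) * D x)
      = (LINT t|lborel. of_real (1 / (1 + t\<^sup>2)) * D (y + d n * t))" for n
  proof -
    have "(LINT x|lborel. of_real (poisson_kernel (d n) (x - y)) * D x)
       = \<bar>d n\<bar> *\<^sub>R (LINT t|lborel. of_real (poisson_kernel (d n) (y + d n * t - y)) * D (y + d n * t))"
      using d(1)[of n] by (intro lborel_integral_real_affine) auto
    also have "\<dots> = (LINT t|lborel. d n *\<^sub>R (of_real (poisson_kernel (d n) (d n * t)) * D (y + d n * t)))"
      using d(1)[of n] by simp
    also have "\<dots> = (LINT t|lborel. of_real (1 / (1 + t\<^sup>2)) * D (y + d n * t))"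
      using poisson_kernel_scale[OF d(1)[of n]] 
      by (intro Bochner_Integration.integral_cong refl)
        (simp add: scaleR_conv_of_real mult.assoc[symmetric] flip: of_real_mult)
    finally show ?thesis .
  qed
  have "(\<lambda>n. LINT t|lborel. of_real (1 / (1 + t\<^sup>2)) * D (y + d n * t))
      \<longlonglongrightarrow> (LINT t|lborel. of_real (1 / (1 + t\<^sup>2)) * D y)"
  proof (rule integral_dominated_convergence[where w = "\<lambda>t. B * (1 / (1 + t\<^sup>2))"])
    show "integrable lborel (\<lambda>t::real. B * (1 / (1 + t\<^sup>2)))"
      using cauchy_density_integral by (intro integrable_mult_right) (simp add: has_bochner_integral_iff)
    show "AE t in lborel. (\<lambda>n. of_real (1 / (1 + t\<^sup>2)) * D (y + d n * t)) \<longlonglongrightarrow> of_real (1 / (1 + t\<^sup>2)) * D y"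
    proof (intro AE_I2 tendsto_intros)
      fix t
      have "(\<lambda>n. y + d n * t) \<longlonglongrightarrow> y + 0 * t"
        by (intro tendsto_intros d)
      then show "(\<lambda>n. D (y + d n * t)) \<longlonglongrightarrow> D y"
        by (intro isCont_tendsto_compose[OF cont]) auto
    qed
    show "AE t in lborel. norm (of_real (1 / (1 + t\<^sup>2)) * D (y + d n * t)) \<le> B * (1 / (1 + t\<^sup>2))" for n
    proof (intro AE_I2)
      fix t :: real
      have "norm (of_real (1 / (1 + t\<^sup>2)) * D (y + d n * t)) = 1 / (1 + t\<^sup>2) * cmod (D (y + d n * t))"
        unfolding norm_mult norm_of_real by simp
      also have "\<dots> \<le> 1 / (1 + t\<^sup>2) * B"
        by (intro mult_left_mono bound) auto
      finally show "norm (of_real (1 / (1 + t\<^sup>2)) * D (y + d n * t)) \<le> B * (1 / (1 + t\<^sup>2))"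
        by (simp only: mult.commute)
    qed
  qed auto
  also have "(LINT t|lborel. of_real (1 / (1 + t\<^sup>2)) * D y) = of_real pi * D y"
    using has_bochner_integral_mult_left[OF has_bochner_integral_of_real[OF cauchy_density_integral], of "D y"]
    by (intro has_bochner_integral_integral_eq) simp
  finally show ?thesis
    unfolding eq .
qed

lemma exp_neg_set_integrable:
  assumes "Re p > 0"
  shows "set_integrable lborel {0<..} (\<lambda>x::real. exp (- p * of_real x))"
    and "(LINT x:{0<..}|lborel. exp (- p * of_real x)) = 1 / p"
proof -
  have einterval: "einterval 0 \<infinity> = {0::real<..}"
    by (auto simp: einterval_def)
  have lim0: "((\<lambda>x. exp (- Re p * x)) \<longlongrightarrow> 0) at_top"
    using assms by real_asymp
  have real_int: "set_integrable lborel (einterval 0 \<infinity>) (\<lambda>x. exp (- Re p * x))"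
  proof (rule interval_integral_FTC_nonneg[where F = "\<lambda>x. - exp (- Re p * x) / Re p" and A = "- 1 / Re p" and B = 0])
    show "DERIV (\<lambda>x. - exp (- Re p * x) / Re p) x :> exp (- Re p * x)" for x
      using assms by (auto intro!: derivative_eq_intros)
    show "(((\<lambda>x. - exp (- Re p * x) / Re p) \<circ> real_of_ereal) \<longlongrightarrow> - 1 / Re p) (at_right 0)"
      unfolding zero_ereal_def ereal_tendsto_simps using assms by (auto intro!: tendsto_eq_intros)
    show "(((\<lambda>x. - exp (- Re p * x) / Re p) \<circ> real_of_ereal) \<longlongrightarrow> 0) (at_left \<infinity>)"
      unfolding ereal_tendsto_simps using tendsto_divide[OF tendsto_minus[OF lim0] tendsto_const, of "Re p"] assms by simp
  qed (auto intro!: continuous_intros)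
  show int: "set_integrable lborel {0<..} (\<lambda>x::real. exp (- p * of_real x))"
    using real_int unfolding einterval
    by (rule set_integrable_bound) (auto simp: set_borel_measurable_def norm_exp_eq_Re)
  have "(LBINT x=0..\<infinity>. exp (- p * of_real x)) = 0 - (- 1 / p)"
  proof (rule interval_integral_FTC_integrable[where F = "\<lambda>x. - exp (- p * of_real x) / p"])
    show "((\<lambda>x. - exp (- p * of_real x) / p) has_vector_derivative exp (- p * of_real x)) (at x)" for x
      using assms by (auto intro!: derivative_eq_intros has_vector_derivative_real_field simp: field_simps)
    show "(((\<lambda>x. - exp (- p * of_real x) / p) \<circ> real_of_ereal) \<longlongrightarrow> - 1 / p) (at_right 0)"
      unfolding zero_ereal_def ereal_tendsto_simps using assms by (auto intro!: tendsto_eq_intros)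
    have "((\<lambda>x::real. exp (- p * of_real x)) \<longlongrightarrow> 0) at_top"
      by (rule tendsto_norm_zero_cancel) (use lim0 in \<open>simp add: norm_exp_eq_Re\<close>)
    moreover have "p \<noteq> 0"
      using assms by auto
    ultimately have "((\<lambda>x::real. - exp (- p * of_real x) / p) \<longlongrightarrow> - 0 / p) at_top"
      by (intro tendsto_intros)
    then show "(((\<lambda>x. - exp (- p * of_real x) / p) \<circ> real_of_ereal) \<longlongrightarrow> 0) (at_left \<infinity>)"
      unfolding ereal_tendsto_simps by simp
  qed (use int in \<open>auto intro!: continuous_intros simp: einterval\<close>)
  then show "(LINT x:{0<..}|lborel. exp (- p * of_real x)) = 1 / p"
    by (simp add: interval_lebesgue_integral_def einterval)
qed

lemma lborel_integral_split_at_0: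
  fixes f :: "real \<Rightarrow> complex"
  assumes "integrable lborel f"
  shows "(LINT x|lborel. f x) = (LINT x:{0<..}|lborel. f x) + (LINT x:{0<..}|lborel. f (- x))"
proof -
  have [measurable]: "f \<in> borel_measurable borel"
    using assms by auto
  have "(LINT x|lborel. f x) = (LINT x|lborel. indicator {0<..} x *\<^sub>R f x + indicator {..<0} x *\<^sub>R f x)"
  proof (intro integral_cong_AE)
    show "AE x in lborel. f x = indicator {0<..} x *\<^sub>R f x + indicator {..<0} x *\<^sub>R f x"
      using AE_lborel_singleton[of "0::real"] by eventually_elim (auto simp: indicator_def)
  qed auto
  also have "\<dots> = (LINT x|lborel. indicator {0<..} x *\<^sub>R f x) + (LINT x|lborel. indicator {..<0} x *\<^sub>R f x)"
    using assms by (intro Bochner_Integration.integral_add integrable_mult_indicator) auto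
  also have "(LINT x|lborel. indicator {..<0} x *\<^sub>R f x) = (LINT x|lborel. indicator {0<..} x *\<^sub>R f (- x))"
    by (subst lborel_integral_real_affine[where c = "-1" and t = 0]) (auto simp: indicator_def)
  finally show ?thesis
    by (simp add: set_lebesgue_integral_def)
qed

lemma set_integrable_reflect_UNIV:
  fixes f :: "real \<Rightarrow> complex"
  assumes "set_integrable lborel {0<..} f" and "set_integrable lborel {0<..} (\<lambda>x. f (- x))"
    and [measurable]: "f \<in> borel_measurable borel"
  shows "integrable lborel f"
proof -
  have "integrable lborel (\<lambda>x. indicator {0<..} (0 + (-1) * x) *\<^sub>R f (- (0 + (-1) * x)))"
    using assms(2) unfolding set_integrable_def
    by (intro lborel_integrable_real_affine) auto
  then have "integrable lborel (\<lambda>x. indicator {0<..} x *\<^sub>R f x + indicator {0<..} (- x) *\<^sub>R f x)"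
    using assms(1) unfolding set_integrable_def by (intro Bochner_Integration.integrable_add) auto
  then show ?thesis
  proof (rule integrable_cong_AE_imp)
    show "AE x in lborel. indicator {0<..} x *\<^sub>R f x + indicator {0<..} (- x) *\<^sub>R f x = f x"
      using AE_lborel_singleton[of "0::real"] by eventually_elim (auto simp: indicator_def)
  qed auto
qed

lemma exp_neg_abs_integrable:
  assumes "d > 0"
  shows "integrable lborel (\<lambda>\<xi>::real. complex_of_real (exp (- d * \<bar>\<xi>\<bar>)))"
proof (rule set_integrable_reflect_UNIV)
  show "set_integrable lborel {0<..} (\<lambda>\<xi>::real. complex_of_real (exp (- d * \<bar>\<xi>\<bar>)))"
    using exp_neg_set_integrable(1)[of "of_real d"] assms
    by (subst set_integrable_cong[where f' = "\<lambda>x. exp (- of_real d * of_real x)"])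
      (auto simp flip: exp_of_real)
  then show "set_integrable lborel {0<..} (\<lambda>\<xi>::real. complex_of_real (exp (- d * \<bar>- \<xi>\<bar>)))"
    by simp
qed auto

lemma fourier_exp_neg_abs:
  assumes "d > 0"
  shows "fourier (\<lambda>\<xi>. complex_of_real (exp (- d * \<bar>\<xi>\<bar>))) u = of_real (2 * poisson_kernel d u)"
proof -
  let ?p = "Complex d u"
  have eq1: "exp (- \<i> * complex_of_real (u * x)) * complex_of_real (exp (- d * \<bar>x\<bar>)) = exp (- ?p * of_real x)"
    if "x > 0" for x
    using that by (simp add: complex_eq_iff exp_of_real[symmetric] mult_exp_exp Complex_eq algebra_simps)
  have eq2: "exp (- \<i> * complex_of_real (u * - x)) * complex_of_real (exp (- d * \<bar>- x\<bar>)) = exp (- cnj ?p * of_real x)"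
    if "x > 0" for x
    using that by (simp add: complex_eq_iff exp_of_real[symmetric] mult_exp_exp Complex_eq algebra_simps)
  have "fourier (\<lambda>\<xi>. complex_of_real (exp (- d * \<bar>\<xi>\<bar>))) u
      = (LINT x:{0<..}|lborel. exp (- ?p * of_real x)) + (LINT x:{0<..}|lborel. exp (- cnj ?p * of_real x))"
    unfolding fourier_def
    by (subst lborel_integral_split_at_0[OF fourier_kernel_integrable[OF exp_neg_abs_integrable[OF assms]]])
      (intro arg_cong2[where f = "(+)"] set_lebesgue_integral_cong; use eq1 eq2 in auto)
  also have "\<dots> = 1 / ?p + 1 / cnj ?p"
    using assms by (subst (1 2) exp_neg_set_integrable(2)) auto
  also have "\<dots> = of_real (2 * poisson_kernel d u)"
    using assms sum_power2_gt_zero_iff[of d u]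
    by (auto simp: poisson_kernel_def complex_eq_iff Re_divide Im_divide add.commute power2_eq_square)
  finally show ?thesis .
qed

text \<open>
  The Abel factor \<open>exp (-d \<bar>\<xi>\<bar>)\<close> makes all integrals converge absolutely; its transform is twice
  the Poisson kernel, which is positive and tends to \<open>2 \<pi>\<close> times a point mass as \<open>d \<rightarrow> 0\<close>.
\<close>

lemma fourier_abel_parseval:
  assumes f: "integrable lborel f" and k: "integrable lborel k" and d: "d > 0"
  shows "(LINT \<xi>|lborel. fourier f \<xi> * (cnj (fourier k \<xi>) * of_real (exp (- d * \<bar>\<xi>\<bar>))))
    = 2 * (LINT x|lborel. f x * (LINT y|lborel. of_real (poisson_kernel d (y - x)) * cnj (k y)))"
proof -
  have ck: "integrable lborel (\<lambda>x. cnj (k x))"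
    using k by simp
  note exp_int = exp_neg_abs_integrable[OF d]
  have bounded_mult: "integrable lborel (\<lambda>\<xi>. h \<xi> * of_real (exp (- d * \<bar>\<xi>\<bar>)))"
    if [measurable]: "h \<in> borel_measurable borel" and "\<And>\<xi>. cmod (h \<xi>) \<le> C" for h :: "real \<Rightarrow> complex" and C
  proof (rule Bochner_Integration.integrable_bound)
    show "integrable lborel (\<lambda>\<xi>::real. of_real C * complex_of_real (exp (- d * \<bar>\<xi>\<bar>)))"
      using exp_int by (rule integrable_mult_right)
    show "AE \<xi> in lborel. norm (h \<xi> * of_real (exp (- d * \<bar>\<xi>\<bar>))) \<le> norm (of_real C * complex_of_real (exp (- d * \<bar>\<xi>\<bar>)))"
      using that(2) by (intro AE_I2) (auto simp: norm_mult intro!: mult_right_mono order_trans[OF that(2)])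
  qed measurable
  have [measurable]: "fourier k \<in> borel_measurable borel" "fourier (\<lambda>x. cnj (k x)) \<in> borel_measurable borel"
    using k ck fourier_measurable by auto
  have int1: "integrable lborel (\<lambda>\<xi>. cnj (fourier k \<xi>) * of_real (exp (- d * \<bar>\<xi>\<bar>)))"
  proof -
    have "integrable lborel (\<lambda>\<xi>. fourier (\<lambda>x. cnj (k x)) (- \<xi>) * of_real (exp (- d * \<bar>\<xi>\<bar>)))"
      by (rule bounded_mult[where C = "LINT x|lborel. cmod (cnj (k x))"])
        (measurable, rule fourier_norm_le[OF ck])
    then show ?thesis
      by (simp add: fourier_cnj)
  qed
  have inner: "fourier (\<lambda>\<xi>. cnj (fourier k \<xi>) * of_real (exp (- d * \<bar>\<xi>\<bar>))) x
      = 2 * (LINT y|lborel. of_real (poisson_kernel d (y - x)) * cnj (k y))" for x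
  proof -
    let ?e = "\<lambda>\<xi>. exp (\<i> * complex_of_real (\<xi> * x)) * of_real (exp (- d * \<bar>\<xi>\<bar>))"
    have "fourier (\<lambda>\<xi>. cnj (fourier k \<xi>) * of_real (exp (- d * \<bar>\<xi>\<bar>))) x
      = (LINT \<xi>|lborel. exp (- \<i> * complex_of_real (x * \<xi>)) * (cnj (fourier k \<xi>) * of_real (exp (- d * \<bar>\<xi>\<bar>))))"
      by (simp add: fourier_def)
    also have "\<dots> = (LINT \<xi>|lborel. fourier (\<lambda>x. cnj (k x)) \<xi> * ?e \<xi>)"
      by (subst lborel_integral_real_affine[where c = "-1" and t = 0])
        (auto simp: fourier_cnj ac_simps)
    also have "\<dots> = (LINT y|lborel. cnj (k y) * fourier ?e y)"
      using bounded_mult[where h = "\<lambda>\<xi>. exp (\<i> * complex_of_real (\<xi> * x))" and C = 1]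
      by (intro fourier_mult_formula ck) (auto simp: norm_exp_eq_Re)
    also have "\<dots> = (LINT y|lborel. 2 * (of_real (poisson_kernel d (y - x)) * cnj (k y)))"
    proof (intro Bochner_Integration.integral_cong refl)
      fix y
      have "fourier ?e y = fourier (\<lambda>\<xi>. complex_of_real (exp (- d * \<bar>\<xi>\<bar>))) (y - x)"
        unfolding fourier_def
      proof (intro Bochner_Integration.integral_cong refl)
        fix \<xi> :: real
        have "exp (- \<i> * complex_of_real (y * \<xi>)) * exp (\<i> * complex_of_real (\<xi> * x))
            = exp (- \<i> * complex_of_real ((y - x) * \<xi>))"
          unfolding mult_exp_exp by (simp add: algebra_simps)
        then show "exp (- \<i> * complex_of_real (y * \<xi>)) * ?e \<xi>
            = exp (- \<i> * complex_of_real ((y - x) * \<xi>)) * of_real (exp (- d * \<bar>\<xi>\<bar>))"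
          by (simp only: mult.assoc[symmetric])
      qed
      from this[unfolded fourier_exp_neg_abs[OF d]] show "cnj (k y) * fourier ?e y = 2 * (of_real (poisson_kernel d (y - x)) * cnj (k y))"
        by (simp only: of_real_mult of_real_numeral mult_ac)
    qed
    finally show ?thesis
      by simp
  qed
  show ?thesis
    unfolding fourier_mult_formula[OF f int1] inner
    by (simp only: mult.left_commute[of "f x" 2 for x] integral_mult_right_zero)
qed

lemma norm_integral_le_nn_integral:
  fixes f :: "'a \<Rightarrow> complex"
  shows "ennreal (cmod (integral\<^sup>L M f)) \<le> (\<integral>\<^sup>+ x. ennreal (cmod (f x)) \<partial>M)"
proof (cases "integrable M f")
  case True
  then show ?thesis
    by (rule integral_norm_bound_ennreal)
next
  case False
  then show ?thesis
    by (simp add: not_integrable_integral_eq)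
qed

text \<open>
  By \<open>2 \<bar>f(x) f(y)\<bar> \<le> \<bar>f(x)\<bar>\<^sup>2 + \<bar>f(y)\<bar>\<^sup>2\<close> and the mass \<open>\<pi>\<close> of the kernel in either variable, the bound
  is uniform in \<open>d\<close>, so that no convergence of the means in \<open>L\<^sup>2\<close> has to be known.
\<close>

lemma fourier_abel_sqnorm_le:
  assumes f: "integrable lborel f" and d: "d > 0"
  shows "(\<integral>\<^sup>+ \<xi>. ennreal ((cmod (fourier f \<xi>))\<^sup>2 * exp (- d * \<bar>\<xi>\<bar>)) \<partial>lborel) \<le> ennreal (2 * pi) * sqnorm f"
proof -
  have [measurable]: "f \<in> borel_measurable borel" "fourier f \<in> borel_measurable borel"
    using f fourier_measurable by auto
  let ?P = "\<lambda>x y. poisson_kernel d (y - x)"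
  let ?G = "\<lambda>x. LINT y|lborel. of_real (?P x y) * cnj (f y)"
  have int: "integrable lborel (\<lambda>\<xi>. (cmod (fourier f \<xi>))\<^sup>2 * exp (- d * \<bar>\<xi>\<bar>))"
  proof (rule Bochner_Integration.integrable_bound)
    show "integrable lborel (\<lambda>\<xi>. of_real ((LINT x|lborel. cmod (f x))\<^sup>2) * complex_of_real (exp (- d * \<bar>\<xi>\<bar>)))"
      by (intro integrable_mult_right exp_neg_abs_integrable d)
    show "AE \<xi> in lborel. norm ((cmod (fourier f \<xi>))\<^sup>2 * exp (- d * \<bar>\<xi>\<bar>))
        \<le> norm (of_real ((LINT x|lborel. cmod (f x))\<^sup>2) * complex_of_real (exp (- d * \<bar>\<xi>\<bar>)))"
      by (intro AE_I2) (auto simp: norm_mult norm_power intro!: power_mono fourier_norm_le f)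
  qed measurable
  have "(LINT \<xi>|lborel. fourier f \<xi> * (cnj (fourier f \<xi>) * of_real (exp (- d * \<bar>\<xi>\<bar>))))
      = of_real (LINT \<xi>|lborel. (cmod (fourier f \<xi>))\<^sup>2 * exp (- d * \<bar>\<xi>\<bar>))"
    unfolding integral_complex_of_real[symmetric]
    by (intro Bochner_Integration.integral_cong refl)
      (simp only: mult.assoc[symmetric] of_real_mult complex_norm_square)
  then have "of_real (LINT \<xi>|lborel. (cmod (fourier f \<xi>))\<^sup>2 * exp (- d * \<bar>\<xi>\<bar>))
      = 2 * (LINT x|lborel. f x * ?G x)"
    using fourier_abel_parseval[OF f f d] by simp
  then have "cmod (of_real (LINT \<xi>|lborel. (cmod (fourier f \<xi>))\<^sup>2 * exp (- d * \<bar>\<xi>\<bar>)))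
      = cmod (2 * (LINT x|lborel. f x * ?G x))"
    by (rule arg_cong)
  then have eq: "(LINT \<xi>|lborel. (cmod (fourier f \<xi>))\<^sup>2 * exp (- d * \<bar>\<xi>\<bar>)) = 2 * cmod (LINT x|lborel. f x * ?G x)"
    by (simp add: norm_mult)
  have "(\<integral>\<^sup>+ \<xi>. ennreal ((cmod (fourier f \<xi>))\<^sup>2 * exp (- d * \<bar>\<xi>\<bar>)) \<partial>lborel)
      = ennreal (2 * cmod (LINT x|lborel. f x * ?G x))"
    unfolding eq[symmetric] by (intro nn_integral_eq_integral int) auto
  also have "\<dots> = 2 * ennreal (cmod (LINT x|lborel. f x * ?G x))"
    by (simp add: ennreal_mult)
  also have "ennreal (cmod (LINT x|lborel. f x * ?G x)) \<le> (\<integral>\<^sup>+ x. ennreal (cmod (f x * ?G x)) \<partial>lborel)"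
    by (rule norm_integral_le_nn_integral)
  also have "\<dots> \<le> (\<integral>\<^sup>+ x. (\<integral>\<^sup>+ y. ennreal (?P x y / 2 * (cmod (f x))\<^sup>2) + ennreal (?P x y / 2 * (cmod (f y))\<^sup>2) \<partial>lborel) \<partial>lborel)"
  proof (intro nn_integral_mono)
    fix x
    have "ennreal (cmod (f x * ?G x)) = ennreal (cmod (f x)) * ennreal (cmod (?G x))"
      by (simp add: norm_mult ennreal_mult)
    also have "\<dots> \<le> ennreal (cmod (f x)) * (\<integral>\<^sup>+ y. ennreal (cmod (of_real (?P x y) * cnj (f y))) \<partial>lborel)"
      by (intro mult_left_mono norm_integral_le_nn_integral) auto
    also have "\<dots> = (\<integral>\<^sup>+ y. ennreal (cmod (f x)) * ennreal (cmod (of_real (?P x y) * cnj (f y))) \<partial>lborel)"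
      by (intro nn_integral_cmult[symmetric]) (simp add: norm_mult)
    also have "\<dots> \<le> (\<integral>\<^sup>+ y. ennreal (?P x y / 2 * (cmod (f x))\<^sup>2) + ennreal (?P x y / 2 * (cmod (f y))\<^sup>2) \<partial>lborel)"
    proof (intro nn_integral_mono)
      fix y
      have P: "?P x y \<ge> 0"
        using d by (rule poisson_kernel_nonneg)
      have "?P x y / 2 * (2 * cmod (f x) * cmod (f y)) \<le> ?P x y / 2 * ((cmod (f x))\<^sup>2 + (cmod (f y))\<^sup>2)"
        using P by (intro mult_left_mono sum_squares_bound) auto
      then have "cmod (f x) * cmod (of_real (?P x y) * cnj (f y))
          \<le> ?P x y / 2 * (cmod (f x))\<^sup>2 + ?P x y / 2 * (cmod (f y))\<^sup>2"
        using P by (simp add: norm_mult algebra_simps)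
      then show "ennreal (cmod (f x)) * ennreal (cmod (of_real (?P x y) * cnj (f y)))
          \<le> ennreal (?P x y / 2 * (cmod (f x))\<^sup>2) + ennreal (?P x y / 2 * (cmod (f y))\<^sup>2)"
        using P by (simp flip: ennreal_mult ennreal_plus add: ennreal_leI)
    qed
    finally show "ennreal (cmod (f x * ?G x))
        \<le> (\<integral>\<^sup>+ y. ennreal (?P x y / 2 * (cmod (f x))\<^sup>2) + ennreal (?P x y / 2 * (cmod (f y))\<^sup>2) \<partial>lborel)" .
  qed
  also have "\<dots> = (\<integral>\<^sup>+ x. (\<integral>\<^sup>+ y. ennreal (?P x y / 2 * (cmod (f x))\<^sup>2) \<partial>lborel) \<partial>lborel)
      + (\<integral>\<^sup>+ x. (\<integral>\<^sup>+ y. ennreal (?P x y / 2 * (cmod (f y))\<^sup>2) \<partial>lborel) \<partial>lborel)"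
    by (subst nn_integral_add[symmetric]) (auto simp: nn_integral_add)
  also have "(\<integral>\<^sup>+ x. (\<integral>\<^sup>+ y. ennreal (?P x y / 2 * (cmod (f y))\<^sup>2) \<partial>lborel) \<partial>lborel)
      = (\<integral>\<^sup>+ x. (\<integral>\<^sup>+ y. ennreal (?P x y / 2 * (cmod (f x))\<^sup>2) \<partial>lborel) \<partial>lborel)"
    by (subst lborel_pair.Fubini'[of "\<lambda>y x. ennreal (?P x y / 2 * (cmod (f y))\<^sup>2)"])
      (measurable, simp only: poisson_kernel_minus)
  also have "(\<integral>\<^sup>+ x. (\<integral>\<^sup>+ y. ennreal (?P x y / 2 * (cmod (f x))\<^sup>2) \<partial>lborel) \<partial>lborel)
      = (\<integral>\<^sup>+ x. ennreal (pi / 2) * ennreal ((cmod (f x))\<^sup>2) \<partial>lborel)"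
  proof (intro nn_integral_cong)
    fix x
    have "(\<integral>\<^sup>+ y. ennreal (?P x y / 2 * (cmod (f x))\<^sup>2) \<partial>lborel)
        = (\<integral>\<^sup>+ y. ennreal (?P x y) * ennreal ((cmod (f x))\<^sup>2 / 2) \<partial>lborel)"
      using poisson_kernel_nonneg[OF d] by (intro nn_integral_cong) (simp flip: ennreal_mult)
    also have "\<dots> = ennreal pi * ennreal ((cmod (f x))\<^sup>2 / 2)"
      by (subst nn_integral_multc) (auto simp: poisson_kernel_nn_integral[OF d])
    also have "\<dots> = ennreal (pi / 2) * ennreal ((cmod (f x))\<^sup>2)"
      by (simp flip: ennreal_mult)
    finally show "(\<integral>\<^sup>+ y. ennreal (?P x y / 2 * (cmod (f x))\<^sup>2) \<partial>lborel) = ennreal (pi / 2) * ennreal ((cmod (f x))\<^sup>2)" .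
  qed
  also have "\<dots> = ennreal (pi / 2) * sqnorm f"
    unfolding sqnorm_def by (rule nn_integral_cmult) auto
  finally have "(\<integral>\<^sup>+ \<xi>. ennreal ((cmod (fourier f \<xi>))\<^sup>2 * exp (- d * \<bar>\<xi>\<bar>)) \<partial>lborel)
      \<le> 2 * (ennreal (pi / 2) * sqnorm f + ennreal (pi / 2) * sqnorm f)"
    by (simp add: mult_left_mono)
  also have "\<dots> = (2 * (ennreal (pi / 2) + ennreal (pi / 2))) * sqnorm f"
    by (simp only: distrib_right mult.assoc)
  also have "2 * (ennreal (pi / 2) + ennreal (pi / 2)) = ennreal (2 * pi)"
    by (simp add: ennreal_mult flip: ennreal_plus)
  finally show ?thesis .
qed

definition null_scale :: "nat \<Rightarrow> real" where
  "null_scale n = inverse (real (Suc n))"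

lemma null_scale_pos: "null_scale n > 0"
  by (simp add: null_scale_def)

lemma null_scale_tendsto: "null_scale \<longlonglongrightarrow> 0"
  unfolding null_scale_def[abs_def] by (rule LIMSEQ_inverse_real_of_nat)

lemma abel_factor_tendsto: "(\<lambda>n. exp (- null_scale n * \<bar>\<xi>\<bar>)) \<longlonglongrightarrow> 1"
proof -
  have "(\<lambda>n. exp (- null_scale n * \<bar>\<xi>\<bar>)) \<longlonglongrightarrow> exp (- 0 * \<bar>\<xi>\<bar>)"
    by (intro tendsto_intros null_scale_tendsto)
  then show ?thesis by simp
qed

lemma abel_factor_le_1: "exp (- null_scale n * \<bar>\<xi>\<bar>) \<le> 1"
  using null_scale_pos[of n] by simp

lemma plancherel_le:
  assumes f: "integrable lborel f"
  shows "sqnorm (fourier f) \<le> ennreal (2 * pi) * sqnorm f"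
proof -
  have [measurable]: "fourier f \<in> borel_measurable borel"
    using f by (rule fourier_measurable)
  have "sqnorm (fourier f)
      = (\<integral>\<^sup>+ \<xi>. liminf (\<lambda>n. ennreal ((cmod (fourier f \<xi>))\<^sup>2 * exp (- null_scale n * \<bar>\<xi>\<bar>))) \<partial>lborel)"
    unfolding sqnorm_def
  proof (intro nn_integral_cong)
    fix \<xi>
    have "(\<lambda>n. (cmod (fourier f \<xi>))\<^sup>2 * exp (- null_scale n * \<bar>\<xi>\<bar>)) \<longlonglongrightarrow> (cmod (fourier f \<xi>))\<^sup>2 * 1"
      by (intro tendsto_intros abel_factor_tendsto)
    then have "(\<lambda>n. ennreal ((cmod (fourier f \<xi>))\<^sup>2 * exp (- null_scale n * \<bar>\<xi>\<bar>))) \<longlonglongrightarrow> ennreal ((cmod (fourier f \<xi>))\<^sup>2)"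
      by (intro tendsto_ennrealI) simp
    from lim_imp_Liminf[OF _ this]
    show "ennreal ((cmod (fourier f \<xi>))\<^sup>2) = liminf (\<lambda>n. ennreal ((cmod (fourier f \<xi>))\<^sup>2 * exp (- null_scale n * \<bar>\<xi>\<bar>)))"
      by simp
  qed
  also have "\<dots> \<le> liminf (\<lambda>n. \<integral>\<^sup>+ \<xi>. ennreal ((cmod (fourier f \<xi>))\<^sup>2 * exp (- null_scale n * \<bar>\<xi>\<bar>)) \<partial>lborel)"
    by (intro nn_integral_liminf) auto
  also have "\<dots> \<le> limsup (\<lambda>n. \<integral>\<^sup>+ \<xi>. ennreal ((cmod (fourier f \<xi>))\<^sup>2 * exp (- null_scale n * \<bar>\<xi>\<bar>)) \<partial>lborel)"
    by (intro Liminf_le_Limsup) simp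
  also have "\<dots> \<le> ennreal (2 * pi) * sqnorm f"
    by (intro Limsup_bounded always_eventually allI fourier_abel_sqnorm_le f null_scale_pos)
  finally show ?thesis .
qed

lemma fourier_in_L2:
  assumes "integrable lborel f" "f \<in> L2 UNIV"
  shows "fourier f \<in> L2 UNIV"
  unfolding L2_UNIV_iff_sqnorm
  using fourier_measurable[OF assms(1)] plancherel_le[OF assms(1)] L2_sqnorm_finite[OF assms(2)]
  by (auto intro: le_less_trans simp: ennreal_mult_less_top)

lemma indicator_complex_eq: "(indicator A :: real \<Rightarrow> complex) = (\<lambda>x. complex_of_real (indicator A x))"
  by (auto simp: indicator_def fun_eq_iff)

lemma indicator_interval_L1_L2:
  "integrable lborel (indicator {a..b} :: real \<Rightarrow> complex)" "(indicator {a..b} :: real \<Rightarrow> complex) \<in> L2 UNIV"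
proof -
  show "integrable lborel (indicator {a..b} :: real \<Rightarrow> complex)"
    unfolding indicator_complex_eq by (intro integrable_of_real integrable_real_indicator) (auto simp: emeasure_lborel_Icc_eq)
  have "(\<lambda>x. (cmod (indicator {a..b} x))\<^sup>2) = (indicator {a..b} :: real \<Rightarrow> real)"
    by (auto simp: indicator_def fun_eq_iff)
  then show "(indicator {a..b} :: real \<Rightarrow> complex) \<in> L2 UNIV"
    using integrable_real_indicator[of "{a..b}" lborel] by (simp add: L2_UNIV_iff emeasure_lborel_Icc_eq)
qed

text \<open>
  In the Abel means the Poisson kernel is moved onto the indicator, so that the limit \<open>d \<rightarrow> 0\<close> is a
  pointwise one away from the two endpoints. On the frequency side, the product of two
  square-integrable transforms is integrable and dominates.
\<close>

lemma fourier_parseval_indicator: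
  assumes f: "integrable lborel f" "f \<in> L2 UNIV"
  shows "(LINT \<xi>|lborel. fourier f \<xi> * cnj (fourier (indicator {a..b}) \<xi>))
    = of_real (2 * pi) * (LINT x|lborel. f x * indicator {a..b} x)"
proof -
  let ?k = "indicator {a..b} :: real \<Rightarrow> complex"
  note k = indicator_interval_L1_L2[of a b]
  have [measurable]: "f \<in> borel_measurable borel" "fourier f \<in> borel_measurable borel"
      "fourier ?k \<in> borel_measurable borel"
    using f k fourier_measurable by auto
  have [measurable]: "(\<lambda>\<xi>. cnj (fourier ?k \<xi>)) \<in> borel_measurable borel"
    using L2_cnj[OF fourier_in_L2[OF k]] by auto
  have int: "integrable lborel (\<lambda>\<xi>. fourier f \<xi> * cnj (fourier ?k \<xi>))"
    by (intro L2_mult_integrable L2_cnj fourier_in_L2 f k)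
  have lhs: "(\<lambda>n. LINT \<xi>|lborel. fourier f \<xi> * (cnj (fourier ?k \<xi>) * of_real (exp (- null_scale n * \<bar>\<xi>\<bar>))))
      \<longlonglongrightarrow> (LINT \<xi>|lborel. fourier f \<xi> * cnj (fourier ?k \<xi>))"
  proof (rule integral_dominated_convergence[where w = "\<lambda>\<xi>. cmod (fourier f \<xi> * cnj (fourier ?k \<xi>))"])
    show "AE \<xi> in lborel. (\<lambda>n. fourier f \<xi> * (cnj (fourier ?k \<xi>) * of_real (exp (- null_scale n * \<bar>\<xi>\<bar>))))
        \<longlonglongrightarrow> fourier f \<xi> * cnj (fourier ?k \<xi>)"
    proof (intro AE_I2)
      fix \<xi>
      have "(\<lambda>n. fourier f \<xi> * (cnj (fourier ?k \<xi>) * of_real (exp (- null_scale n * \<bar>\<xi>\<bar>))))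
        \<longlonglongrightarrow> fourier f \<xi> * (cnj (fourier ?k \<xi>) * of_real 1)"
        by (intro tendsto_intros abel_factor_tendsto)
      then show "(\<lambda>n. fourier f \<xi> * (cnj (fourier ?k \<xi>) * of_real (exp (- null_scale n * \<bar>\<xi>\<bar>))))
        \<longlonglongrightarrow> fourier f \<xi> * cnj (fourier ?k \<xi>)"
        by simp
    qed
    show "AE \<xi> in lborel. cmod (fourier f \<xi> * (cnj (fourier ?k \<xi>) * of_real (exp (- null_scale n * \<bar>\<xi>\<bar>))))
        \<le> cmod (fourier f \<xi> * cnj (fourier ?k \<xi>))" for n
    proof (intro AE_I2)
      fix \<xi>
      have "cmod (fourier f \<xi> * (cnj (fourier ?k \<xi>) * of_real (exp (- null_scale n * \<bar>\<xi>\<bar>))))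
          = cmod (fourier f \<xi> * cnj (fourier ?k \<xi>)) * exp (- null_scale n * \<bar>\<xi>\<bar>)"
        by (simp add: norm_mult)
      also have "\<dots> \<le> cmod (fourier f \<xi> * cnj (fourier ?k \<xi>))"
        by (intro mult_right_le_one_le abel_factor_le_1) auto
      finally show "cmod (fourier f \<xi> * (cnj (fourier ?k \<xi>) * of_real (exp (- null_scale n * \<bar>\<xi>\<bar>))))
        \<le> cmod (fourier f \<xi> * cnj (fourier ?k \<xi>))" .
    qed
  qed (use int in auto)
  let ?G = "\<lambda>n x. LINT y|lborel. of_real (poisson_kernel (null_scale n) (y - x)) * ?k y"
  have G_le: "cmod (?G n x) \<le> pi" for n x
  proof -
    have "ennreal (cmod (?G n x)) \<le> (\<integral>\<^sup>+ y. ennreal (cmod (of_real (poisson_kernel (null_scale n) (y - x)) * ?k y)) \<partial>lborel)"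
      by (rule norm_integral_le_nn_integral)
    also have "\<dots> \<le> (\<integral>\<^sup>+ y. ennreal (poisson_kernel (null_scale n) (y - x)) \<partial>lborel)"
      using poisson_kernel_nonneg[OF null_scale_pos[of n]]
      by (intro nn_integral_mono) (auto simp: norm_mult indicator_def)
    also have "\<dots> = ennreal pi"
      by (rule poisson_kernel_nn_integral[OF null_scale_pos])
    finally show ?thesis
      by simp
  qed
  have rhs: "(\<lambda>n. LINT x|lborel. f x * ?G n x) \<longlonglongrightarrow> (LINT x|lborel. f x * (of_real pi * ?k x))"
  proof (rule integral_dominated_convergence[where w = "\<lambda>x. cmod (f x) * pi"])
    show "AE x in lborel. (\<lambda>n. f x * ?G n x) \<longlonglongrightarrow> f x * (of_real pi * ?k x)"
      using AE_lborel_singleton[of a] AE_lborel_singleton[of b]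
    proof eventually_elim
      fix x assume x: "x \<noteq> a" "x \<noteq> b"
      have cont: "isCont ?k x"
      proof -
        have "x \<notin> frontier {a..b}"
          using x by (auto simp: frontier_def interior_atLeastAtMost_real)
        then have "isCont (indicator {a..b} :: real \<Rightarrow> real) x"
          by (simp only: isCont_indicator not_False_eq_True)
        then show ?thesis
          unfolding indicator_complex_eq by (rule continuous_of_real)
      qed
      have "cmod (?k y) \<le> 1" for y
        by (simp add: indicator_def)
      then show "(\<lambda>n. f x * ?G n x) \<longlonglongrightarrow> f x * (of_real pi * ?k x)"
        by (intro tendsto_mult tendsto_const
              poisson_kernel_approx_identity[OF _ _ cont null_scale_pos null_scale_tendsto]) measurable
    qed
    show "AE x in lborel. cmod (f x * ?G n x) \<le> cmod (f x) * pi" for n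
      using G_le by (intro AE_I2) (auto simp: norm_mult intro!: mult_left_mono)
    show "integrable lborel (\<lambda>x. cmod (f x) * pi)"
      using f by simp
  qed measurable
  have "(\<lambda>n. LINT \<xi>|lborel. fourier f \<xi> * (cnj (fourier ?k \<xi>) * of_real (exp (- null_scale n * \<bar>\<xi>\<bar>))))
      = (\<lambda>n. 2 * (LINT x|lborel. f x * ?G n x))"
  proof (intro ext)
    fix n
    have "cnj (?k y) = ?k y" for y
      by (simp add: indicator_def)
    then show "(LINT \<xi>|lborel. fourier f \<xi> * (cnj (fourier ?k \<xi>) * of_real (exp (- null_scale n * \<bar>\<xi>\<bar>))))
      = 2 * (LINT x|lborel. f x * ?G n x)"
      using fourier_abel_parseval[OF f(1) k(1) null_scale_pos[of n]] by simp
  qed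
  from lhs[unfolded this] tendsto_mult[OF tendsto_const rhs, of 2]
  have "(LINT \<xi>|lborel. fourier f \<xi> * cnj (fourier ?k \<xi>)) = 2 * (LINT x|lborel. f x * (of_real pi * ?k x))"
    by (rule LIMSEQ_unique)
  also have "(LINT x|lborel. f x * (of_real pi * ?k x)) = of_real pi * (LINT x|lborel. f x * ?k x)"
    by (simp only: mult.left_commute[of "f x" "of_real pi" for x] integral_mult_right_zero)
  finally show ?thesis
    by simp
qed

section \<open>The Fourier transform on square-integrable functions\<close>

lemma zero_ext_measurable:
  assumes "f \<in> L2 S" shows "zero_ext S f \<in> borel_measurable borel"
proof -
  have "(\<lambda>x. indicator S x *\<^sub>R f x) = zero_ext S f"
    by (auto simp: zero_ext_def indicator_def)
  then show ?thesis
    using assms by (simp add: L2_def set_borel_measurable_def)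
qed

lemma zero_ext_in_L2:
  assumes "f \<in> L2 S" shows "zero_ext S f \<in> L2 UNIV"
proof -
  have "(\<lambda>x. indicator S x *\<^sub>R (cmod (f x))\<^sup>2) = (\<lambda>x. (cmod (zero_ext S f x))\<^sup>2)"
    by (auto simp: zero_ext_def indicator_def)
  then show ?thesis
    unfolding L2_UNIV_iff using assms zero_ext_measurable[OF assms] by (simp add: L2_def set_integrable_def)
qed

lemma truncation_in_L2:
  assumes "f \<in> L2 UNIV" shows "zero_ext {a..b} f \<in> L2 UNIV"
proof (rule L2_dominated[where C = 1, OF _ assms])
  have "zero_ext {a..b} f = (\<lambda>x. indicator {a..b} x *\<^sub>R f x)"
    by (auto simp: zero_ext_def indicator_def)
  then show "zero_ext {a..b} f \<in> borel_measurable borel"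
    using assms by simp
qed (auto simp: zero_ext_def)

lemma L2_compact_support_integrable:
  assumes "f \<in> L2 UNIV" and "\<And>x. x \<notin> {a..b} \<Longrightarrow> f x = 0"
  shows "integrable lborel f"
proof -
  have "(\<lambda>x. f x * indicator {a..b} x) = f"
    using assms(2) by (auto simp: indicator_def fun_eq_iff)
  then show ?thesis
    using L2_mult_integrable[OF assms(1) indicator_interval_L1_L2(2)[of a b]] by simp
qed

lemma truncation_integrable:
  assumes "f \<in> L2 UNIV" shows "integrable lborel (zero_ext {a..b} f)"
  by (rule L2_compact_support_integrable[OF truncation_in_L2[OF assms], of a b a b])
    (auto simp: zero_ext_def)

lemma truncation_tendsto:
  assumes f: "f \<in> L2 UNIV"
  shows "(\<lambda>n. sqnorm (\<lambda>x. zero_ext {- real n..real n} f x - f x)) \<longlonglongrightarrow> 0"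
proof -
  have [measurable]: "f \<in> borel_measurable borel" "zero_ext {- real n..real n} f \<in> borel_measurable borel" for n
    using f truncation_in_L2[OF f] by auto
  have "(\<lambda>n. \<integral>\<^sup>+ x. ennreal ((cmod (zero_ext {- real n..real n} f x - f x))\<^sup>2) \<partial>lborel) \<longlonglongrightarrow> (\<integral>\<^sup>+ x. 0 \<partial>(lborel :: real measure))"
  proof (rule nn_integral_dominated_convergence[where w = "\<lambda>x. ennreal ((cmod (f x))\<^sup>2)"])
    show "AE x in lborel. ennreal ((cmod (zero_ext {- real n..real n} f x - f x))\<^sup>2) \<le> ennreal ((cmod (f x))\<^sup>2)" for n
      by (auto simp: zero_ext_def)
    show "AE x in lborel. (\<lambda>n. ennreal ((cmod (zero_ext {- real n..real n} f x - f x))\<^sup>2)) \<longlonglongrightarrow> 0"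
    proof (intro AE_I2)
      fix x
      obtain N :: nat where N: "\<bar>x\<bar> \<le> real N"
        using real_arch_simple by blast
      have "\<forall>\<^sub>F n in sequentially. ennreal ((cmod (zero_ext {- real n..real n} f x - f x))\<^sup>2) = 0"
        using eventually_ge_at_top[of N]
      proof eventually_elim
        case (elim n)
        then have "\<bar>x\<bar> \<le> real n"
          using N by linarith
        then show ?case
          by (simp add: zero_ext_def abs_le_iff)
      qed
      then show "(\<lambda>n. ennreal ((cmod (zero_ext {- real n..real n} f x - f x))\<^sup>2)) \<longlonglongrightarrow> 0"
        by (rule tendsto_eventually)
    qed
    show "(\<integral>\<^sup>+ x. ennreal ((cmod (f x))\<^sup>2) \<partial>lborel) < \<infinity>"
      using L2_sqnorm_finite[OF f] by (simp add: sqnorm_def)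
  qed measurable
  then show ?thesis
    by (simp add: sqnorm_def)
qed

text \<open>
  The weights \<open>4 ^ k\<close> do the work: \<open>\<Sum>k. 4 ^ k * \<bar>F (r (k + 1)) - F (r k)\<bar>\<^sup>2\<close> has a finite
  integral along a fast subsequence, hence is finite almost everywhere, and this forces
  \<open>\<bar>F (r (k + 1)) - F (r k)\<bar>\<close> to decay like \<open>2 ^ - k\<close> at almost every point.
\<close>

lemma L2_complete:
  assumes F: "\<And>n. F n \<in> L2 UNIV"
    and cauchy: "\<And>e. e > 0 \<Longrightarrow> \<exists>N. \<forall>m\<ge>N. \<forall>n\<ge>N. sqnorm (\<lambda>x. F m x - F n x) \<le> ennreal e"
  shows "\<exists>f \<in> L2 UNIV. (\<lambda>n. sqnorm (\<lambda>x. F n x - f x)) \<longlonglongrightarrow> 0"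
proof -
  have [measurable]: "F n \<in> borel_measurable borel" for n
    using F by auto
  have "\<exists>N. \<forall>k. \<forall>m\<ge>N k. \<forall>n\<ge>N k. sqnorm (\<lambda>x. F m x - F n x) \<le> ennreal ((1/8) ^ k)"
    by (rule choice) (auto intro!: cauchy)
  then obtain N where N: "\<And>k m n. m \<ge> N k \<Longrightarrow> n \<ge> N k \<Longrightarrow> sqnorm (\<lambda>x. F m x - F n x) \<le> ennreal ((1/8) ^ k)"
    by blast
  \<comment> \<open>The summand \<open>k\<close> only forces \<open>r\<close> to tend to infinity, which Fatou's lemma below needs.\<close>
  define r where "r k = k + (\<Sum>i\<le>k. N i)" for k
  have r_N: "r k \<ge> N k" and r_Suc: "r (Suc k) \<ge> N k" and r_id: "r k \<ge> k" for k
  proof -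
    have "N k \<le> (\<Sum>i\<le>k. N i)"
      by (rule member_le_sum) auto
    then show "r k \<ge> N k" "r (Suc k) \<ge> N k" "r k \<ge> k"
      by (auto simp: r_def)
  qed
  define D where "D k x = F (r (Suc k)) x - F (r k) x" for k x
  have [measurable]: "D k \<in> borel_measurable borel" for k
    unfolding D_def by measurable
  have "(\<integral>\<^sup>+ x. (\<Sum>k. ennreal (4 ^ k * (cmod (D k x))\<^sup>2)) \<partial>lborel)
      = (\<Sum>k. \<integral>\<^sup>+ x. ennreal (4 ^ k * (cmod (D k x))\<^sup>2) \<partial>lborel)"
    by (rule nn_integral_suminf) measurable
  also have "\<dots> \<le> (\<Sum>k. ennreal ((1/2) ^ k))"
  proof (intro suminf_le)
    fix k
    have "(\<integral>\<^sup>+ x. ennreal (4 ^ k * (cmod (D k x))\<^sup>2) \<partial>lborel) = ennreal (4 ^ k) * sqnorm (D k)"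
      unfolding sqnorm_def by (subst nn_integral_cmult[symmetric]) (auto simp: ennreal_mult)
    also have "\<dots> \<le> ennreal (4 ^ k) * ennreal ((1/8) ^ k)"
      unfolding D_def by (intro mult_left_mono N r_N r_Suc) auto
    also have "\<dots> = ennreal ((1/2) ^ k)"
      by (simp add: ennreal_mult[symmetric] power_mult_distrib[symmetric])
    finally show "(\<integral>\<^sup>+ x. ennreal (4 ^ k * (cmod (D k x))\<^sup>2) \<partial>lborel) \<le> ennreal ((1/2) ^ k)" .
  qed auto
  also have "\<dots> < \<infinity>"
    by (subst suminf_ennreal2) auto
  finally have "AE x in lborel. (\<Sum>k. ennreal (4 ^ k * (cmod (D k x))\<^sup>2)) \<noteq> \<infinity>"
    by (intro nn_integral_PInf_AE) auto
  then have conv: "AE x in lborel. convergent (\<lambda>k. F (r k) x)"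
  proof eventually_elim
    fix x assume "(\<Sum>k. ennreal (4 ^ k * (cmod (D k x))\<^sup>2)) \<noteq> \<infinity>"
    then have "summable (\<lambda>k. 4 ^ k * (cmod (D k x))\<^sup>2)"
      by (intro summable_suminf_not_top) auto
    then have "Bseq (\<lambda>k. 4 ^ k * (cmod (D k x))\<^sup>2)"
      by (intro convergent_imp_Bseq) (auto simp: convergent_def intro: summable_LIMSEQ_zero)
    then obtain B where B: "B > 0" "\<And>k. norm (4 ^ k * (cmod (D k x))\<^sup>2) \<le> B"
      by (auto simp: Bseq_def)
    have "cmod (D k x) \<le> sqrt B * (1/2) ^ k" for k
    proof -
      have "(2 ^ k * cmod (D k x))\<^sup>2 \<le> B"
        using B(2)[of k] by (simp add: power_mult_distrib power_mult[symmetric] mult.commute[of k 2] power_mult)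
      then have "2 ^ k * cmod (D k x) \<le> sqrt B"
        by (rule real_le_rsqrt)
      then show ?thesis
        by (simp add: field_simps power_one_over)
    qed
    then have "summable (\<lambda>k. D k x)"
      by (intro summable_comparison_test[OF _ summable_mult[OF summable_geometric]]) auto
    then have "convergent (\<lambda>n. F (r 0) x + (\<Sum>k<n. D k x))"
      by (intro convergent_add convergent_const) (simp add: summable_iff_convergent)
    moreover have "F (r 0) x + (\<Sum>k<n. D k x) = F (r n) x" for n
      unfolding D_def by (subst sum_lessThan_telescope) simp
    ultimately show "convergent (\<lambda>k. F (r k) x)"
      by simp
  qed
  define f where "f x = lim (\<lambda>k. F (r k) x)" for x
  have [measurable]: "f \<in> borel_measurable borel"
    unfolding f_def by measurable
  have lim: "AE x in lborel. (\<lambda>k. F (r k) x) \<longlonglongrightarrow> f x"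
    using conv by eventually_elim (simp add: f_def convergent_LIMSEQ_iff)
  have fatou: "sqnorm (\<lambda>x. F m x - f x) \<le> ennreal e"
    if N': "\<forall>m\<ge>N'. \<forall>n\<ge>N'. sqnorm (\<lambda>x. F m x - F n x) \<le> ennreal e" and m: "m \<ge> N'" for m N' e
  proof -
    have "sqnorm (\<lambda>x. F m x - f x) = (\<integral>\<^sup>+ x. liminf (\<lambda>k. ennreal ((cmod (F m x - F (r k) x))\<^sup>2)) \<partial>lborel)"
      unfolding sqnorm_def
    proof (intro nn_integral_cong_AE, use lim in eventually_elim)
      fix x assume "(\<lambda>k. F (r k) x) \<longlonglongrightarrow> f x"
      then have "(\<lambda>k. ennreal ((cmod (F m x - F (r k) x))\<^sup>2)) \<longlonglongrightarrow> ennreal ((cmod (F m x - f x))\<^sup>2)"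
        by (intro tendsto_intros)
      from lim_imp_Liminf[OF _ this]
      show "ennreal ((cmod (F m x - f x))\<^sup>2) = liminf (\<lambda>k. ennreal ((cmod (F m x - F (r k) x))\<^sup>2))"
        by simp
    qed
    also have "\<dots> \<le> liminf (\<lambda>k. \<integral>\<^sup>+ x. ennreal ((cmod (F m x - F (r k) x))\<^sup>2) \<partial>lborel)"
      by (intro nn_integral_liminf) measurable
    also have "\<dots> \<le> limsup (\<lambda>k. \<integral>\<^sup>+ x. ennreal ((cmod (F m x - F (r k) x))\<^sup>2) \<partial>lborel)"
      by (intro Liminf_le_Limsup) simp
    also have "\<dots> \<le> ennreal e"
    proof (intro Limsup_bounded eventually_sequentiallyI)
      fix k assume "k \<ge> N'"
      then have "r k \<ge> N'"
        using r_id[of k] by simp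
      then show "(\<integral>\<^sup>+ x. ennreal ((cmod (F m x - F (r k) x))\<^sup>2) \<partial>lborel) \<le> ennreal e"
        using N' m by (simp add: sqnorm_def)
    qed
    finally show ?thesis .
  qed
  have "f \<in> L2 UNIV"
  proof -
    obtain N' where N': "\<forall>m\<ge>N'. \<forall>n\<ge>N'. sqnorm (\<lambda>x. F m x - F n x) \<le> ennreal 1"
      using cauchy[of 1] by auto
    from fatou[OF this, of N'] have "sqnorm (\<lambda>x. F N' x - f x) < \<infinity>"
      by (auto intro: le_less_trans)
    then have "(\<lambda>x. F N' x - f x) \<in> L2 UNIV"
      by (simp add: L2_UNIV_iff_sqnorm)
    from L2_diff[OF F[of N'] this] show ?thesis
      by simp
  qed
  moreover have "(\<lambda>n. sqnorm (\<lambda>x. F n x - f x)) \<longlonglongrightarrow> 0"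
  proof (rule tendsto_zero_ennreal)
    fix e :: real assume e: "0 < e"
    then obtain N' where N': "\<forall>m\<ge>N'. \<forall>n\<ge>N'. sqnorm (\<lambda>x. F m x - F n x) \<le> ennreal (e / 2)"
      using cauchy[of "e / 2"] by auto
    show "\<forall>\<^sub>F n in sequentially. sqnorm (\<lambda>x. F n x - f x) < ennreal e"
      using eventually_ge_at_top[of N']
    proof eventually_elim
      case (elim n)
      have "sqnorm (\<lambda>x. F n x - f x) \<le> ennreal (e / 2)"
        by (rule fatou[OF N' elim])
      also have "\<dots> < ennreal e"
        using e by (simp add: ennreal_lessI)
      finally show ?case .
    qed
  qed
  ultimately show ?thesis
    by blast
qed

lemma sqnorm_diff_triangle:
  assumes "f \<in> borel_measurable borel" "g \<in> borel_measurable borel" "h \<in> borel_measurable borel"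
  shows "sqnorm (\<lambda>x. f x - g x) \<le> 2 * sqnorm (\<lambda>x. f x - h x) + 2 * sqnorm (\<lambda>x. g x - h x)"
  using sqnorm_diff_le[of "\<lambda>x. f x - h x" "\<lambda>x. g x - h x"] assms by simp

lemma sqnorm_limit_unique:
  assumes F: "\<And>n. F n \<in> borel_measurable borel" "f \<in> borel_measurable borel" "g \<in> borel_measurable borel"
    and lim: "(\<lambda>n. sqnorm (\<lambda>x. F n x - f x)) \<longlonglongrightarrow> 0" "(\<lambda>n. sqnorm (\<lambda>x. F n x - g x)) \<longlonglongrightarrow> 0"
  shows "AE x in lborel. f x = g x"
proof -
  have "(\<lambda>n. 2 * sqnorm (\<lambda>x. F n x - f x) + 2 * sqnorm (\<lambda>x. F n x - g x)) \<longlonglongrightarrow> 2 * 0 + 2 * 0"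
    using lim by (intro tendsto_add ennreal_tendsto_cmult) auto
  then have "sqnorm (\<lambda>x. f x - g x) \<le> 2 * 0 + 2 * 0"
    using sqnorm_diff_triangle[OF F(2,3) F(1)]
    by (intro LIMSEQ_le_const) (auto simp: sqnorm_minus_commute[of _ "F _"])
  then have "AE x in lborel. f x - g x = 0"
    using F by (intro sqnorm_eq_0) auto
  then show ?thesis
    by eventually_elim simp
qed

text \<open>
  The transforms of the truncations form a Cauchy sequence by \<open>plancherel_le\<close>.
\<close>

lemma fourier_L2_exists:
  assumes f: "f \<in> L2 UNIV"
  shows "\<exists>F. F \<in> L2 UNIV \<and> (\<lambda>n. sqnorm (\<lambda>\<xi>. fourier (zero_ext {- real n..real n} f) \<xi> - F \<xi>)) \<longlonglongrightarrow> 0"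
proof -
  let ?T = "\<lambda>n. zero_ext {- real n..real n} f"
  have T: "?T n \<in> L2 UNIV" "integrable lborel (?T n)" for n
    using truncation_in_L2[OF f] truncation_integrable[OF f] by auto
  have bound: "sqnorm (\<lambda>\<xi>. fourier (?T m) \<xi> - fourier (?T n) \<xi>)
      \<le> ennreal (4 * pi) * (sqnorm (\<lambda>x. ?T m x - f x) + sqnorm (\<lambda>x. ?T n x - f x))" for m n
  proof -
    have "sqnorm (\<lambda>\<xi>. fourier (?T m) \<xi> - fourier (?T n) \<xi>) = sqnorm (fourier (\<lambda>x. ?T m x - ?T n x))"
      by (simp add: sqnorm_def fourier_diff[OF T(2) T(2)])
    also have "\<dots> \<le> ennreal (2 * pi) * sqnorm (\<lambda>x. ?T m x - ?T n x)"
      by (intro plancherel_le Bochner_Integration.integrable_diff T)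
    also have "\<dots> \<le> ennreal (2 * pi) * (2 * sqnorm (\<lambda>x. ?T m x - f x) + 2 * sqnorm (\<lambda>x. ?T n x - f x))"
      using T f by (intro mult_left_mono sqnorm_diff_triangle) auto
    also have "\<dots> = (ennreal (2 * pi) * 2) * (sqnorm (\<lambda>x. ?T m x - f x) + sqnorm (\<lambda>x. ?T n x - f x))"
      by (simp only: distrib_left mult.assoc)
    also have "ennreal (2 * pi) * 2 = ennreal (4 * pi)"
      by (simp add: ennreal_mult[symmetric] flip: ennreal_numeral)
    finally show ?thesis .
  qed
  have "\<exists>F \<in> L2 UNIV. (\<lambda>n. sqnorm (\<lambda>\<xi>. fourier (?T n) \<xi> - F \<xi>)) \<longlonglongrightarrow> 0"
  proof (rule L2_complete)
    show "fourier (?T n) \<in> L2 UNIV" for n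
      by (intro fourier_in_L2 T)
    fix e :: real assume e: "e > 0"
    have "\<forall>\<^sub>F n in sequentially. sqnorm (\<lambda>x. ?T n x - f x) < ennreal (e / (8 * pi))"
      using e by (intro order_tendstoD(2)[OF truncation_tendsto[OF f]]) auto
    then obtain N where N: "\<And>n. n \<ge> N \<Longrightarrow> sqnorm (\<lambda>x. ?T n x - f x) \<le> ennreal (e / (8 * pi))"
      unfolding eventually_sequentially by (meson less_imp_le)
    show "\<exists>N. \<forall>m\<ge>N. \<forall>n\<ge>N. sqnorm (\<lambda>\<xi>. fourier (?T m) \<xi> - fourier (?T n) \<xi>) \<le> ennreal e"
    proof (intro exI[of _ N] allI impI)
      fix m n assume "m \<ge> N" "n \<ge> N"
      then have "sqnorm (\<lambda>\<xi>. fourier (?T m) \<xi> - fourier (?T n) \<xi>)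
          \<le> ennreal (4 * pi) * (ennreal (e / (8 * pi)) + ennreal (e / (8 * pi)))"
        by (intro order_trans[OF bound] mult_left_mono add_mono N) auto
      also have "\<dots> = ennreal e"
        using e by (simp flip: ennreal_mult ennreal_plus)
      finally show "sqnorm (\<lambda>\<xi>. fourier (?T m) \<xi> - fourier (?T n) \<xi>) \<le> ennreal e" .
    qed
  qed
  then show ?thesis
    by blast
qed

lemma
  assumes "f \<in> L2 UNIV"
  shows fourier_L2_in_L2: "fourier_L2 f \<in> L2 UNIV"
    and fourier_L2_limit: "(\<lambda>n. sqnorm (\<lambda>\<xi>. fourier (zero_ext {- real n..real n} f) \<xi> - fourier_L2 f \<xi>)) \<longlonglongrightarrow> 0"
  using someI_ex[OF fourier_L2_exists[OF assms]] unfolding fourier_L2_def sqnorm_def by auto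

lemma fourier_L2_unique:
  assumes "f \<in> L2 UNIV" "F \<in> L2 UNIV"
    and "(\<lambda>n. sqnorm (\<lambda>\<xi>. fourier (zero_ext {- real n..real n} f) \<xi> - F \<xi>)) \<longlonglongrightarrow> 0"
  shows "AE \<xi> in lborel. fourier_L2 f \<xi> = F \<xi>"
  using fourier_measurable[OF truncation_integrable[OF assms(1)]] fourier_L2_in_L2[OF assms(1)] assms(2)
  by (intro sqnorm_limit_unique[OF _ _ _ fourier_L2_limit[OF assms(1)] assms(3)]) auto

lemma fourier_L2_diff:
  assumes f: "f \<in> L2 UNIV" and g: "g \<in> L2 UNIV"
  shows "AE \<xi> in lborel. fourier_L2 (\<lambda>x. f x - g x) \<xi> = fourier_L2 f \<xi> - fourier_L2 g \<xi>"
proof (rule fourier_L2_unique[OF L2_diff[OF f g] L2_diff[OF fourier_L2_in_L2[OF f] fourier_L2_in_L2[OF g]]])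
  let ?T = "\<lambda>f n. zero_ext {- real n..real n} f"
  have meas: "fourier (?T f n) \<in> borel_measurable borel" "fourier (?T g n) \<in> borel_measurable borel"
      "fourier_L2 f \<in> borel_measurable borel" "fourier_L2 g \<in> borel_measurable borel" for n
    by (intro fourier_measurable truncation_integrable f g L2_measurable fourier_L2_in_L2)+
  have eq: "fourier (?T (\<lambda>x. f x - g x) n) \<xi> = fourier (?T f n) \<xi> - fourier (?T g n) \<xi>" for n \<xi>
    by (subst fourier_diff[OF truncation_integrable[OF f] truncation_integrable[OF g], symmetric])
      (intro arg_cong2[where f = fourier], auto simp: zero_ext_def)
  have regroup: "(a - b) - (c - d) = (a - c) - (b - d)" for a b c d :: complex
    by simp
  have le: "sqnorm (\<lambda>\<xi>. fourier (?T (\<lambda>x. f x - g x) n) \<xi> - (fourier_L2 f \<xi> - fourier_L2 g \<xi>))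
     \<le> 2 * sqnorm (\<lambda>\<xi>. fourier (?T f n) \<xi> - fourier_L2 f \<xi>) + 2 * sqnorm (\<lambda>\<xi>. fourier (?T g n) \<xi> - fourier_L2 g \<xi>)" for n
    using sqnorm_diff_le[of "\<lambda>\<xi>. fourier (?T f n) \<xi> - fourier_L2 f \<xi>" "\<lambda>\<xi>. fourier (?T g n) \<xi> - fourier_L2 g \<xi>"] meas
    unfolding eq regroup[of "fourier (?T f n) _"] by simp
  have "(\<lambda>n. 2 * sqnorm (\<lambda>\<xi>. fourier (?T f n) \<xi> - fourier_L2 f \<xi>) + 2 * sqnorm (\<lambda>\<xi>. fourier (?T g n) \<xi> - fourier_L2 g \<xi>))
     \<longlonglongrightarrow> 2 * 0 + 2 * 0"
    by (intro tendsto_add ennreal_tendsto_cmult fourier_L2_limit f g) auto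
  then have lim: "(\<lambda>n. 2 * sqnorm (\<lambda>\<xi>. fourier (?T f n) \<xi> - fourier_L2 f \<xi>) + 2 * sqnorm (\<lambda>\<xi>. fourier (?T g n) \<xi> - fourier_L2 g \<xi>))
     \<longlonglongrightarrow> 0"
    by simp
  show "(\<lambda>n. sqnorm (\<lambda>\<xi>. fourier (?T (\<lambda>x. f x - g x) n) \<xi> - (fourier_L2 f \<xi> - fourier_L2 g \<xi>))) \<longlonglongrightarrow> 0"
    by (rule tendsto_sandwich[OF always_eventually always_eventually tendsto_const lim]) (use le in auto)
qed

lemma fourier_L2_eq_fourier:
  assumes f: "f \<in> L2 UNIV" and supp: "\<And>x. x \<notin> {- real N..real N} \<Longrightarrow> f x = 0"
  shows "AE \<xi> in lborel. fourier_L2 f \<xi> = fourier f \<xi>"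
proof (rule fourier_L2_unique[OF f fourier_in_L2[OF L2_compact_support_integrable[OF f supp] f]])
  show "(\<lambda>n. sqnorm (\<lambda>\<xi>. fourier (zero_ext {- real n..real n} f) \<xi> - fourier f \<xi>)) \<longlonglongrightarrow> 0"
  proof (intro tendsto_eventually eventually_sequentiallyI)
    fix n assume "n \<ge> N"
    then have "zero_ext {- real n..real n} f = f"
    proof (intro ext)
      fix x show "zero_ext {- real n..real n} f x = f x"
        using \<open>n \<ge> N\<close> supp[of x] by (cases "x \<in> {- real n..real n}") (auto simp: zero_ext_def)
    qed
    then show "sqnorm (\<lambda>\<xi>. fourier (zero_ext {- real n..real n} f) \<xi> - fourier f \<xi>) = 0"
      by (simp add: sqnorm_def)
  qed
qed

text \<open>
  The sets over which \<open>h\<close> integrates to zero form a Dynkin system; the hypothesis on the total integral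
  provides the complements.
\<close>

lemma AE_zero_if_interval_integrals_zero:
  fixes h :: "real \<Rightarrow> complex"
  assumes h: "integrable lborel h" and total: "(LINT x|lborel. h x) = 0"
    and int: "\<And>a b. a \<le> b \<Longrightarrow> (LINT x:{a..b}|lborel. h x) = 0"
  shows "AE x in lborel. h x = 0"
proof (rule sigma_finite_measure.density_zero[OF sigma_finite_lborel h])
  have set_int: "set_integrable lborel A h" if "A \<in> sets borel" for A
    using h that unfolding set_integrable_def by (intro integrable_mult_indicator) auto
  fix A :: "real set" assume "A \<in> sets lborel"
  then have "A \<in> sets borel" by simp
  then show "(LINT x:A|lborel. h x) = 0"
  proof (induction rule: borel_set_induct)
    case (compl A)
    have "(LINT x:(A \<union> - A)|lborel. h x) = (LINT x:A|lborel. h x) + (LINT x:-A|lborel. h x)"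
      using compl by (intro set_integral_Un set_int) auto
    then show ?case
      using compl total by (simp add: set_lebesgue_integral_def)
  next
    case (union f)
    have "(LINT x:(\<Union>i. f i)|lborel. h x) = (\<Sum>i. LINT x:f i|lborel. h x)"
    proof (intro lebesgue_integral_countable_add set_int)
      show "f i \<inter> f j = {}" if "i \<noteq> j" for i j
        using union(1) that by (auto simp: disjoint_family_on_def)
    qed (use union(2) in auto)
    then show ?case
      by (simp only: union(3)) simp
  qed (auto simp: int set_lebesgue_integral_def[where A = "{}"])
qed

text \<open>
  Parseval's formula against indicators passes to the limit of the truncations, so a vanishing
  transform makes the integral of \<open>f\<close> over every interval vanish.
\<close>

lemma fourier_L2_injective:
  assumes f: "f \<in> L2 UNIV" and zero: "AE \<xi> in lborel. fourier_L2 f \<xi> = 0"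
  shows "AE x in lborel. f x = 0"
proof -
  let ?T = "\<lambda>n. zero_ext {- real n..real n} f"
  have [measurable]: "f \<in> borel_measurable borel" "fourier_L2 f \<in> borel_measurable borel"
    using f fourier_L2_in_L2[OF f] by auto
  have interval: "(LINT x|lborel. f x * indicator {a..b} x) = 0" for a b
  proof -
    let ?k = "indicator {a..b} :: real \<Rightarrow> complex"
    have k: "(\<lambda>\<xi>. cnj (fourier ?k \<xi>)) \<in> L2 UNIV"
      by (intro L2_cnj fourier_in_L2 indicator_interval_L1_L2)
    have "(\<lambda>n. LINT \<xi>|lborel. fourier (?T n) \<xi> * cnj (fourier ?k \<xi>)) \<longlonglongrightarrow> (LINT \<xi>|lborel. fourier_L2 f \<xi> * cnj (fourier ?k \<xi>))"
      by (intro L2_integral_mult_tendsto fourier_L2_limit fourier_in_L2 truncation_integrable truncation_in_L2 fourier_L2_in_L2 f k)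
    also have "(LINT \<xi>|lborel. fourier_L2 f \<xi> * cnj (fourier ?k \<xi>)) = (LINT \<xi>|(lborel :: real measure). 0)"
      using zero k by (intro integral_cong_AE) auto
    finally have "(\<lambda>n. of_real (2 * pi) * (LINT x|lborel. ?T n x * ?k x)) \<longlonglongrightarrow> 0"
      by (simp add: fourier_parseval_indicator[OF truncation_integrable[OF f] truncation_in_L2[OF f]])
    moreover have "(\<lambda>n. of_real (2 * pi) * (LINT x|lborel. ?T n x * ?k x)) \<longlonglongrightarrow> of_real (2 * pi) * (LINT x|lborel. f x * ?k x)"
      by (intro tendsto_intros L2_integral_mult_tendsto truncation_tendsto truncation_in_L2 f indicator_interval_L1_L2)
    ultimately have "of_real (2 * pi) * (LINT x|lborel. f x * ?k x) = 0"
      by (intro LIMSEQ_unique)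
    then show ?thesis
      by simp
  qed
  have "AE x in lborel. ?T n x = 0" for n
  proof (rule AE_zero_if_interval_integrals_zero[OF truncation_integrable[OF f]])
    have "(LINT x|lborel. ?T n x) = (LINT x|lborel. f x * indicator {- real n..real n} x)"
      by (intro Bochner_Integration.integral_cong) (auto simp: zero_ext_def)
    then show "(LINT x|lborel. ?T n x) = 0"
      by (simp only: interval)
    fix a b :: real
    have "(LINT x:{a..b}|lborel. ?T n x) = (LINT x|lborel. f x * indicator {max a (- real n)..min b (real n)} x)"
      unfolding set_lebesgue_integral_def
      by (intro Bochner_Integration.integral_cong) (auto simp: zero_ext_def indicator_def)
    then show "(LINT x:{a..b}|lborel. ?T n x) = 0"
      by (simp only: interval)
  qed
  then have "AE x in lborel. \<forall>n. ?T n x = 0"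
    by (simp add: AE_all_countable)
  then show ?thesis
  proof eventually_elim
    fix x assume *: "\<forall>n. ?T n x = 0"
    obtain N :: nat where "\<bar>x\<bar> \<le> real N"
      using real_arch_simple by blast
    then show "f x = 0"
      using *[rule_format, of N] by (auto simp: zero_ext_def abs_le_iff split: if_splits)
  qed
qed

section \<open>Test functions and uniqueness of the solution\<close>

lemma test_functionE:
  assumes "\<phi> \<in> test_functions \<Omega>"
  obtains D where "D 0 = \<phi>" and "\<And>k x. (D k has_vector_derivative D (Suc k) x) (at x)"
    and "compact (closure {x. \<phi> x \<noteq> 0})" and "closure {x. \<phi> x \<noteq> 0} \<subseteq> \<Omega>"
  using assms unfolding test_functions_def by blast

lemma test_function_eq_0:
  assumes "\<phi> \<in> test_functions \<Omega>" "x \<notin> \<Omega>"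
  shows "\<phi> x = 0"
  using assms closure_subset[of "{x. \<phi> x \<noteq> 0}"] unfolding test_functions_def by auto

lemma test_function_continuous:
  assumes "\<phi> \<in> test_functions \<Omega>" shows "continuous_on S \<phi>"
proof -
  obtain D where D: "D 0 = \<phi>" "\<And>k x. (D k has_vector_derivative D (Suc k) x) (at x)"
    using test_functionE[OF assms] by metis
  have "isCont \<phi> x" for x
    using D(2)[of 0 x] D(1) has_vector_derivative_continuous by blast
  then show ?thesis
    by (simp add: continuous_at_imp_continuous_on)
qed

lemma test_function_support_subset:
  fixes \<psi> :: "real \<Rightarrow> complex"
  assumes "compact K" "K \<subseteq> \<Omega>" "\<And>x. x \<notin> K \<Longrightarrow> \<psi> x = 0"
  shows "compact (closure {x. \<psi> x \<noteq> 0})" "closure {x. \<psi> x \<noteq> 0} \<subseteq> \<Omega>"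
proof -
  have sub: "closure {x. \<psi> x \<noteq> 0} \<subseteq> K"
    using assms(3) compact_imp_closed[OF assms(1)] by (intro closure_minimal) auto
  then show "closure {x. \<psi> x \<noteq> 0} \<subseteq> \<Omega>"
    using assms(2) by auto
  show "compact (closure {x. \<psi> x \<noteq> 0})"
    using compact_Int_closed[OF assms(1) closed_closure[of "{x. \<psi> x \<noteq> 0}"]] sub
    by (simp add: inf_absorb2)
qed

lemma test_functionI:
  assumes "D 0 = \<phi>" and "\<And>k x. (D k has_vector_derivative D (Suc k) x) (at x)"
    and "compact K" "K \<subseteq> \<Omega>" "\<And>x. x \<notin> K \<Longrightarrow> \<phi> x = 0"
  shows "\<phi> \<in> test_functions \<Omega>"
proof -
  have "compact (closure {x. \<phi> x \<noteq> 0})" "closure {x. \<phi> x \<noteq> 0} \<subseteq> \<Omega>"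
    by (rule test_function_support_subset[OF assms(3,4)], rule assms(5), assumption)+
  then show ?thesis
    unfolding test_functions_def using assms(1,2) by blast
qed

lemma test_function_derivative:
  assumes "\<phi> \<in> test_functions \<Omega>"
  shows "\<exists>\<phi>' \<in> test_functions \<Omega>. \<forall>x. (\<phi> has_vector_derivative \<phi>' x) (at x)"
proof -
  obtain D where D: "D 0 = \<phi>" "\<And>k x. (D k has_vector_derivative D (Suc k) x) (at x)"
      "compact (closure {x. \<phi> x \<noteq> 0})" "closure {x. \<phi> x \<noteq> 0} \<subseteq> \<Omega>"
    using test_functionE[OF assms] by metis
  let ?K = "closure {x. \<phi> x \<noteq> 0}"
  have "D 1 x = 0" if "x \<notin> ?K" for x
  proof -
    have "(\<phi> has_vector_derivative 0) (at x)"
    proof (rule has_vector_derivative_transform_within_open[of "\<lambda>_. 0"])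
      show "open (- ?K)" "x \<in> - ?K"
        using that by auto
      show "0 = \<phi> y" if "y \<in> - ?K" for y
        using that closure_subset[of "{x. \<phi> x \<noteq> 0}"] by auto
    qed auto
    moreover have "(\<phi> has_vector_derivative D 1 x) (at x)"
      using D(2)[of 0 x] D(1) by simp
    ultimately show ?thesis
      using vector_derivative_unique_at by metis
  qed
  then have "D 1 \<in> test_functions \<Omega>"
    using D by (intro test_functionI[where D = "\<lambda>k. D (Suc k)" and K = ?K]) auto
  moreover have "\<forall>x. (\<phi> has_vector_derivative D 1 x) (at x)"
    using D(2)[of 0] D(1) by simp
  ultimately show ?thesis
    by blast
qed

lemma test_function_diff:
  assumes "\<phi> \<in> test_functions \<Omega>" "\<psi> \<in> test_functions \<Omega>"
  shows "(\<lambda>x. \<phi> x - \<psi> x) \<in> test_functions \<Omega>"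
proof -
  obtain D where D: "D 0 = \<phi>" "\<And>k x. (D k has_vector_derivative D (Suc k) x) (at x)"
      "compact (closure {x. \<phi> x \<noteq> 0})" "closure {x. \<phi> x \<noteq> 0} \<subseteq> \<Omega>"
    using test_functionE[OF assms(1)] by metis
  obtain E where E: "E 0 = \<psi>" "\<And>k x. (E k has_vector_derivative E (Suc k) x) (at x)"
      "compact (closure {x. \<psi> x \<noteq> 0})" "closure {x. \<psi> x \<noteq> 0} \<subseteq> \<Omega>"
    using test_functionE[OF assms(2)] by metis
  show ?thesis
  proof (rule test_functionI[where D = "\<lambda>k x. D k x - E k x"
        and K = "closure {x. \<phi> x \<noteq> 0} \<union> closure {x. \<psi> x \<noteq> 0}"])
    show "\<phi> x - \<psi> x = 0" if "x \<notin> closure {x. \<phi> x \<noteq> 0} \<union> closure {x. \<psi> x \<noteq> 0}" for x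
    proof -
      have "\<phi> x = 0" "\<psi> x = 0"
        using that closure_subset[of "{x. \<phi> x \<noteq> 0}"] closure_subset[of "{x. \<psi> x \<noteq> 0}"] by blast+
      then show ?thesis
        by simp
    qed
  qed (use D E in \<open>auto intro!: has_vector_derivative_diff compact_Un\<close>)
qed

lemma test_function_cnj:
  assumes "\<phi> \<in> test_functions \<Omega>"
  shows "(\<lambda>x. cnj (\<phi> x)) \<in> test_functions \<Omega>"
proof -
  obtain D where D: "D 0 = \<phi>" "\<And>k x. (D k has_vector_derivative D (Suc k) x) (at x)"
      "compact (closure {x. \<phi> x \<noteq> 0})" "closure {x. \<phi> x \<noteq> 0} \<subseteq> \<Omega>"
    using test_functionE[OF assms(1)] by metis
  show ?thesis
  proof (rule test_functionI[where D = "\<lambda>k x. cnj (D k x)" and K = "closure {x. \<phi> x \<noteq> 0}"])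
    show "cnj (\<phi> x) = 0" if "x \<notin> closure {x. \<phi> x \<noteq> 0}" for x
      using that closure_subset[of "{x. \<phi> x \<noteq> 0}"] by auto
  qed (use D in \<open>auto intro!: has_vector_derivative_cnj\<close>)
qed

lemma continuous_compact_support_L1_L2:
  fixes f :: "real \<Rightarrow> complex"
  assumes cont: "continuous_on UNIV f" and supp: "\<And>x. x \<notin> {a..b} \<Longrightarrow> f x = 0"
  shows "integrable lborel f" "f \<in> L2 UNIV"
proof -
  have "integrable lborel (\<lambda>x. indicator {a..b} x *\<^sub>R f x)"
    using borel_integrable_atLeastAtMost'[OF continuous_on_subset[OF cont], of a b]
    by (simp add: set_integrable_def)
  also have "(\<lambda>x. indicator {a..b} x *\<^sub>R f x) = f"
    using supp by (auto simp: indicator_def)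
  finally show "integrable lborel f" .
  have "continuous_on {a..b} (\<lambda>x. (cmod (f x))\<^sup>2)"
    by (intro continuous_intros continuous_on_subset[OF cont]) auto
  then have "integrable lborel (\<lambda>x. indicator {a..b} x *\<^sub>R (cmod (f x))\<^sup>2)"
    using borel_integrable_atLeastAtMost'[of a b "\<lambda>x. (cmod (f x))\<^sup>2"]
    by (simp add: set_integrable_def)
  also have "(\<lambda>x. indicator {a..b} x *\<^sub>R (cmod (f x))\<^sup>2) = (\<lambda>x. (cmod (f x))\<^sup>2)"
    using supp by (intro ext) (auto simp: indicator_def)
  finally show "f \<in> L2 UNIV"
    using cont by (simp add: L2_UNIV_iff borel_measurable_continuous_onI)
qed

lemma test_function_L1_L2:
  assumes "\<phi> \<in> test_functions {-1<..<1}"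
  shows "integrable lborel \<phi>" "\<phi> \<in> L2 UNIV"
proof -
  have "\<phi> x = 0" if "x \<notin> {-1..1}" for x
    using that by (intro test_function_eq_0[OF assms]) auto
  then show "integrable lborel \<phi>" "\<phi> \<in> L2 UNIV"
    using continuous_compact_support_L1_L2[OF test_function_continuous[OF assms], of "-1" 1] by blast+
qed

lemma test_function_fourier_L2:
  assumes "\<phi> \<in> test_functions {-1<..<1}"
  shows "AE \<xi> in lborel. fourier_L2 \<phi> \<xi> = fourier \<phi> \<xi>"
  using test_function_L1_L2[OF assms] test_function_eq_0[OF assms]
  by (intro fourier_L2_eq_fourier[where N = 1]) auto

text \<open>
  Integration by parts; there are no boundary terms, since \<open>f\<close> vanishes at \<open>-1\<close> and \<open>1\<close>.
\<close>

lemma fourier_derivative: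
  fixes f f' :: "real \<Rightarrow> complex"
  assumes deriv: "\<And>x. (f has_vector_derivative f' x) (at x)" and cont: "continuous_on UNIV f'"
    and supp: "\<And>x. x \<notin> {-1<..<1} \<Longrightarrow> f x = 0" "\<And>x. x \<notin> {-1<..<1} \<Longrightarrow> f' x = 0"
  shows "fourier f' \<xi> = \<i> * of_real \<xi> * fourier f \<xi>"
proof -
  let ?E = "\<lambda>x. exp (- \<i> * complex_of_real (\<xi> * x))"
  have cont_f: "continuous_on UNIV f"
    using deriv has_vector_derivative_continuous by (blast intro: continuous_at_imp_continuous_on)
  have "f x = 0" "f' x = 0" if "x \<notin> {-1..1}" for x
    using that by (intro supp; auto)+
  then have int: "integrable lborel f" "integrable lborel f'"
    using continuous_compact_support_L1_L2(1)[OF cont_f, of "-1" 1] continuous_compact_support_L1_L2(1)[OF cont, of "-1" 1]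
    by blast+
  have "(LINT x|lborel. indicator {-1..1} x *\<^sub>R (?E x * f' x - \<i> * of_real \<xi> * (?E x * f x))) = ?E 1 * f 1 - ?E (-1) * f (-1)"
  proof (rule integral_FTC_atLeastAtMost)
    fix x :: real
    have "((\<lambda>x. ?E x * f x) has_vector_derivative ?E x * f' x + (- \<i> * of_real \<xi> * ?E x) * f x) (at x)"
    proof (intro has_vector_derivative_mult deriv)
      have "((\<lambda>z. exp (- \<i> * of_real \<xi> * z)) has_field_derivative (- \<i> * of_real \<xi> * exp (- \<i> * of_real \<xi> * of_real x))) (at (of_real x))"
        by (auto intro!: derivative_eq_intros)
      from has_vector_derivative_real_field[OF this]
      show "(?E has_vector_derivative - \<i> * of_real \<xi> * ?E x) (at x)"
        by (simp add: mult.assoc)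
    qed
    then show "((\<lambda>x. ?E x * f x) has_vector_derivative ?E x * f' x - \<i> * of_real \<xi> * (?E x * f x)) (at x within {-1..1})"
      by (rule has_vector_derivative_at_within[OF has_vector_derivative_eq_rhs]) (simp add: mult.assoc)
  next
    show "continuous_on {-1..1} (\<lambda>x. ?E x * f' x - \<i> * of_real \<xi> * (?E x * f x))"
      by (intro continuous_intros continuous_on_subset[OF cont] continuous_on_subset[OF cont_f]) auto
  qed auto
  also have "(\<lambda>x. indicator {-1..1} x *\<^sub>R (?E x * f' x - \<i> * of_real \<xi> * (?E x * f x)))
      = (\<lambda>x. ?E x * f' x - \<i> * of_real \<xi> * (?E x * f x))"
    using supp by (auto simp: indicator_def fun_eq_iff)
  also have "(LINT x|lborel. ?E x * f' x - \<i> * of_real \<xi> * (?E x * f x)) = fourier f' \<xi> - \<i> * of_real \<xi> * fourier f \<xi>"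
    unfolding fourier_def using int[THEN fourier_kernel_integrable, of \<xi>]
    by (subst Bochner_Integration.integral_diff) auto
  finally show ?thesis
    using supp(1)[of 1] supp(1)[of "-1"] by simp
qed

text \<open>Since \<open>(1 + \<xi>\<^sup>2) \<phi>\<^sup>^ = (\<phi> - \<phi>'')\<^sup>^\<close>, each factor \<open>1 + \<xi>\<^sup>2\<close> costs two derivatives.\<close>

lemma test_function_fourier_decay:
  assumes "\<phi> \<in> test_functions {-1<..<1}"
  shows "\<exists>C. \<forall>\<xi>. (1 + \<xi>\<^sup>2) ^ m * cmod (fourier \<phi> \<xi>) \<le> C"
  using assms
proof (induction m arbitrary: \<phi>)
  case 0
  then show ?case
    using fourier_norm_le[OF test_function_L1_L2(1)[OF 0]] by auto
next
  case (Suc m)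
  obtain \<phi>' where \<phi>': "\<phi>' \<in> test_functions {-1<..<1}" "\<And>x. (\<phi> has_vector_derivative \<phi>' x) (at x)"
    using test_function_derivative[OF Suc.prems] by blast
  obtain \<phi>'' where \<phi>'': "\<phi>'' \<in> test_functions {-1<..<1}" "\<And>x. (\<phi>' has_vector_derivative \<phi>'' x) (at x)"
    using test_function_derivative[OF \<phi>'(1)] by blast
  obtain C where C: "\<And>\<xi>. (1 + \<xi>\<^sup>2) ^ m * cmod (fourier \<phi> \<xi>) \<le> C"
    using Suc.IH[OF Suc.prems] by blast
  obtain C' where C': "\<And>\<xi>. (1 + \<xi>\<^sup>2) ^ m * cmod (fourier \<phi>'' \<xi>) \<le> C'"
    using Suc.IH[OF \<phi>''(1)] by blast
  have "fourier \<phi>' \<xi> = \<i> * of_real \<xi> * fourier \<phi> \<xi>" "fourier \<phi>'' \<xi> = \<i> * of_real \<xi> * fourier \<phi>' \<xi>" for \<xi>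
  proof -
    show "fourier \<phi>' \<xi> = \<i> * of_real \<xi> * fourier \<phi> \<xi>"
      using \<phi>'(2) test_function_continuous[OF \<phi>'(1)] test_function_eq_0[OF Suc.prems] test_function_eq_0[OF \<phi>'(1)]
      by (rule fourier_derivative)
    show "fourier \<phi>'' \<xi> = \<i> * of_real \<xi> * fourier \<phi>' \<xi>"
      using \<phi>''(2) test_function_continuous[OF \<phi>''(1)] test_function_eq_0[OF \<phi>'(1)] test_function_eq_0[OF \<phi>''(1)]
      by (rule fourier_derivative)
  qed
  then have eq: "of_real (1 + \<xi>\<^sup>2) * fourier \<phi> \<xi> = fourier \<phi> \<xi> - fourier \<phi>'' \<xi>" for \<xi>
    by (simp add: algebra_simps power2_eq_square)
  have "(1 + \<xi>\<^sup>2) ^ Suc m * cmod (fourier \<phi> \<xi>) \<le> C + C'" for \<xi>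
  proof -
    have "(1 + \<xi>\<^sup>2) * cmod (fourier \<phi> \<xi>) = cmod (fourier \<phi> \<xi> - fourier \<phi>'' \<xi>)"
      unfolding eq[symmetric] norm_mult norm_of_real by simp
    then have "(1 + \<xi>\<^sup>2) ^ Suc m * cmod (fourier \<phi> \<xi>) = (1 + \<xi>\<^sup>2) ^ m * cmod (fourier \<phi> \<xi> - fourier \<phi>'' \<xi>)"
      by (simp only: power_Suc2 mult.assoc)
    also have "\<dots> \<le> (1 + \<xi>\<^sup>2) ^ m * (cmod (fourier \<phi> \<xi>) + cmod (fourier \<phi>'' \<xi>))"
      by (intro mult_left_mono norm_triangle_ineq4) auto
    also have "\<dots> \<le> C + C'"
      using C[of \<xi>] C'[of \<xi>] by (simp add: distrib_left)
    finally show ?thesis .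
  qed
  then show ?case
    by blast
qed

lemma abs_powr_le:
  fixes s \<xi> :: real
  shows "0 \<le> s \<Longrightarrow> \<bar>\<xi>\<bar> powr (2 * s) \<le> (1 + \<xi>\<^sup>2) powr s"
proof -
  assume s: "0 \<le> s"
  have "\<bar>\<xi>\<bar> powr (2 * s) = (\<bar>\<xi>\<bar> powr 2) powr s"
    by (simp only: powr_powr)
  also have "\<dots> = (\<xi>\<^sup>2) powr s"
    by (cases "\<xi> = 0") (auto simp: powr_numeral)
  also have "\<dots> \<le> (1 + \<xi>\<^sup>2) powr s"
    using s by (intro powr_mono2) auto
  finally show ?thesis .
qed

lemma inverse_one_plus_sq_integrable: "integrable lborel (\<lambda>\<xi>::real. 1 / (1 + \<xi>\<^sup>2))"
  using cauchy_density_integral by (simp add: has_bochner_integral_iff)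

lemma sqnorm_weighted_le_Hs:
  assumes "0 \<le> s"
  shows "sqnorm (\<lambda>\<xi>. of_real (\<bar>\<xi>\<bar> powr s) * fourier_L2 f \<xi>) \<le> Hs_norm_sq s f"
  unfolding sqnorm_def Hs_norm_sq_def
proof (intro nn_integral_mono ennreal_leI)
  fix \<xi>
  have "(cmod (of_real (\<bar>\<xi>\<bar> powr s) * fourier_L2 f \<xi>))\<^sup>2 = \<bar>\<xi>\<bar> powr (2 * s) * (cmod (fourier_L2 f \<xi>))\<^sup>2"
    by (simp add: norm_mult power_mult_distrib power2_eq_square powr_add[symmetric])
  also have "\<dots> \<le> (1 + \<xi>\<^sup>2) powr s * (cmod (fourier_L2 f \<xi>))\<^sup>2"
    by (intro mult_right_mono abs_powr_le assms) auto
  finally show "(cmod (of_real (\<bar>\<xi>\<bar> powr s) * fourier_L2 f \<xi>))\<^sup>2 \<le> (1 + \<xi>\<^sup>2) powr s * (cmod (fourier_L2 f \<xi>))\<^sup>2" .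
qed

lemma test_function_weighted_in_L2:
  assumes s: "0 \<le> s" "s \<le> 1" and \<phi>: "\<phi> \<in> test_functions {-1<..<1}"
  shows "(\<lambda>\<xi>. of_real (\<bar>\<xi>\<bar> powr s) * fourier \<phi> \<xi>) \<in> L2 UNIV"
proof -
  obtain C where C: "\<And>\<xi>. (1 + \<xi>\<^sup>2) ^ 1 * cmod (fourier \<phi> \<xi>) \<le> C"
    using test_function_fourier_decay[OF \<phi>, of 1] by blast
  have [measurable]: "fourier \<phi> \<in> borel_measurable borel"
    by (intro fourier_measurable test_function_L1_L2 \<phi>)
  have "integrable lborel (\<lambda>\<xi>. (cmod (of_real (\<bar>\<xi>\<bar> powr s) * fourier \<phi> \<xi>))\<^sup>2)"
  proof (rule Bochner_Integration.integrable_bound)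
    show "integrable lborel (\<lambda>\<xi>::real. C\<^sup>2 * (1 / (1 + \<xi>\<^sup>2)))"
      by (intro integrable_mult_right inverse_one_plus_sq_integrable)
    show "AE \<xi> in lborel. norm ((cmod (of_real (\<bar>\<xi>\<bar> powr s) * fourier \<phi> \<xi>))\<^sup>2) \<le> norm (C\<^sup>2 * (1 / (1 + \<xi>\<^sup>2)))"
    proof (intro AE_I2)
      fix \<xi> :: real
      have pos: "1 + \<xi>\<^sup>2 > 0"
        using zero_le_power2[of \<xi>] by linarith
      have "(cmod (of_real (\<bar>\<xi>\<bar> powr s) * fourier \<phi> \<xi>))\<^sup>2 = \<bar>\<xi>\<bar> powr (2 * s) * (cmod (fourier \<phi> \<xi>))\<^sup>2"
        by (simp add: norm_mult power_mult_distrib power2_eq_square powr_add[symmetric])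
      also have "\<dots> \<le> (1 + \<xi>\<^sup>2) powr 1 * (C / (1 + \<xi>\<^sup>2))\<^sup>2"
      proof (intro mult_mono power_mono)
        show "\<bar>\<xi>\<bar> powr (2 * s) \<le> (1 + \<xi>\<^sup>2) powr 1"
          using s by (intro order_trans[OF abs_powr_le powr_mono]) auto
        show "cmod (fourier \<phi> \<xi>) \<le> C / (1 + \<xi>\<^sup>2)"
          using C[of \<xi>] pos by (simp add: pos_le_divide_eq mult.commute)
      qed auto
      also have "\<dots> = C\<^sup>2 * (1 / (1 + \<xi>\<^sup>2))"
        using pos by (simp add: power2_eq_square[of "_ / _"] power2_eq_square[of C])
      finally show "norm ((cmod (of_real (\<bar>\<xi>\<bar> powr s) * fourier \<phi> \<xi>))\<^sup>2) \<le> norm (C\<^sup>2 * (1 / (1 + \<xi>\<^sup>2)))"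
        by simp
    qed
  qed measurable
  then show ?thesis
    by (simp add: L2_UNIV_iff)
qed

lemma Hs_in_L2: "f \<in> Hs s \<Longrightarrow> f \<in> L2 UNIV"
  by (simp add: Hs_def)

lemma Hs_weighted_in_L2:
  assumes "0 \<le> s" and f: "f \<in> Hs s"
  shows "(\<lambda>\<xi>. of_real (\<bar>\<xi>\<bar> powr s) * fourier_L2 f \<xi>) \<in> L2 UNIV"
proof -
  have [measurable]: "fourier_L2 f \<in> borel_measurable borel"
    using fourier_L2_in_L2[OF Hs_in_L2[OF f]] by auto
  have "sqnorm (\<lambda>\<xi>. of_real (\<bar>\<xi>\<bar> powr s) * fourier_L2 f \<xi>) < \<infinity>"
    using sqnorm_weighted_le_Hs[OF assms(1), of f] f by (auto simp: Hs_def intro: le_less_trans)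
  then show ?thesis
    by (simp add: L2_UNIV_iff_sqnorm)
qed

text \<open>
  The energy argument: the difference of the approximating test functions, conjugated, is an
  admissible test function, and in the limit it gives \<open>\<integral> \<bar>\<xi>\<bar>\<^bsup>2s\<^esup> \<bar>v\<^sub>1\<^sup>^ - v\<^sub>2\<^sup>^\<bar>\<^sup>2 = 0\<close>.
\<close>

lemma Hs_tilde_frac_laplacian_unique:
  assumes s: "0 \<le> s" "s \<le> 1"
    and v: "v \<in> Hs_tilde s {-1<..<1}" and w: "w \<in> Hs_tilde s {-1<..<1}"
    and eq: "\<And>\<phi>. \<phi> \<in> test_functions {-1<..<1} \<Longrightarrow> frac_laplacian s v \<phi> = frac_laplacian s w \<phi>"
  shows "AE x in lborel. v x = w x"
proof -
  obtain p where p: "\<And>n. p n \<in> test_functions {-1<..<1}" "(\<lambda>n. Hs_norm_sq s (\<lambda>x. p n x - v x)) \<longlonglongrightarrow> 0"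
    using v unfolding Hs_tilde_def by blast
  obtain q where q: "\<And>n. q n \<in> test_functions {-1<..<1}" "(\<lambda>n. Hs_norm_sq s (\<lambda>x. q n x - w x)) \<longlonglongrightarrow> 0"
    using w unfolding Hs_tilde_def by blast
  have vH: "v \<in> Hs s" and wH: "w \<in> Hs s"
    using v w unfolding Hs_tilde_def by auto
  let ?W = "\<lambda>f \<xi>. complex_of_real (\<bar>\<xi>\<bar> powr s) * f \<xi>"
  define G where "G \<xi> = ?W (fourier_L2 v) \<xi> - ?W (fourier_L2 w) \<xi>" for \<xi>
  have GL2: "G \<in> L2 UNIV"
    unfolding G_def by (intro L2_diff Hs_weighted_in_L2 s vH wH)
  have orth: "(LINT \<xi>|lborel. cnj (?W (fourier \<psi>) \<xi>) * G \<xi>) = 0" if \<psi>: "\<psi> \<in> test_functions {-1<..<1}" for \<psi>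
  proof -
    let ?\<phi> = "\<lambda>x. cnj (\<psi> x)"
    have c: "fourier ?\<phi> (- \<xi>) = cnj (fourier \<psi> \<xi>)" for \<xi>
      by (simp add: fourier_cnj)
    have pow: "complex_of_real (\<bar>\<xi>\<bar> powr (2 * s)) = of_real (\<bar>\<xi>\<bar> powr s) * of_real (\<bar>\<xi>\<bar> powr s)" for \<xi>
      by (simp flip: of_real_mult powr_add)
    have W\<psi>: "(\<lambda>\<xi>. cnj (?W (fourier \<psi>) \<xi>)) \<in> L2 UNIV"
      by (intro L2_cnj test_function_weighted_in_L2 s \<psi>)
    have frac: "frac_laplacian s f ?\<phi> * of_real (2 * pi)
        = (LINT \<xi>|lborel. cnj (?W (fourier \<psi>) \<xi>) * ?W (fourier_L2 f) \<xi>)" for f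
      unfolding frac_laplacian_def c pow by (simp add: mult_ac)
    have "(LINT \<xi>|lborel. cnj (?W (fourier \<psi>) \<xi>) * G \<xi>)
       = (LINT \<xi>|lborel. cnj (?W (fourier \<psi>) \<xi>) * ?W (fourier_L2 v) \<xi>) - (LINT \<xi>|lborel. cnj (?W (fourier \<psi>) \<xi>) * ?W (fourier_L2 w) \<xi>)"
      unfolding G_def right_diff_distrib
      by (intro Bochner_Integration.integral_diff L2_mult_integrable W\<psi> Hs_weighted_in_L2 s vH wH)
    also have "\<dots> = 0"
      unfolding frac[symmetric] using eq[OF test_function_cnj[OF \<psi>]] by simp
    finally show ?thesis .
  qed
  define \<psi> where "\<psi> n x = p n x - q n x" for n x
  have \<psi>: "\<psi> n \<in> test_functions {-1<..<1}" for n
    unfolding \<psi>_def by (intro test_function_diff p q)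
  have le: "sqnorm (\<lambda>\<xi>. ?W (fourier r) \<xi> - ?W (fourier_L2 f) \<xi>) \<le> Hs_norm_sq s (\<lambda>x. r x - f x)"
    if r: "r \<in> test_functions {-1<..<1}" and f: "f \<in> Hs s" for r f
  proof -
    have "AE \<xi> in lborel. ?W (fourier r) \<xi> - ?W (fourier_L2 f) \<xi> = ?W (fourier_L2 (\<lambda>x. r x - f x)) \<xi>"
      using fourier_L2_diff[OF test_function_L1_L2(2)[OF r] Hs_in_L2[OF f]] test_function_fourier_L2[OF r]
      by eventually_elim (simp add: right_diff_distrib)
    from sqnorm_cong_AE[OF this] show ?thesis
      using sqnorm_weighted_le_Hs[OF s(1), of "\<lambda>x. r x - f x"] by simp
  qed
  have lim: "(\<lambda>n. sqnorm (\<lambda>\<xi>. cnj (?W (fourier (\<psi> n)) \<xi>) - cnj (G \<xi>))) \<longlonglongrightarrow> 0"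
  proof (rule tendsto_sandwich[OF always_eventually always_eventually tendsto_const])
    have "(\<lambda>n. 2 * Hs_norm_sq s (\<lambda>x. p n x - v x) + 2 * Hs_norm_sq s (\<lambda>x. q n x - w x)) \<longlonglongrightarrow> 2 * 0 + 2 * 0"
      by (intro tendsto_add ennreal_tendsto_cmult p q) auto
    then show "(\<lambda>n. 2 * Hs_norm_sq s (\<lambda>x. p n x - v x) + 2 * Hs_norm_sq s (\<lambda>x. q n x - w x)) \<longlonglongrightarrow> 0"
      by simp
    show "\<forall>n. sqnorm (\<lambda>\<xi>. cnj (?W (fourier (\<psi> n)) \<xi>) - cnj (G \<xi>))
       \<le> 2 * Hs_norm_sq s (\<lambda>x. p n x - v x) + 2 * Hs_norm_sq s (\<lambda>x. q n x - w x)"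
    proof
      fix n
      let ?p = "\<lambda>\<xi>. ?W (fourier (p n)) \<xi> - ?W (fourier_L2 v) \<xi>"
      let ?q = "\<lambda>\<xi>. ?W (fourier (q n)) \<xi> - ?W (fourier_L2 w) \<xi>"
      have meas: "?p \<in> L2 UNIV" "?q \<in> L2 UNIV"
        by (intro L2_diff test_function_weighted_in_L2 Hs_weighted_in_L2 s p q vH wH)+
      have "fourier (\<psi> n) \<xi> = fourier (p n) \<xi> - fourier (q n) \<xi>" for \<xi>
        unfolding \<psi>_def by (intro fourier_diff test_function_L1_L2 p q)
      then have "cnj (?W (fourier (\<psi> n)) \<xi>) - cnj (G \<xi>) = cnj (?p \<xi> - ?q \<xi>)" for \<xi>
        by (simp add: G_def right_diff_distrib)
      then have "sqnorm (\<lambda>\<xi>. cnj (?W (fourier (\<psi> n)) \<xi>) - cnj (G \<xi>)) = sqnorm (\<lambda>\<xi>. ?p \<xi> - ?q \<xi>)"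
        unfolding sqnorm_def by (simp only: complex_mod_cnj)
      also have "\<dots> \<le> 2 * sqnorm ?p + 2 * sqnorm ?q"
        using meas by (intro sqnorm_diff_le) auto
      also have "\<dots> \<le> 2 * Hs_norm_sq s (\<lambda>x. p n x - v x) + 2 * Hs_norm_sq s (\<lambda>x. q n x - w x)"
        by (intro add_mono mult_left_mono le p q vH wH) auto
      finally show "sqnorm (\<lambda>\<xi>. cnj (?W (fourier (\<psi> n)) \<xi>) - cnj (G \<xi>))
         \<le> 2 * Hs_norm_sq s (\<lambda>x. p n x - v x) + 2 * Hs_norm_sq s (\<lambda>x. q n x - w x)" .
    qed
  qed auto
  have "(\<lambda>n. LINT \<xi>|lborel. cnj (?W (fourier (\<psi> n)) \<xi>) * G \<xi>) \<longlonglongrightarrow> (LINT \<xi>|lborel. cnj (G \<xi>) * G \<xi>)"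
    by (intro L2_integral_mult_tendsto L2_cnj GL2 test_function_weighted_in_L2 s \<psi> lim)
  then have "(LINT \<xi>|lborel. cnj (G \<xi>) * G \<xi>) = 0"
    unfolding orth[OF \<psi>] by (simp add: LIMSEQ_const_iff)
  also have "(\<lambda>\<xi>. cnj (G \<xi>) * G \<xi>) = (\<lambda>\<xi>. complex_of_real ((cmod (G \<xi>))\<^sup>2))"
    by (simp only: complex_norm_square mult.commute)
  finally have "(LINT \<xi>|lborel. (cmod (G \<xi>))\<^sup>2) = 0"
    unfolding integral_complex_of_real by simp
  then have G0: "AE \<xi> in lborel. (cmod (G \<xi>))\<^sup>2 = 0"
    using GL2 by (subst (asm) integral_nonneg_eq_0_iff_AE) (auto simp: L2_UNIV_iff)
  have "AE \<xi> in lborel. fourier_L2 (\<lambda>x. v x - w x) \<xi> = 0"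
    using G0 AE_lborel_singleton[of 0] fourier_L2_diff[OF Hs_in_L2[OF vH] Hs_in_L2[OF wH]]
    by eventually_elim (simp add: G_def)
  then have "AE x in lborel. v x - w x = 0"
    by (rule fourier_L2_injective[OF L2_diff[OF Hs_in_L2[OF vH] Hs_in_L2[OF wH]]])
  then show ?thesis
    by eventually_elim simp
qed

section \<open>Approximation by test functions\<close>

text \<open>
  Differentiation under the integral sign. The map \<open>e\<close> is the identity for a complex parameter and
  \<open>of_real\<close> for a real one, so that one proof covers both.
\<close>

lemma has_derivative_integral:
  fixes f :: "'a \<Rightarrow> 'b::real_normed_vector \<Rightarrow> complex" and e :: "'b \<Rightarrow> complex"
  assumes e: "bounded_linear e" "\<And>h. norm (e h) = norm h" and r: "r > 0"
    and int: "\<And>z. z \<in> ball z0 r \<Longrightarrow> integrable M (\<lambda>t. f t z)"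
    and D: "D \<in> borel_measurable M"
    and deriv: "\<And>t. t \<in> space M \<Longrightarrow> (f t has_derivative (\<lambda>h. D t * e h)) (at z0)"
    and lip: "\<And>t z. t \<in> space M \<Longrightarrow> z \<in> ball z0 r \<Longrightarrow> norm (f t z - f t z0) \<le> g t * norm (z - z0)"
    and g: "integrable M g" "\<And>t. t \<in> space M \<Longrightarrow> norm (D t) \<le> g t"
  shows "((\<lambda>z. integral\<^sup>L M (\<lambda>t. f t z)) has_derivative (\<lambda>h. integral\<^sup>L M D * e h)) (at z0)"
proof -
  have D_int: "integrable M D"
    using g D by (intro Bochner_Integration.integrable_bound[OF g(1) D]) (auto intro!: AE_I2 order_trans[OF g(2)])
  let ?R = "\<lambda>z t. (f t z - f t z0 - D t * e (z - z0)) / of_real (norm (z - z0))"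
  have lim: "((\<lambda>z. integral\<^sup>L M (?R z)) \<longlongrightarrow> 0) (at z0)"
    unfolding tendsto_at_iff_sequentially comp_def
  proof (intro allI impI)
    fix u assume u: "\<forall>i. u i \<in> UNIV - {z0}" "u \<longlonglongrightarrow> z0"
    have "\<forall>\<^sub>F i in sequentially. u i \<in> ball z0 r"
      using topological_tendstoD[OF u(2) open_ball, of z0 r] r by simp
    then obtain N where N: "\<And>i. i \<ge> N \<Longrightarrow> u i \<in> ball z0 r"
      by (auto simp: eventually_sequentially)
    have "(\<lambda>i. integral\<^sup>L M (?R (u (i + N)))) \<longlonglongrightarrow> integral\<^sup>L M (\<lambda>t. 0)"
    proof (rule integral_dominated_convergence[where w = "\<lambda>t. 2 * g t"])
      show "?R (u (i + N)) \<in> borel_measurable M" for i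
        using int[OF N[of "i + N"]] int[of z0] D r by (intro borel_measurable_divide borel_measurable_diff borel_measurable_times) auto
      show "AE t in M. (\<lambda>i. ?R (u (i + N)) t) \<longlonglongrightarrow> 0"
      proof (intro AE_I2)
        fix t assume "t \<in> space M"
        from deriv[OF this] have "((\<lambda>z. norm (f t z - f t z0 - D t * e (z - z0)) / norm (z - z0)) \<longlongrightarrow> 0) (at z0)"
          unfolding has_derivative_iff_norm by blast
        then have "((\<lambda>z. norm (?R z t)) \<longlongrightarrow> 0) (at z0)"
          by (simp add: norm_divide)
        then have "((\<lambda>z. ?R z t) \<longlongrightarrow> 0) (at z0)"
          by (simp only: tendsto_norm_zero_iff)
        then have "(\<lambda>i. ?R (u i) t) \<longlonglongrightarrow> 0"
          using u unfolding tendsto_at_iff_sequentially comp_def by blast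
        then show "(\<lambda>i. ?R (u (i + N)) t) \<longlonglongrightarrow> 0"
          by (rule LIMSEQ_ignore_initial_segment)
      qed
      show "AE t in M. norm (?R (u (i + N)) t) \<le> 2 * g t" for i
      proof (intro AE_I2)
        fix t assume t: "t \<in> space M"
        let ?z = "u (i + N)"
        have ne: "norm (?z - z0) > 0"
          using u(1) by auto
        have "norm (f t ?z - f t z0 - D t * e (?z - z0)) \<le> norm (f t ?z - f t z0) + norm (D t * e (?z - z0))"
          by (rule norm_triangle_ineq4)
        also have "\<dots> \<le> g t * norm (?z - z0) + g t * norm (?z - z0)"
          unfolding norm_mult e(2)
          by (intro add_mono lip t N mult_right_mono g(2)) auto
        finally show "norm (?R ?z t) \<le> 2 * g t"
          using ne by (simp add: norm_divide pos_divide_le_eq)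
      qed
    qed (use g in auto)
    then show "(\<lambda>i. integral\<^sup>L M (?R (u i))) \<longlonglongrightarrow> 0"
      unfolding Bochner_Integration.integral_zero by (rule LIMSEQ_offset)
  qed
  have eq: "norm (integral\<^sup>L M (\<lambda>t. f t z) - integral\<^sup>L M (\<lambda>t. f t z0) - integral\<^sup>L M D * e (z - z0)) / norm (z - z0)
      = norm (integral\<^sup>L M (?R z))" if "z \<in> ball z0 r" for z
  proof -
    have "integral\<^sup>L M (?R z) = (integral\<^sup>L M (\<lambda>t. f t z) - integral\<^sup>L M (\<lambda>t. f t z0) - integral\<^sup>L M D * e (z - z0)) / of_real (norm (z - z0))"
      using int[OF that] int[of z0] D_int r by simp
    then have "norm (integral\<^sup>L M (?R z)) = norm ((integral\<^sup>L M (\<lambda>t. f t z) - integral\<^sup>L M (\<lambda>t. f t z0) - integral\<^sup>L M D * e (z - z0)) / of_real (norm (z - z0)))"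
      by (simp only:)
    then show ?thesis
      by (simp only: norm_divide norm_of_real abs_norm_cancel)
  qed
  show ?thesis
    unfolding has_derivative_iff_norm
  proof
    show "bounded_linear (\<lambda>h. integral\<^sup>L M D * e h)"
      by (intro bounded_linear_const_mult e)
    have "\<forall>\<^sub>F z in at z0. norm (integral\<^sup>L M (?R z)) = norm (integral\<^sup>L M (\<lambda>t. f t z) - integral\<^sup>L M (\<lambda>t. f t z0) - integral\<^sup>L M D * e (z - z0)) / norm (z - z0)"
      using eventually_at_ball[OF r, of z0 UNIV] by eventually_elim (simp add: eq)
    from Lim_transform_eventually[OF tendsto_norm_zero[OF lim] this]
    show "((\<lambda>z. norm (integral\<^sup>L M (\<lambda>t. f t z) - integral\<^sup>L M (\<lambda>t. f t z0) - integral\<^sup>L M D * e (z - z0)) / norm (z - z0)) \<longlongrightarrow> 0) (at z0)" .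
  qed
qed

text \<open>
  The derivatives of \<open>exp (-1 / (1 - x\<^sup>2))\<close> all have this shape. As the family is closed under
  differentiation, a single differentiation rule yields derivatives of all orders.
\<close>

definition flat_bump :: "real poly \<Rightarrow> nat \<Rightarrow> real \<Rightarrow> real" where
  "flat_bump p n x = (if \<bar>x\<bar> < 1 then poly p x / (1 - x\<^sup>2) ^ n * exp (- 1 / (1 - x\<^sup>2)) else 0)"

lemma exp_neg_inverse_le:
  assumes "(w::real) > 0" shows "exp (- 1 / w) \<le> fact k * w ^ k"
proof -
  have "(1 / w) ^ k / fact k \<le> exp (1 / w)"
  proof -
    have "(\<Sum>n\<in>{k}. (1 / w) ^ n /\<^sub>R fact n) \<le> (\<Sum>n. (1 / w) ^ n /\<^sub>R fact n)"
      using assms by (intro sum_le_suminf summable_exp_generic) auto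
    then show ?thesis
      by (simp add: exp_def divide_inverse_commute)
  qed
  then have "inverse (exp (1 / w)) \<le> inverse ((1 / w) ^ k / fact k)"
    using assms by (intro le_imp_inverse_le) auto
  then show ?thesis
    using assms by (simp add: exp_minus power_one_over field_simps)
qed

text \<open>
  The exponential beats every power of \<open>1 - x\<^sup>2\<close>; vanishing to second order at the endpoints is what
  makes the derivative there exist and vanish.
\<close>

lemma flat_bump_quadratic:
  assumes "\<bar>x0\<bar> = 1"
  shows "\<exists>K. \<forall>x. \<bar>flat_bump p n x\<bar> \<le> K * (x - x0)\<^sup>2"
proof -
  have "compact ((\<lambda>x. \<bar>poly p x\<bar>) ` {-1..1})"
    by (intro compact_continuous_image continuous_intros) auto
  then obtain M where M: "\<And>x. x \<in> {-1..1} \<Longrightarrow> \<bar>poly p x\<bar> \<le> M"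
    by (fastforce dest: compact_imp_bounded simp: bounded_iff)
  have M0: "M \<ge> 0"
    using M[of 0] by auto
  have "\<bar>flat_bump p n x\<bar> \<le> M * fact (n + 2) * 4 * (x - x0)\<^sup>2" for x
  proof (cases "\<bar>x\<bar> < 1")
    case True
    define w where "w = 1 - x\<^sup>2"
    have w: "w > 0"
      using True by (simp add: w_def abs_square_less_1)
    have w_le: "w \<le> 2 * \<bar>x - x0\<bar>"
    proof -
      have x0: "x0 = 1 \<or> x0 = -1"
        using assms by auto
      have "w = (1 - x) * (1 + x)"
        by (simp add: w_def power2_eq_square algebra_simps)
      moreover have "(1 - x) * (1 + x) \<le> (1 - x) * 2" "(1 - x) * (1 + x) \<le> 2 * (1 + x)"
        using True by (intro mult_left_mono mult_right_mono; auto)+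
      ultimately show ?thesis
        using True x0 by auto
    qed
    have "\<bar>flat_bump p n x\<bar> = \<bar>poly p x\<bar> / w ^ n * exp (- 1 / w)"
      using True w by (simp add: flat_bump_def w_def[symmetric] abs_mult)
    also have "\<dots> \<le> M / w ^ n * (fact (n + 2) * w ^ (n + 2))"
      using True w M0 by (intro mult_mono divide_right_mono M exp_neg_inverse_le) auto
    also have "\<dots> = M * fact (n + 2) * w\<^sup>2"
      using w by (simp add: power_add power2_eq_square)
    also have "w\<^sup>2 \<le> (2 * \<bar>x - x0\<bar>)\<^sup>2"
      using w w_le by (intro power_mono) auto
    finally show ?thesis
      using M0 by (simp add: mult_left_mono power_mult_distrib mult.assoc)
  next
    case False
    then show ?thesis
      using M0 by (simp add: flat_bump_def)
  qed
  then show ?thesis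
    by blast
qed

lemma DERIV_zero_if_quadratic:
  fixes f :: "real \<Rightarrow> real"
  assumes "\<And>x. \<bar>f x\<bar> \<le> K * (x - x0)\<^sup>2"
  shows "DERIV f x0 :> 0"
proof -
  have f0: "f x0 = 0"
    using assms[of x0] by simp
  have "((\<lambda>x. (f x - f x0) / (x - x0)) \<longlongrightarrow> 0) (at x0)"
  proof (rule Lim_null_comparison)
    show "\<forall>\<^sub>F x in at x0. norm ((f x - f x0) / (x - x0)) \<le> K * \<bar>x - x0\<bar>"
      unfolding eventually_at_filter
    proof (intro always_eventually allI impI)
      fix x assume "x \<noteq> x0"
      then show "norm ((f x - f x0) / (x - x0)) \<le> K * \<bar>x - x0\<bar>"
        using assms[of x] f0 by (simp add: pos_divide_le_eq power2_eq_square mult.assoc flip: abs_mult)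
    qed
    have "((\<lambda>x. K * \<bar>x - x0\<bar>) \<longlongrightarrow> K * \<bar>x0 - x0\<bar>) (at x0)"
      by (intro tendsto_intros)
    then show "((\<lambda>x. K * \<bar>x - x0\<bar>) \<longlongrightarrow> 0) (at x0)"
      by simp
  qed
  then show ?thesis
    by (simp add: has_field_derivative_iff)
qed

lemma flat_bump_DERIV:
  "DERIV (flat_bump p n) x :>
    flat_bump (pderiv p * [:1, 0, -1:]\<^sup>2 + [:0, 2 * real n:] * p * [:1, 0, -1:] - [:0, 2:] * p) (n + 2) x"
  (is "DERIV _ x :> flat_bump ?q _ x")
proof -
  consider "\<bar>x\<bar> < 1" | "\<bar>x\<bar> = 1" | "\<bar>x\<bar> > 1"
    by linarith
  then show ?thesis
  proof cases
    case 1
    let ?f = "\<lambda>x. poly p x / (1 - x\<^sup>2) ^ n * exp (- 1 / (1 - x\<^sup>2))"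
    have w: "1 - x\<^sup>2 > 0"
      using 1 by (simp add: abs_square_less_1)
    have D: "DERIV ?f x :> flat_bump ?q (n + 2) x"
    proof -
      define w where "w = 1 - x\<^sup>2"
      have w: "w > 0"
        using 1 by (simp add: w_def abs_square_less_1)
      have d1: "DERIV (\<lambda>x. 1 - x\<^sup>2) x :> - 2 * x"
        by (auto intro!: derivative_eq_intros)
      have d2: "DERIV (\<lambda>x. inverse (1 - x\<^sup>2)) x :> 2 * x / w\<^sup>2"
      proof -
        have "1 - x\<^sup>2 \<noteq> 0"
          using w by (simp add: w_def)
        from DERIV_inverse_fun[OF d1 this] show ?thesis
          unfolding w_def[symmetric] by (rule DERIV_cong) (simp add: divide_inverse power2_eq_square)
      qed
      have d3: "DERIV (\<lambda>x. exp (- inverse (1 - x\<^sup>2))) x :> exp (- inverse w) * - (2 * x / w\<^sup>2)"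
        using DERIV_chain2[OF DERIV_exp DERIV_minus[OF d2]] by (simp add: w_def)
      have d4: "DERIV (\<lambda>x. inverse (1 - x\<^sup>2) ^ n) x :> real n * inverse w ^ (n - 1) * (2 * x / w\<^sup>2)"
        using DERIV_power[OF d2, of n] by (simp add: w_def mult_ac)
      have nn: "real n * inverse w ^ (n - 1) * (2 * x / w\<^sup>2) = 2 * real n * x / w ^ (n + 1)"
        using w by (cases n) (simp_all add: field_simps power2_eq_square)
      have "DERIV (\<lambda>x. poly p x * inverse (1 - x\<^sup>2) ^ n * exp (- inverse (1 - x\<^sup>2))) x
        :> (poly (pderiv p) x * inverse w ^ n + 2 * real n * x / w ^ (n + 1) * poly p x) * exp (- inverse w)
            + exp (- inverse w) * - (2 * x / w\<^sup>2) * (poly p x * inverse w ^ n)"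
        using DERIV_mult[OF DERIV_mult[OF poly_DERIV d4[unfolded nn]] d3] by (simp add: w_def)
      moreover have "(poly (pderiv p) x * inverse w ^ n + 2 * real n * x / w ^ (n + 1) * poly p x) * exp (- inverse w)
            + exp (- inverse w) * - (2 * x / w\<^sup>2) * (poly p x * inverse w ^ n)
          = poly ?q x / w ^ (n + 2) * exp (- inverse w)"
      proof -
        have W: "poly [:1, 0, -1:] x = w"
          by (simp add: w_def power2_eq_square)
        have q: "poly ?q x = poly (pderiv p) x * w\<^sup>2 + 2 * real n * x * poly p x * w - 2 * x * poly p x"
          by (simp only: poly_add poly_diff poly_mult poly_power W) simp
        show ?thesis
          unfolding q using w by (simp add: field_simps power2_eq_square power_add)
      qed
      ultimately show ?thesis
        using 1 by (simp add: flat_bump_def divide_inverse w_def power_inverse)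
    qed
    show ?thesis
    proof (rule has_field_derivative_transform_within_open[of ?f])
      show "?f y = flat_bump p n y" if "y \<in> {-1<..<1}" for y
        using that by (auto simp: flat_bump_def abs_less_iff)
    qed (use D 1 in \<open>auto simp: abs_less_iff\<close>)
  next
    case 2
    obtain K where "\<And>y. \<bar>flat_bump p n y\<bar> \<le> K * (y - x)\<^sup>2"
      using flat_bump_quadratic[OF 2] by blast
    note D = DERIV_zero_if_quadratic[OF this]
    have "flat_bump q m x = 0" for q m
      using 2 by (simp add: flat_bump_def)
    then show ?thesis
      using D by (simp only:)
  next
    case 3
    have "DERIV (flat_bump p n) x :> 0"
    proof (rule has_field_derivative_transform_within_open[of "\<lambda>_. 0"])
      show "open (- {-1..1::real})"
        by auto
      show "0 = flat_bump p n y" if "y \<in> - {-1..1}" for y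
        using that by (auto simp: flat_bump_def)
    qed (use 3 in auto)
    moreover have "flat_bump q m x = 0" for q m
      using 3 by (simp add: flat_bump_def)
    ultimately show ?thesis
      by (simp only:)
  qed
qed

fun bump_numerator :: "nat \<Rightarrow> real poly" where
  "bump_numerator 0 = 1"
| "bump_numerator (Suc k) = pderiv (bump_numerator k) * [:1, 0, -1:]\<^sup>2
      + [:0, 2 * real (2 * k):] * bump_numerator k * [:1, 0, -1:] - [:0, 2:] * bump_numerator k"

definition bump :: "nat \<Rightarrow> real \<Rightarrow> real" where
  "bump k = flat_bump (bump_numerator k) (2 * k)"

lemma bump_DERIV: "DERIV (bump k) x :> bump (Suc k) x"
  using flat_bump_DERIV[of "bump_numerator k" "2 * k" x] by (simp add: bump_def)

lemma bump_eq_0: "\<bar>x\<bar> \<ge> 1 \<Longrightarrow> bump k x = 0"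
  by (simp add: bump_def flat_bump_def)

lemma bump_continuous_on: "continuous_on S (bump k)"
  using bump_DERIV DERIV_isCont by (blast intro: continuous_at_imp_continuous_on)

lemma bump_measurable [measurable]: "bump k \<in> borel_measurable borel"
  by (intro borel_measurable_continuous_onI bump_continuous_on)

lemma bump_bounded: "\<exists>M. \<forall>x. \<bar>bump k x\<bar> \<le> M"
proof -
  have "compact (bump k ` {-1..1})"
    by (intro compact_continuous_image bump_continuous_on) auto
  then obtain M where M: "\<And>x. x \<in> {-1..1} \<Longrightarrow> \<bar>bump k x\<bar> \<le> M"
    by (fastforce dest: compact_imp_bounded simp: bounded_iff)
  have "\<bar>bump k x\<bar> \<le> M" for x
  proof (cases "\<bar>x\<bar> < 1")
    case False
    then show ?thesis
      using bump_eq_0[of x k] M[of 0] by simp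
  qed (use M[of x] in \<open>auto simp: abs_less_iff\<close>)
  then show ?thesis
    by blast
qed

lemma bump_nonneg: "bump 0 x \<ge> 0"
  by (auto simp: bump_def flat_bump_def)

lemma bump_integrable: "integrable lborel (bump 0)"
proof -
  have "integrable lborel (\<lambda>x. indicator {-1..1} x *\<^sub>R bump 0 x)"
    using borel_integrable_atLeastAtMost'[OF bump_continuous_on, of "-1" 1 0]
    by (simp add: set_integrable_def)
  also have "(\<lambda>x. indicator {-1..1} x *\<^sub>R bump 0 x) = bump 0"
  proof (intro ext)
    fix x show "indicator {-1..1} x *\<^sub>R bump 0 x = bump 0 x"
      using bump_eq_0[of x 0] by (cases "x \<in> {-1..1}") (auto simp: abs_if)
  qed
  finally show ?thesis .
qed

definition bump_mass :: real where
  "bump_mass = (LINT x|lborel. bump 0 x)"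

lemma bump_mass_pos: "bump_mass > 0"
proof -
  have "(LINT x|lborel. indicator {-1/2..1/2::real} x *\<^sub>R exp (- 2 :: real)) \<le> bump_mass"
    unfolding bump_mass_def
  proof (intro integral_mono bump_integrable)
    show "indicator {-1/2..1/2} x *\<^sub>R exp (- 2) \<le> bump 0 x" for x
    proof (cases "x \<in> {-1/2..1/2}")
      case True
      then have "\<bar>x\<bar> \<le> 1 / 2"
        by auto
      then have "\<bar>x\<bar>\<^sup>2 \<le> (1 / 2)\<^sup>2"
        by (intro power_mono) auto
      then have w: "1 - x\<^sup>2 \<ge> 1 / 2"
        by (simp add: power2_eq_square)
      then have "1 / (1 - x\<^sup>2) \<le> 2"
        by (simp add: pos_divide_le_eq)
      then show ?thesis
        using True \<open>\<bar>x\<bar> \<le> 1 / 2\<close> by (simp add: bump_def flat_bump_def)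
    qed (use bump_nonneg in auto)
  qed auto
  then show ?thesis
    using less_le_trans[OF exp_gt_zero[of "-2::real"]] by simp
qed

text \<open>
  The \<open>k\<close>-th derivative of the bump of width \<open>\<delta>\<close> and mass \<open>1\<close>.
\<close>

definition mollifier :: "real \<Rightarrow> nat \<Rightarrow> real \<Rightarrow> real" where
  "mollifier \<delta> k x = bump k (x / \<delta>) / (\<delta> ^ Suc k * bump_mass)"

lemma mollifier_DERIV: "\<delta> \<noteq> 0 \<Longrightarrow> DERIV (mollifier \<delta> k) x :> mollifier \<delta> (Suc k) x"
  unfolding mollifier_def using bump_mass_pos
  by (auto intro!: derivative_eq_intros DERIV_chain2[OF bump_DERIV] simp: field_simps)

lemma mollifier_bounded: "\<exists>M. \<forall>x. \<bar>mollifier \<delta> k x\<bar> \<le> M"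
proof -
  obtain M where "\<And>x. \<bar>bump k x\<bar> \<le> M"
    using bump_bounded by blast
  then have "\<bar>mollifier \<delta> k x\<bar> \<le> M / \<bar>\<delta> ^ Suc k * bump_mass\<bar>" for x
    unfolding mollifier_def abs_divide by (intro divide_right_mono) auto
  then show ?thesis
    by blast
qed

lemma mollifier_eq_0: "\<delta> > 0 \<Longrightarrow> \<bar>x\<bar> \<ge> \<delta> \<Longrightarrow> mollifier \<delta> k x = 0"
  unfolding mollifier_def by (subst bump_eq_0) (auto simp: abs_divide)

lemma mollifier_measurable [measurable]: "mollifier \<delta> k \<in> borel_measurable borel"
  unfolding mollifier_def by measurable

lemma fourier_scale:
  assumes "c > 0"
  shows "fourier (\<lambda>x. f (x / c)) \<xi> = of_real c * fourier f (c * \<xi>)"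
  unfolding fourier_def
  by (subst lborel_integral_real_affine[where c = c and t = 0])
    (use assms in \<open>auto simp: scaleR_conv_of_real ac_simps\<close>)

lemma mollifier_integrable: "\<delta> > 0 \<Longrightarrow> integrable lborel (mollifier \<delta> 0)"
proof -
  assume \<delta>: "\<delta> > 0"
  have "integrable lborel (\<lambda>x. bump 0 (0 + (1 / \<delta>) * x))"
    using \<delta> by (intro lborel_integrable_real_affine bump_integrable) auto
  then show ?thesis
    unfolding mollifier_def by simp
qed

lemma fourier_mollifier:
  assumes "\<delta> > 0"
  shows "fourier (\<lambda>x. of_real (mollifier \<delta> 0 x)) \<xi> = fourier (\<lambda>x. of_real (bump 0 x)) (\<delta> * \<xi>) / of_real bump_mass"
proof -
  have "fourier (\<lambda>x. of_real (mollifier \<delta> 0 x)) \<xi> = fourier (\<lambda>x. of_real (bump 0 (x / \<delta>))) \<xi> / of_real (\<delta> * bump_mass)"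
    unfolding fourier_def mollifier_def by simp
  also have "fourier (\<lambda>x. of_real (bump 0 (x / \<delta>))) \<xi> = of_real \<delta> * fourier (\<lambda>x. of_real (bump 0 x)) (\<delta> * \<xi>)"
    by (rule fourier_scale[OF assms, of "\<lambda>x. of_real (bump 0 x)"])
  finally show ?thesis
    using assms by simp
qed

lemma fourier_mollifier_norm_le:
  assumes "\<delta> > 0"
  shows "cmod (fourier (\<lambda>x. of_real (mollifier \<delta> 0 x)) \<xi>) \<le> 1"
proof -
  have "cmod (fourier (\<lambda>x. of_real (bump 0 x)) (\<delta> * \<xi>)) \<le> (LINT x|lborel. cmod (of_real (bump 0 x)))"
    by (intro fourier_norm_le) (simp add: bump_integrable)
  also have "\<dots> = bump_mass"
    unfolding bump_mass_def using bump_nonneg by simp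
  finally show ?thesis
    unfolding fourier_mollifier[OF assms] using bump_mass_pos by (simp add: norm_divide)
qed

lemma fourier_mollifier_tendsto:
  assumes "\<And>n. \<delta> n > 0" "\<delta> \<longlonglongrightarrow> 0"
  shows "(\<lambda>n. fourier (\<lambda>x. of_real (mollifier (\<delta> n) 0 x)) \<xi>) \<longlonglongrightarrow> 1"
proof -
  have "(\<lambda>n. \<delta> n * \<xi>) \<longlonglongrightarrow> 0"
    using tendsto_mult_left_zero[OF assms(2)] .
  moreover have "isCont (fourier (\<lambda>x. of_real (bump 0 x))) 0"
    by (intro fourier_isCont) (simp add: bump_integrable)
  ultimately have "(\<lambda>n. fourier (\<lambda>x. of_real (bump 0 x)) (\<delta> n * \<xi>)) \<longlonglongrightarrow> fourier (\<lambda>x. of_real (bump 0 x)) 0"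
    using isCont_tendsto_compose by blast
  moreover have "fourier (\<lambda>x. of_real (bump 0 x)) 0 = of_real bump_mass"
    by (simp add: fourier_def bump_mass_def)
  ultimately have "(\<lambda>n. fourier (\<lambda>x. of_real (bump 0 x)) (\<delta> n * \<xi>) / of_real bump_mass) \<longlonglongrightarrow> of_real bump_mass / of_real bump_mass"
    using bump_mass_pos by (intro tendsto_divide) auto
  then show ?thesis
    using bump_mass_pos by (simp add: fourier_mollifier[OF assms(1)])
qed

text \<open>
  The \<open>k\<close>-th derivative of the convolution of \<open>w\<close> with the mollifier of width \<open>\<delta>\<close>.
\<close>

definition mollify :: "real \<Rightarrow> nat \<Rightarrow> (real \<Rightarrow> complex) \<Rightarrow> real \<Rightarrow> complex" where
  "mollify \<delta> k w x = (LINT t|lborel. w t * of_real (mollifier \<delta> k (x - t)))"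

lemma mollify_has_vector_derivative:
  assumes w: "integrable lborel w" and \<delta>: "\<delta> > 0"
  shows "(mollify \<delta> k w has_vector_derivative mollify \<delta> (Suc k) w x) (at x)"
proof -
  have [measurable]: "w \<in> borel_measurable borel"
    using w by auto
  have int: "integrable lborel (\<lambda>t. w t * of_real (mollifier \<delta> k (z - t)))" for k z
  proof -
    obtain M where M: "\<And>x. \<bar>mollifier \<delta> k x\<bar> \<le> M"
      using mollifier_bounded by blast
    show ?thesis
    proof (rule Bochner_Integration.integrable_bound)
      show "integrable lborel (\<lambda>t. w t * of_real M)"
        using w by simp
      show "AE t in lborel. norm (w t * of_real (mollifier \<delta> k (z - t))) \<le> norm (w t * of_real M)"
        by (intro AE_I2) (auto simp: norm_mult intro!: mult_left_mono order_trans[OF M])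
    qed measurable
  qed
  obtain M where M: "\<And>x. \<bar>mollifier \<delta> (Suc k) x\<bar> \<le> M"
    using mollifier_bounded by blast
  have "((\<lambda>z. LINT t|lborel. w t * of_real (mollifier \<delta> k (z - t))) has_derivative
      (\<lambda>h. (LINT t|lborel. w t * of_real (mollifier \<delta> (Suc k) (x - t))) * of_real h)) (at x)"
  proof (rule has_derivative_integral[where r = 1 and g = "\<lambda>t. cmod (w t) * M"])
    fix t
    have d: "((\<lambda>z. mollifier \<delta> k (z - t)) has_real_derivative mollifier \<delta> (Suc k) (z - t)) (at z)" for z
      using DERIV_chain2[OF mollifier_DERIV[of \<delta> k "z - t"] DERIV_diff[OF DERIV_ident DERIV_const]] \<delta> by simp
    then have "((\<lambda>z. mollifier \<delta> k (z - t)) has_derivative (\<lambda>h. mollifier \<delta> (Suc k) (x - t) * h)) (at x)"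
      by (simp add: has_field_derivative_def)
    then have "((\<lambda>z. w t * of_real (mollifier \<delta> k (z - t))) has_derivative (\<lambda>h. w t * of_real (mollifier \<delta> (Suc k) (x - t) * h))) (at x)"
      by (intro has_derivative_mult_right has_derivative_of_real)
    then show "((\<lambda>z. w t * of_real (mollifier \<delta> k (z - t))) has_derivative (\<lambda>h. w t * of_real (mollifier \<delta> (Suc k) (x - t)) * of_real h)) (at x)"
      by (simp add: mult.assoc)
    fix z :: real
    have "norm (mollifier \<delta> k (z - t) - mollifier \<delta> k (x - t)) \<le> M * norm (z - x)"
      by (rule field_differentiable_bound[where S = UNIV and f' = "\<lambda>z. mollifier \<delta> (Suc k) (z - t)"])
        (use d M in auto)
    then have "cmod (w t) * norm (mollifier \<delta> k (z - t) - mollifier \<delta> k (x - t)) \<le> cmod (w t) * (M * norm (z - x))"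
      by (intro mult_left_mono) auto
    then show "norm (w t * of_real (mollifier \<delta> k (z - t)) - w t * of_real (mollifier \<delta> k (x - t))) \<le> cmod (w t) * M * norm (z - x)"
      unfolding right_diff_distrib[symmetric] of_real_diff[symmetric] norm_mult norm_of_real
      by (simp add: mult.assoc)
    show "norm (w t * of_real (mollifier \<delta> (Suc k) (x - t))) \<le> cmod (w t) * M"
      using M by (auto simp: norm_mult intro!: mult_left_mono)
  qed (use w int in \<open>auto intro: bounded_linear_of_real\<close>)
  then show ?thesis
    unfolding has_vector_derivative_def mollify_def[abs_def]
    by (simp add: scaleR_conv_of_real mult.commute)
qed

lemma fourier_mollify:
  assumes w: "integrable lborel w" and \<delta>: "\<delta> > 0"
  shows "fourier (mollify \<delta> 0 w) \<xi> = fourier w \<xi> * fourier (\<lambda>x. of_real (mollifier \<delta> 0 x)) \<xi>"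
proof -
  have [measurable]: "w \<in> borel_measurable borel"
    using w by auto
  let ?E = "\<lambda>x. exp (- \<i> * complex_of_real (\<xi> * x))"
  let ?m = "\<lambda>x. complex_of_real (mollifier \<delta> 0 x)"
  have m: "integrable lborel ?m"
    using mollifier_integrable[OF \<delta>] by simp
  have shift: "(LINT x|lborel. f (x - t)) = (LINT x|lborel. f x)" for f :: "real \<Rightarrow> complex" and t
    using lborel_integral_real_affine[of 1 f "- t"] by simp
  have shift_real: "(LINT x|lborel. f (x - t)) = (LINT x|lborel. f x)" for f :: "real \<Rightarrow> real" and t
    using lborel_integral_real_affine[of 1 f "- t"] by simp
  have int: "integrable (lborel \<Otimes>\<^sub>M lborel) (case_prod (\<lambda>t x. ?E x * (w t * ?m (x - t))))"
  proof (intro lborel_pair.Fubini_integrable)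
    have "norm (case_prod (\<lambda>t x. ?E x * (w t * ?m (x - t))) (t, x)) = cmod (w t) * \<bar>mollifier \<delta> 0 (x - t)\<bar>" for t x
      by (simp add: norm_mult norm_exp_eq_Re)
    then have "(\<lambda>t. LINT x|lborel. norm (case_prod (\<lambda>t x. ?E x * (w t * ?m (x - t))) (t, x)))
        = (\<lambda>t. cmod (w t) * (LINT x|lborel. \<bar>mollifier \<delta> 0 x\<bar>))"
      by (simp only: integral_mult_right_zero shift_real[of "\<lambda>x. \<bar>mollifier \<delta> 0 x\<bar>"])
    then show "integrable lborel (\<lambda>t. LINT x|lborel. norm (case_prod (\<lambda>t x. ?E x * (w t * ?m (x - t))) (t, x)))"
      using w by simp
    have "integrable lborel (\<lambda>x. ?m (x - t))" for t
      using lborel_integrable_real_affine[OF m, of 1 "- t"] by simp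
    then have "integrable lborel (\<lambda>x. ?E x * (w t * ?m (x - t)))" for t
      by (intro fourier_kernel_integrable integrable_mult_right)
    then show "AE t in lborel. integrable lborel (\<lambda>x. case_prod (\<lambda>t x. ?E x * (w t * ?m (x - t))) (t, x))"
      by simp
  qed measurable
  have "fourier (mollify \<delta> 0 w) \<xi> = (LINT x|lborel. LINT t|lborel. ?E x * (w t * ?m (x - t)))"
    by (simp add: fourier_def mollify_def)
  also have "\<dots> = (LINT t|lborel. LINT x|lborel. ?E x * (w t * ?m (x - t)))"
    by (rule lborel_pair.Fubini_integral[OF int])
  also have "\<dots> = (LINT t|lborel. ?E t * w t * fourier ?m \<xi>)"
  proof (intro Bochner_Integration.integral_cong refl)
    fix t
    have E: "?E x = ?E t * ?E (x - t)" for x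
      unfolding mult_exp_exp by (simp add: algebra_simps)
    have "(LINT x|lborel. ?E x * (w t * ?m (x - t))) = (LINT x|lborel. (?E t * w t) * (?E (x - t) * ?m (x - t)))"
      by (intro Bochner_Integration.integral_cong refl) (subst E, simp only: mult_ac)
    also have "\<dots> = ?E t * w t * (LINT x|lborel. ?E (x - t) * ?m (x - t))"
      by (rule integral_mult_right_zero)
    also have "(LINT x|lborel. ?E (x - t) * ?m (x - t)) = fourier ?m \<xi>"
      unfolding fourier_def by (rule shift[of "\<lambda>x. ?E x * ?m x"])
    finally show "(LINT x|lborel. ?E x * (w t * ?m (x - t))) = ?E t * w t * fourier ?m \<xi>" .
  qed
  also have "\<dots> = fourier w \<xi> * fourier ?m \<xi>"
    unfolding fourier_def by (rule integral_mult_left_zero)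
  finally show ?thesis .
qed

text \<open>
  A decay of \<open>v\<^sup>^\<close> that is slightly faster than what \<open>H\<^sup>s\<close> requires makes dominated convergence
  applicable to the shrunk and mollified functions: shrinking the support into \<open>[-1 + 2 \<delta>, 1 - 2 \<delta>]\<close>
  leaves room for the mollifier of width \<open>\<delta>\<close>.
\<close>

lemma Hs_tildeI_fourier_decay:
  assumes s: "0 \<le> s" "s \<le> 1" and v: "v \<in> L2 UNIV" and supp: "\<And>x. x \<notin> {-1..1} \<Longrightarrow> v x = 0"
    and decay: "\<And>\<xi>. (cmod (fourier v \<xi>))\<^sup>2 \<le> C * (1 + \<xi>\<^sup>2) powr - (1 + s)"
  shows "v \<in> Hs_tilde s {-1<..<1}"
proof -
  have v_int: "integrable lborel v"
    using L2_compact_support_integrable[OF v, of "-1" 1] supp by blast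
  have [measurable]: "v \<in> borel_measurable borel" "fourier v \<in> borel_measurable borel"
    using v fourier_measurable[OF v_int] by auto
  have pos: "1 + \<xi>\<^sup>2 > 0" for \<xi> :: real
    using zero_le_power2[of \<xi>] by linarith
  have C: "C \<ge> 0"
    using decay[of 0] order_trans[OF zero_le_power2] by simp
  have weight: "(1 + \<xi>\<^sup>2) powr s * (K * (1 + \<xi>\<^sup>2) powr - (1 + s)) = K * (1 / (1 + \<xi>\<^sup>2))" for \<xi> K :: real
  proof -
    have "(1 + \<xi>\<^sup>2) powr s * (1 + \<xi>\<^sup>2) powr - (1 + s) = (1 + \<xi>\<^sup>2) powr (- 1)"
      unfolding powr_add[symmetric] by simp
    then show ?thesis
      using pos[of \<xi>] by (simp add: powr_minus_divide mult.left_commute[of _ K])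
  qed
  have dom_finite: "(\<integral>\<^sup>+ \<xi>. ennreal (K * (1 / (1 + \<xi>\<^sup>2))) \<partial>lborel) < \<infinity>" if "K \<ge> 0" for K :: real
    using that integrable_mult_right[OF inverse_one_plus_sq_integrable, of K] pos
    by (subst nn_integral_eq_integral) (auto simp: less_imp_le)
  have vHs: "v \<in> Hs s"
    unfolding Hs_def
  proof (intro CollectI conjI v)
    have "AE \<xi> in lborel. fourier_L2 v \<xi> = fourier v \<xi>"
      using supp by (intro fourier_L2_eq_fourier[OF v, where N = 1]) auto
    then have "Hs_norm_sq s v = (\<integral>\<^sup>+ \<xi>. ennreal ((1 + \<xi>\<^sup>2) powr s * (cmod (fourier v \<xi>))\<^sup>2) \<partial>lborel)"
      unfolding Hs_norm_sq_def by (intro nn_integral_cong_AE) auto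
    also have "\<dots> \<le> (\<integral>\<^sup>+ \<xi>. ennreal (C * (1 / (1 + \<xi>\<^sup>2))) \<partial>lborel)"
      by (intro nn_integral_mono ennreal_leI, subst weight[symmetric])
        (intro mult_left_mono decay, auto)
    also have "\<dots> < \<infinity>"
      by (rule dom_finite[OF C])
    finally show "Hs_norm_sq s v < \<infinity>" .
  qed
  \<comment> \<open>The offset \<open>2\<close> gives \<open>\<delta> n \<le> 1/3\<close>, so that the dilation factor \<open>c n\<close> stays at least \<open>1/3\<close>.\<close>
  define \<delta> where "\<delta> n = inverse (real (Suc n) + 2)" for n :: nat
  define c where "c n = 1 - 2 * \<delta> n" for n
  have \<delta>: "\<delta> n > 0" "\<delta> n \<le> 1 / 3" for n
    by (auto simp: \<delta>_def field_simps)
  have c: "c n \<ge> 1 / 3" "c n > 0" "c n \<le> 1" for n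
    using \<delta>[of n] by (auto simp: c_def)
  have \<delta>_lim: "\<delta> \<longlonglongrightarrow> 0"
  proof -
    have "\<delta> = (\<lambda>n. inverse (real (Suc (n + 2))))"
      by (auto simp: \<delta>_def fun_eq_iff algebra_simps)
    then show ?thesis
      using LIMSEQ_ignore_initial_segment[OF LIMSEQ_inverse_real_of_nat, of 2] by simp
  qed
  have c_lim: "c \<longlonglongrightarrow> 1"
  proof -
    have "(\<lambda>n. 1 - 2 * \<delta> n) \<longlonglongrightarrow> 1 - 2 * 0"
      by (intro tendsto_intros \<delta>_lim)
    then show ?thesis
      by (simp add: c_def[abs_def])
  qed
  define w where "w n x = v (x / c n)" for n x
  define \<phi> where "\<phi> n = mollify (\<delta> n) 0 (w n)" for n
  have w_supp: "w n x = 0" if "\<bar>x\<bar> > c n" for n x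
    using that c(2)[of n] unfolding w_def by (intro supp) (auto simp: divide_simps abs_if split: if_splits)
  have w_int: "integrable lborel (w n)" for n
    using lborel_integrable_real_affine[OF v_int, of "1 / c n" 0] c(2)[of n] by (simp add: w_def[abs_def])
  have \<phi>_test: "\<phi> n \<in> test_functions {-1<..<1}" for n
  proof (rule test_functionI[where D = "\<lambda>k. mollify (\<delta> n) k (w n)" and K = "{- (1 - \<delta> n)..1 - \<delta> n}"])
    show "\<phi> n x = 0" if "x \<notin> {- (1 - \<delta> n)..1 - \<delta> n}" for x
    proof -
      have "w n t * of_real (mollifier (\<delta> n) 0 (x - t)) = 0" for t
      proof (cases "\<bar>t\<bar> > c n")
        case False
        then have "\<bar>x - t\<bar> \<ge> \<delta> n"
          using that by (auto simp: c_def abs_if split: if_splits)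
        then show ?thesis
          by (simp add: mollifier_eq_0[OF \<delta>(1)])
      qed (simp add: w_supp)
      then show ?thesis
        unfolding \<phi>_def mollify_def by (simp only: Bochner_Integration.integral_zero)
    qed
  qed (use \<delta>[of n] in \<open>auto simp: \<phi>_def intro!: mollify_has_vector_derivative w_int\<close>)
  have F\<phi>: "fourier (\<phi> n) \<xi> = of_real (c n) * fourier v (c n * \<xi>) * fourier (\<lambda>x. of_real (mollifier (\<delta> n) 0 x)) \<xi>" for n \<xi>
    unfolding \<phi>_def fourier_mollify[OF w_int \<delta>(1)] unfolding w_def fourier_scale[OF c(2)] ..
  have F\<phi>_lim: "(\<lambda>n. fourier (\<phi> n) \<xi>) \<longlonglongrightarrow> fourier v \<xi>" for \<xi>
  proof -
    have "(\<lambda>n. c n * \<xi>) \<longlonglongrightarrow> 1 * \<xi>"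
      by (intro tendsto_intros c_lim)
    then have "(\<lambda>n. fourier v (c n * \<xi>)) \<longlonglongrightarrow> fourier v \<xi>"
      by (intro isCont_tendsto_compose[OF fourier_isCont[OF v_int]]) simp
    then have "(\<lambda>n. of_real (c n) * fourier v (c n * \<xi>) * fourier (\<lambda>x. of_real (mollifier (\<delta> n) 0 x)) \<xi>) \<longlonglongrightarrow> of_real 1 * fourier v \<xi> * 1"
      by (intro tendsto_intros c_lim fourier_mollifier_tendsto \<delta> \<delta>_lim)
    then show ?thesis
      by (simp add: F\<phi>)
  qed
  have F\<phi>_le: "(cmod (fourier (\<phi> n) \<xi>))\<^sup>2 \<le> 81 * C * (1 + \<xi>\<^sup>2) powr - (1 + s)" for n \<xi>
  proof -
    have "cmod (fourier (\<phi> n) \<xi>) \<le> 1 * cmod (fourier v (c n * \<xi>)) * 1"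
      unfolding F\<phi> norm_mult using c[of n] by (intro mult_mono fourier_mollifier_norm_le \<delta>) auto
    then have "(cmod (fourier (\<phi> n) \<xi>))\<^sup>2 \<le> (cmod (fourier v (c n * \<xi>)))\<^sup>2"
      by (intro power_mono) auto
    also have "\<dots> \<le> C * (1 + (c n * \<xi>)\<^sup>2) powr - (1 + s)"
      by (rule decay)
    also have "(1 + (c n * \<xi>)\<^sup>2) powr - (1 + s) \<le> ((1 + \<xi>\<^sup>2) / 9) powr - (1 + s)"
    proof (rule powr_mono2')
      have "(1 / 3)\<^sup>2 * \<xi>\<^sup>2 \<le> (c n)\<^sup>2 * \<xi>\<^sup>2"
        using c[of n] by (intro mult_right_mono power_mono) auto
      then show "(1 + \<xi>\<^sup>2) / 9 \<le> 1 + (c n * \<xi>)\<^sup>2"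
        by (simp add: power_mult_distrib power_divide)
    qed (use s pos[of \<xi>] in auto)
    also have "((1 + \<xi>\<^sup>2) / 9) powr - (1 + s) = 9 powr (1 + s) * (1 + \<xi>\<^sup>2) powr - (1 + s)"
      using pos[of \<xi>] by (subst powr_divide) (simp_all only: powr_minus_divide[of 9] divide_divide_eq_right div_by_1 mult.commute less_imp_le)
    also have "\<dots> \<le> 81 * (1 + \<xi>\<^sup>2) powr - (1 + s)"
    proof (intro mult_right_mono)
      have "9 powr (1 + s) \<le> 9 powr (2::real)"
        using s by (intro powr_mono) auto
      then show "9 powr (1 + s) \<le> 81"
        by simp
    qed auto
    finally show ?thesis
      using C by (simp add: mult_left_mono mult.assoc mult.left_commute)
  qed
  have "(\<lambda>n. Hs_norm_sq s (\<lambda>x. \<phi> n x - v x)) \<longlonglongrightarrow> 0"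
  proof -
    have eq: "Hs_norm_sq s (\<lambda>x. \<phi> n x - v x) = (\<integral>\<^sup>+ \<xi>. ennreal ((1 + \<xi>\<^sup>2) powr s * (cmod (fourier (\<phi> n) \<xi> - fourier v \<xi>))\<^sup>2) \<partial>lborel)" for n
    proof -
      have "\<phi> n x - v x = 0" if "x \<notin> {- real 1..real 1}" for x
        using that supp[of x] test_function_eq_0[OF \<phi>_test[of n], of x] by auto
      then have "AE \<xi> in lborel. fourier_L2 (\<lambda>x. \<phi> n x - v x) \<xi> = fourier (\<lambda>x. \<phi> n x - v x) \<xi>"
        by (intro fourier_L2_eq_fourier[where N = 1] L2_diff test_function_L1_L2[OF \<phi>_test] v)
      then show ?thesis
        unfolding Hs_norm_sq_def
        by (intro nn_integral_cong_AE) (auto simp: fourier_diff[OF test_function_L1_L2(1)[OF \<phi>_test] v_int])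
    qed
    have [measurable]: "fourier (\<phi> n) \<in> borel_measurable borel" for n
      by (intro fourier_measurable test_function_L1_L2 \<phi>_test)
    have "(\<lambda>n. \<integral>\<^sup>+ \<xi>. ennreal ((1 + \<xi>\<^sup>2) powr s * (cmod (fourier (\<phi> n) \<xi> - fourier v \<xi>))\<^sup>2) \<partial>lborel) \<longlonglongrightarrow> (\<integral>\<^sup>+ \<xi>. 0 \<partial>(lborel :: real measure))"
    proof (rule nn_integral_dominated_convergence[where w = "\<lambda>\<xi>. ennreal (164 * C * (1 / (1 + \<xi>\<^sup>2)))"])
      show "AE \<xi> in lborel. ennreal ((1 + \<xi>\<^sup>2) powr s * (cmod (fourier (\<phi> n) \<xi> - fourier v \<xi>))\<^sup>2) \<le> ennreal (164 * C * (1 / (1 + \<xi>\<^sup>2)))" for n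
      proof (intro AE_I2 ennreal_leI)
        fix \<xi> :: real
        have "(cmod (fourier (\<phi> n) \<xi> - fourier v \<xi>))\<^sup>2 \<le> 2 * (cmod (fourier (\<phi> n) \<xi>))\<^sup>2 + 2 * (cmod (fourier v \<xi>))\<^sup>2"
          using cmod_add_sq_le[of "fourier (\<phi> n) \<xi>" "- fourier v \<xi>"] by simp
        also have "\<dots> \<le> 2 * (81 * C * (1 + \<xi>\<^sup>2) powr - (1 + s)) + 2 * (C * (1 + \<xi>\<^sup>2) powr - (1 + s))"
          by (intro add_mono mult_left_mono F\<phi>_le decay) auto
        also have "\<dots> = 164 * C * (1 + \<xi>\<^sup>2) powr - (1 + s)"
          by (simp add: algebra_simps)
        finally have "(1 + \<xi>\<^sup>2) powr s * (cmod (fourier (\<phi> n) \<xi> - fourier v \<xi>))\<^sup>2 \<le> (1 + \<xi>\<^sup>2) powr s * (164 * C * (1 + \<xi>\<^sup>2) powr - (1 + s))"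
          by (intro mult_left_mono) auto
        then show "(1 + \<xi>\<^sup>2) powr s * (cmod (fourier (\<phi> n) \<xi> - fourier v \<xi>))\<^sup>2 \<le> 164 * C * (1 / (1 + \<xi>\<^sup>2))"
          by (simp only: weight)
      qed
      show "(\<integral>\<^sup>+ \<xi>. ennreal (164 * C * (1 / (1 + \<xi>\<^sup>2))) \<partial>lborel) < \<infinity>"
        using C by (intro dom_finite) auto
      show "AE \<xi> in lborel. (\<lambda>n. ennreal ((1 + \<xi>\<^sup>2) powr s * (cmod (fourier (\<phi> n) \<xi> - fourier v \<xi>))\<^sup>2)) \<longlonglongrightarrow> 0"
      proof (intro AE_I2)
        fix \<xi> :: real
        have "(\<lambda>n. (1 + \<xi>\<^sup>2) powr s * (cmod (fourier (\<phi> n) \<xi> - fourier v \<xi>))\<^sup>2) \<longlonglongrightarrow> (1 + \<xi>\<^sup>2) powr s * (cmod (fourier v \<xi> - fourier v \<xi>))\<^sup>2"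
          by (intro tendsto_intros F\<phi>_lim)
        from tendsto_ennrealI[OF this]
        show "(\<lambda>n. ennreal ((1 + \<xi>\<^sup>2) powr s * (cmod (fourier (\<phi> n) \<xi> - fourier v \<xi>))\<^sup>2)) \<longlonglongrightarrow> 0"
          by simp
      qed
    qed measurable
    then show ?thesis
      unfolding eq by simp
  qed
  then show ?thesis
    unfolding Hs_tilde_def using vHs \<phi>_test by blast
qed

section \<open>Decay of the transform of the candidate solution\<close>

text \<open>
  As a function of \<open>x\<close>, the Poisson kernel of \<open>(-\<Delta>)\<^sup>s\<close> on \<open>(-1, 1)\<close> without the factor
  \<open>c(s) (y\<^sup>2 - 1)\<^bsup>-s\<^esup>\<close>, which does not depend on \<open>x\<close>.
\<close>

definition ball_kernel :: "real \<Rightarrow> real \<Rightarrow> real \<Rightarrow> real" where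
  "ball_kernel s y x = (if \<bar>x\<bar> < 1 then (1 - x\<^sup>2) powr s / (y - x) else 0)"

lemma ball_kernel_measurable2 [measurable]:
  assumes [measurable]: "f \<in> borel_measurable M" "g \<in> borel_measurable M"
  shows "(\<lambda>x. ball_kernel s (f x) (g x)) \<in> borel_measurable M"
  unfolding ball_kernel_def by measurable

lemma ball_kernel_bound:
  assumes "0 \<le> s" "2 \<le> y"
  shows "\<bar>ball_kernel s y x\<bar> \<le> indicator {-1..1} x"
proof (cases "\<bar>x\<bar> < 1")
  case True
  have "(1 - x\<^sup>2) powr s \<le> 1 powr s"
    using True assms by (intro powr_mono2) (auto simp: abs_square_less_1 less_imp_le)
  moreover have "\<bar>y - x\<bar> \<ge> 1"
    using True assms by linarith
  ultimately have "(1 - x\<^sup>2) powr s / \<bar>y - x\<bar> \<le> 1 / 1"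
    by (intro frac_le) auto
  then have "\<bar>ball_kernel s y x\<bar> \<le> 1"
    using True by (simp add: ball_kernel_def)
  moreover have "x \<in> {-1..1}"
    using True by auto
  ultimately show ?thesis
    by simp
qed (simp add: ball_kernel_def)

lemma ball_kernel_integrable:
  assumes "0 \<le> s" "2 \<le> y"
  shows "integrable lborel (\<lambda>x. complex_of_real (ball_kernel s y x))"
proof (rule Bochner_Integration.integrable_bound[OF indicator_interval_L1_L2(1)[of "-1" 1]])
  show "AE x in lborel. cmod (of_real (ball_kernel s y x)) \<le> cmod (indicator {-1..1} x)"
  proof (intro AE_I2)
    fix x show "cmod (of_real (ball_kernel s y x)) \<le> cmod (indicator {-1..1} x)"
      using ball_kernel_bound[OF assms, of x] by (cases "x \<in> {-1..1}") auto
  qed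
qed measurable

lemma DERIV_one_minus_sq_powr:
  assumes "\<bar>x\<bar> < (1::real)"
  shows "((\<lambda>x. (1 - x\<^sup>2) powr a) has_real_derivative a * (1 - x\<^sup>2) powr (a - 1) * (- 2 * x)) (at x)"
proof -
  have "1 - x\<^sup>2 > 0"
    using assms by (simp add: abs_square_less_1)
  moreover have "((\<lambda>x. 1 - x\<^sup>2) has_real_derivative - 2 * x) (at x)"
    by (auto intro!: derivative_eq_intros)
  ultimately show ?thesis
    by (rule DERIV_chain2[OF has_real_derivative_powr])
qed

lemma DERIV_inverse_diff:
  assumes "x < (y::real)"
  shows "((\<lambda>x. inverse (y - x)) has_real_derivative (inverse (y - x))\<^sup>2) (at x)"
  using assms by (auto intro!: derivative_eq_intros simp: power2_eq_square)

text \<open>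
  Away from distance \<open>\<delta> = 1 / \<bar>\<xi>\<bar>\<close> of the endpoints, two integrations by parts gain
  \<open>\<xi>\<^sup>-\<^sup>2\<close> against a second derivative of size \<open>(1 - \<bar>x\<bar>)\<^bsup>s-2\<^esup>\<close>; the two end pieces have
  length \<open>\<delta>\<close> and height \<open>\<delta>\<^bsup>s\<^esup>\<close>. All contributions are of order \<open>\<delta>\<^bsup>1+s\<^esup>\<close>.
\<close>

lemma ball_kernel_fourier_large:
  assumes s: "0 < s" "s < 1" and y: "2 \<le> y" and \<xi>: "\<bar>\<xi>\<bar> \<ge> 1"
  shows "cmod (fourier (\<lambda>x. of_real (ball_kernel s y x)) \<xi>) \<le> (14 + 24 / (1 - s)) * \<bar>\<xi>\<bar> powr - (1 + s)"
proof -
  define \<delta> where "\<delta> = 1 / \<bar>\<xi>\<bar>"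
  define b where "b = 1 - \<delta>"
  have \<delta>: "\<delta> > 0" "\<delta> \<le> 1"
    using \<xi> by (auto simp: \<delta>_def)
  have b: "0 \<le> b" "b < 1"
    using \<delta> by (auto simp: b_def)
  have \<xi>0: "\<xi> \<noteq> 0"
    using \<xi> by auto
  have inv_\<xi>: "1 / \<bar>\<xi>\<bar> = \<delta>" "1 / \<xi>\<^sup>2 = \<delta>\<^sup>2"
    by (auto simp: \<delta>_def power_divide)
  \<comment> \<open>\<open>R\<close> is the size of every contribution.\<close>
  define R where "R = \<delta> powr (1 + s)"
  have R_eq: "R = \<bar>\<xi>\<bar> powr - (1 + s)"
    unfolding R_def \<delta>_def using \<xi> by (simp add: powr_divide powr_minus_divide del: minus_add_distrib)
  have R1: "\<delta> * \<delta> powr s = R"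
    using \<delta> by (simp add: R_def powr_add)
  have R2: "\<delta>\<^sup>2 * \<delta> powr (s - 1) = R"
  proof -
    have "\<delta>\<^sup>2 * \<delta> powr (s - 1) = \<delta> powr 2 * \<delta> powr (s - 1)"
      using \<delta> by simp
    also have "\<dots> = R"
      unfolding R_def powr_add[symmetric] by (simp add: add.commute)
    finally show ?thesis .
  qed
  define u where "u x = 1 - x\<^sup>2" for x :: real
  define q where "q x = inverse (y - x)" for x
  define f where "f x = u x powr s * q x" for x
  define f1 where "f1 x = s * u x powr (s - 1) * (- 2 * x) * q x + u x powr s * (q x)\<^sup>2" for x
  define f2 where "f2 x = s * ((s - 1) * u x powr (s - 2) * (- 2 * x)) * (- 2 * x) * q x
      + s * u x powr (s - 1) * (- 2) * q x + 2 * (s * u x powr (s - 1) * (- 2 * x) * (q x)\<^sup>2)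
      + u x powr s * (2 * q x * (q x)\<^sup>2)" for x
  have u: "0 < u x" "u x \<le> 1" if "\<bar>x\<bar> < 1" for x
    using that by (auto simp: u_def abs_square_less_1)
  have q: "0 \<le> q x" "q x \<le> 1" if "\<bar>x\<bar> < 1" for x
    using that y by (auto simp: q_def field_simps)
  have q_pow: "(q x)\<^sup>2 \<le> 1" "q x * (q x)\<^sup>2 \<le> 1" if "\<bar>x\<bar> < 1" for x
    using q[OF that] by (auto simp: power2_eq_square mult_le_one)
  have du: "((\<lambda>x. u x powr a) has_real_derivative a * u x powr (a - 1) * (- 2 * x)) (at x)" if "\<bar>x\<bar> < 1" for a x
    unfolding u_def by (rule DERIV_one_minus_sq_powr[OF that])
  have dq: "(q has_real_derivative (q x)\<^sup>2) (at x)" if "\<bar>x\<bar> < 1" for x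
    unfolding q_def[abs_def] using that y by (intro DERIV_inverse_diff) auto
  have df: "(f has_real_derivative f1 x) (at x)" if "\<bar>x\<bar> < 1" for x
    unfolding f_def[abs_def] f1_def
    using DERIV_mult[OF du[OF that, of s] dq[OF that]] by (simp add: algebra_simps)
  have df1: "(f1 has_real_derivative f2 x) (at x)" if "\<bar>x\<bar> < 1" for x
  proof -
    have d1: "((\<lambda>x. s * u x powr (s - 1) * (- 2 * x)) has_real_derivative
        s * ((s - 1) * u x powr (s - 2) * (- 2 * x)) * (- 2 * x) + s * u x powr (s - 1) * (- 2)) (at x)"
      using DERIV_mult[OF DERIV_cmult[OF du[OF that, of "s - 1"], of s] DERIV_cmult[OF DERIV_ident, of "- 2"]]
      by (simp add: algebra_simps)
    have d2: "((\<lambda>x. (q x)\<^sup>2) has_real_derivative 2 * q x * (q x)\<^sup>2) (at x)"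
      using DERIV_power[OF dq[OF that], of 2] by (simp add: mult_ac)
    show ?thesis
      unfolding f1_def[abs_def] f2_def
      by (rule DERIV_cong[OF DERIV_add[OF DERIV_mult[OF d1 dq[OF that]] DERIV_mult[OF du[OF that, of s] d2]]])
        (simp add: algebra_simps)
  qed
  have u_mono: "u x powr s \<le> u x powr (s - 1)" "u x powr (s - 1) \<le> u x powr (s - 2)" if "\<bar>x\<bar> < 1" for x
    using u[OF that] by (auto intro!: powr_mono')
  have f_le: "\<bar>f x\<bar> \<le> u x powr s" if "\<bar>x\<bar> < 1" for x
    unfolding f_def abs_mult using q[OF that] by (auto intro: mult_left_le)
  have f1_le: "\<bar>f1 x\<bar> \<le> 3 * u x powr (s - 1)" if x: "\<bar>x\<bar> < 1" for x
  proof -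
    let ?A = "u x powr (s - 1)"
    have "\<bar>f1 x\<bar> \<le> \<bar>s * ?A * (- 2 * x) * q x\<bar> + \<bar>u x powr s * (q x)\<^sup>2\<bar>"
      unfolding f1_def by (rule abs_triangle_ineq)
    also have "\<bar>s * ?A * (- 2 * x) * q x\<bar> = ?A * (2 * (s * \<bar>x\<bar> * q x))"
      using s q[OF x] by (simp add: abs_mult mult_ac)
    also have "\<dots> \<le> ?A * (2 * (1 * 1 * 1))"
      using s x q[OF x] by (intro mult_left_mono mult_mono) auto
    also have "\<bar>u x powr s * (q x)\<^sup>2\<bar> \<le> ?A * 1"
      unfolding abs_mult using u_mono[OF x] q_pow[OF x] by (intro mult_mono) auto
    finally show ?thesis
      by simp
  qed
  have f2_le: "\<bar>f2 x\<bar> \<le> 12 * u x powr (s - 2)" if x: "\<bar>x\<bar> < 1" for x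
  proof -
    let ?A = "u x powr (s - 2)"
    have A: "u x powr (s - 1) \<le> ?A" "u x powr s \<le> ?A"
      using u_mono[OF x] by auto
    have xx: "x * x \<le> 1"
      using x abs_square_less_1[of x] by (simp add: power2_eq_square)
    have "\<bar>s * ((s - 1) * ?A * (- 2 * x)) * (- 2 * x) * q x\<bar> = ?A * (4 * (s * (1 - s) * (x * x) * q x))"
      using s q[OF x] by (simp add: abs_mult mult_ac)
    also have "\<dots> \<le> ?A * (4 * (1 * 1 * 1 * 1))"
      using s x q[OF x] xx by (intro mult_left_mono mult_mono) auto
    finally have 1: "\<bar>s * ((s - 1) * ?A * (- 2 * x)) * (- 2 * x) * q x\<bar> \<le> 4 * ?A"
      by simp
    have "\<bar>s * u x powr (s - 1) * (- 2) * q x\<bar> = u x powr (s - 1) * (2 * (s * q x))"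
      using s q[OF x] by (simp add: abs_mult mult_ac)
    also have "\<dots> \<le> ?A * (2 * (1 * 1))"
      using s q[OF x] A by (intro mult_mono) auto
    finally have 2: "\<bar>s * u x powr (s - 1) * (- 2) * q x\<bar> \<le> 2 * ?A"
      by simp
    have "\<bar>2 * (s * u x powr (s - 1) * (- 2 * x) * (q x)\<^sup>2)\<bar> = u x powr (s - 1) * (4 * (s * \<bar>x\<bar> * (q x)\<^sup>2))"
      using s q[OF x] by (simp add: abs_mult mult_ac)
    also have "\<dots> \<le> ?A * (4 * (1 * 1 * 1))"
      using s x q_pow[OF x] A by (intro mult_mono) auto
    finally have 3: "\<bar>2 * (s * u x powr (s - 1) * (- 2 * x) * (q x)\<^sup>2)\<bar> \<le> 4 * ?A"
      by simp
    have "\<bar>u x powr s * (2 * q x * (q x)\<^sup>2)\<bar> = u x powr s * (2 * (q x * (q x)\<^sup>2))"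
      using q[OF x] by (simp add: abs_mult mult_ac)
    also have "\<dots> \<le> ?A * (2 * 1)"
      using q_pow[OF x] q[OF x] A by (intro mult_mono) auto
    finally have 4: "\<bar>u x powr s * (2 * q x * (q x)\<^sup>2)\<bar> \<le> 2 * ?A"
      by simp
    show ?thesis
      unfolding f2_def using 1 2 3 4 by linarith
  qed
  let ?E = "\<lambda>x. exp (- \<i> * complex_of_real (\<xi> * x))"
  have E_norm: "cmod (?E x) = 1" for x
    by (rule norm_fourier_kernel)
  have dE: "(?E has_vector_derivative - \<i> * of_real \<xi> * ?E x) (at x)" for x
  proof -
    have "((\<lambda>z. exp (- \<i> * of_real \<xi> * z)) has_field_derivative (- \<i> * of_real \<xi> * exp (- \<i> * of_real \<xi> * of_real x))) (at (of_real x))"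
      by (auto intro!: derivative_eq_intros)
    from has_vector_derivative_real_field[OF this] show ?thesis
      by (simp add: mult.assoc)
  qed
  have cont_f: "continuous_on {-b..b} f" and cont_f1: "continuous_on {-b..b} f1"
  proof -
    have ab: "\<bar>x\<bar> < 1" if "x \<in> {-b..b}" for x
      using that b by auto
    show "continuous_on {-b..b} f" "continuous_on {-b..b} f1"
      by (intro continuous_at_imp_continuous_on ballI, rule DERIV_isCont[OF df[OF ab]] DERIV_isCont[OF df1[OF ab]], assumption)+
  qed
  have cont_f2: "continuous_on {-b..b} f2"
  proof -
    have "\<bar>x\<bar> < 1" if "x \<in> {-b..b}" for x
      using that b by auto
    then have "u x \<noteq> 0" "y - x \<noteq> 0" if "x \<in> {-b..b}" for x
      using that u y by fastforce+
    then show ?thesis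
      unfolding f2_def[abs_def] u_def q_def by (intro continuous_intros) auto
  qed
  have cont_E: "continuous_on S ?E" for S
    by (intro continuous_intros)
  \<comment> \<open>The boundary terms of two integrations by parts, collected in one function whose derivative is
    \<open>E f + E f'' / \<xi>\<^sup>2\<close>.\<close>
  define \<Phi> where "\<Phi> x = ?E x * (\<i> * of_real (f x) / of_real \<xi> + of_real (f1 x) / of_real (\<xi>\<^sup>2))" for x
  have d\<Phi>: "(\<Phi> has_vector_derivative (?E x * of_real (f x) + ?E x * of_real (f2 x) / of_real (\<xi>\<^sup>2))) (at x)" if "\<bar>x\<bar> < 1" for x
  proof -
    have rf: "((\<lambda>x. complex_of_real (f x)) has_vector_derivative of_real (f1 x)) (at x)"
      "((\<lambda>x. complex_of_real (f1 x)) has_vector_derivative of_real (f2 x)) (at x)"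
      using df[OF that] df1[OF that] by (auto intro!: has_vector_derivative_of_real simp: has_real_derivative_iff_has_vector_derivative)
    have "(\<Phi> has_vector_derivative
       ?E x * (\<i> * of_real (f1 x) / of_real \<xi> + of_real (f2 x) / of_real (\<xi>\<^sup>2))
       + (- \<i> * of_real \<xi> * ?E x) * (\<i> * of_real (f x) / of_real \<xi> + of_real (f1 x) / of_real (\<xi>\<^sup>2))) (at x)"
      unfolding \<Phi>_def
      by (intro has_vector_derivative_mult dE has_vector_derivative_add has_vector_derivative_divide has_vector_derivative_mult_right rf)
    moreover have "?E x * (\<i> * of_real (f1 x) / of_real \<xi> + of_real (f2 x) / of_real (\<xi>\<^sup>2))
       + (- \<i> * of_real \<xi> * ?E x) * (\<i> * of_real (f x) / of_real \<xi> + of_real (f1 x) / of_real (\<xi>\<^sup>2))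
       = ?E x * of_real (f x) + ?E x * of_real (f2 x) / of_real (\<xi>\<^sup>2)"
      using \<xi>0 by (simp add: field_simps power2_eq_square)
    ultimately show ?thesis
      by simp
  qed
  have set_int: "set_integrable lborel {-b..b} (\<lambda>x. ?E x * of_real (f x))"
      "set_integrable lborel {-b..b} (\<lambda>x. ?E x * of_real (f2 x) / of_real (\<xi>\<^sup>2))"
    using \<xi>0 by (intro borel_integrable_atLeastAtMost' continuous_intros cont_E cont_f cont_f2; simp)+
  have FTC: "(LINT x:{-b..b}|lborel. ?E x * of_real (f x)) + (LINT x:{-b..b}|lborel. ?E x * of_real (f2 x) / of_real (\<xi>\<^sup>2)) = \<Phi> b - \<Phi> (- b)"
  proof -
    have "(LINT x:{-b..b}|lborel. ?E x * of_real (f x) + ?E x * of_real (f2 x) / of_real (\<xi>\<^sup>2)) = \<Phi> b - \<Phi> (- b)"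
      unfolding set_lebesgue_integral_def
    proof (rule integral_FTC_atLeastAtMost)
      show "(\<Phi> has_vector_derivative ?E x * of_real (f x) + ?E x * of_real (f2 x) / of_real (\<xi>\<^sup>2)) (at x within {-b..b})" if "- b \<le> x" "x \<le> b" for x
        using that b by (intro has_vector_derivative_at_within[OF d\<Phi>]) auto
      show "continuous_on {-b..b} (\<lambda>x. ?E x * of_real (f x) + ?E x * of_real (f2 x) / of_real (\<xi>\<^sup>2))"
        using \<xi>0 by (intro continuous_intros cont_E cont_f cont_f2) simp
    qed (use b in auto)
    then show ?thesis
      using set_int by (simp add: set_integral_add)
  qed
  have u_b: "u b \<le> 2 * \<delta>" "u b \<ge> \<delta>" "u (- b) = u b"
  proof -
    have "u b = \<delta> * (2 - \<delta>)"
      by (simp add: u_def b_def power2_eq_square algebra_simps)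
    moreover have "\<delta> * 1 \<le> \<delta> * (2 - \<delta>)" "\<delta> * (2 - \<delta>) \<le> \<delta> * 2"
      using \<delta> by (intro mult_left_mono; simp)+
    ultimately show "u b \<le> 2 * \<delta>" "u b \<ge> \<delta>" "u (- b) = u b"
      by (auto simp: u_def)
  qed
  have two_powr: "(2 * \<delta>) powr s \<le> 2 * \<delta> powr s"
  proof -
    have "(2::real) powr s \<le> 2 powr 1"
      using s by (intro powr_mono) auto
    then show ?thesis
      using \<delta> by (simp add: powr_mult mult_right_mono)
  qed
  have \<Phi>_le: "cmod (\<Phi> x) \<le> 5 * R" if x: "x = b \<or> x = - b" for x
  proof -
    have x1: "\<bar>x\<bar> < 1"
      using x b by auto
    have ux: "u x = u b"
      using x u_b by auto
    have "u b powr s \<le> (2 * \<delta>) powr s"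
      using s u_b \<delta> by (intro powr_mono2) auto
    then have fx: "\<bar>f x\<bar> \<le> 2 * \<delta> powr s"
      using f_le[OF x1] two_powr unfolding ux by linarith
    have "u b powr (s - 1) \<le> \<delta> powr (s - 1)"
      using s u_b \<delta> by (intro powr_mono2') auto
    then have f1x: "\<bar>f1 x\<bar> \<le> 3 * \<delta> powr (s - 1)"
      using f1_le[OF x1] unfolding ux by linarith
    have "cmod (\<Phi> x) = cmod (\<i> * of_real (f x) / of_real \<xi> + of_real (f1 x) / of_real (\<xi>\<^sup>2))"
      unfolding \<Phi>_def norm_mult[of "?E x"] E_norm by simp
    also have "\<dots> \<le> cmod (\<i> * of_real (f x) / of_real \<xi>) + cmod (of_real (f1 x) / of_real (\<xi>\<^sup>2))"
      by (rule norm_triangle_ineq)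
    also have "\<dots> = \<bar>f x\<bar> * (1 / \<bar>\<xi>\<bar>) + \<bar>f1 x\<bar> * (1 / \<xi>\<^sup>2)"
      by (simp add: norm_divide norm_mult norm_power)
    also have "\<dots> \<le> (2 * \<delta> powr s) * \<delta> + (3 * \<delta> powr (s - 1)) * \<delta>\<^sup>2"
      unfolding inv_\<xi> using fx f1x \<delta> by (intro add_mono mult_right_mono) auto
    also have "\<dots> = 2 * (\<delta> * \<delta> powr s) + 3 * (\<delta>\<^sup>2 * \<delta> powr (s - 1))"
      by simp
    also have "\<dots> = 5 * R"
      unfolding R1 R2 by simp
    finally show ?thesis .
  qed
  define G where "G x = ((1 - x) powr (s - 1) - (1 + x) powr (s - 1)) / (1 - s)" for x
  have f2_int: "cmod (LINT x:{-b..b}|lborel. ?E x * of_real (f2 x) / of_real (\<xi>\<^sup>2)) \<le> 24 / (1 - s) * R"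
  proof -
    \<comment> \<open>Since \<open>1 - x\<^sup>2 \<ge> 1 - \<bar>x\<bar>\<close> and \<open>s - 2 < 0\<close>, this dominates \<open>(1 - x\<^sup>2) powr (s - 2)\<close>, and it has the
      elementary primitive \<open>G\<close>.\<close>
    let ?g = "\<lambda>x. (1 - x) powr (s - 2) + (1 + x) powr (s - 2)"
    have dG: "(G has_real_derivative ?g x) (at x)" if "\<bar>x\<bar> < 1" for x
    proof -
      have p: "1 - x > 0" "1 + x > 0"
        using that by auto
      have d1: "((\<lambda>x. (1 - x) powr (s - 1)) has_real_derivative (s - 1) * (1 - x) powr (s - 1 - 1) * - 1) (at x)"
        using p by (intro DERIV_chain2[OF has_real_derivative_powr]) (auto intro!: derivative_eq_intros)
      have d2: "((\<lambda>x. (1 + x) powr (s - 1)) has_real_derivative (s - 1) * (1 + x) powr (s - 1 - 1) * 1) (at x)"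
        using p by (intro DERIV_chain2[OF has_real_derivative_powr]) (auto intro!: derivative_eq_intros)
      show ?thesis
        unfolding G_def[abs_def]
        by (rule DERIV_cong[OF DERIV_cdivide[OF DERIV_diff[OF d1 d2]]]) (use s in \<open>simp add: field_simps\<close>)
    qed
    have cont_g: "continuous_on {-b..b} ?g"
      using b by (intro continuous_intros) auto
    have g_int: "has_bochner_integral lborel (\<lambda>x. indicator {-b..b} x *\<^sub>R ?g x) (G b - G (- b))"
      unfolding has_bochner_integral_iff
    proof
      show "integrable lborel (\<lambda>x. indicator {-b..b} x *\<^sub>R ?g x)"
        using borel_integrable_atLeastAtMost'[OF cont_g] by (simp add: set_integrable_def)
      show "(LINT x|lborel. indicator {-b..b} x *\<^sub>R ?g x) = G b - G (- b)"
      proof (rule integral_FTC_atLeastAtMost)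
        show "(G has_vector_derivative ?g x) (at x within {-b..b})" if "- b \<le> x" "x \<le> b" for x
          using that b dG[of x] by (intro has_vector_derivative_at_within[where S = "{-b..b}"])
            (auto simp: has_real_derivative_iff_has_vector_derivative)
      qed (use b cont_g in auto)
    qed
    have g_ge: "u x powr (s - 2) \<le> ?g x" if x: "\<bar>x\<bar> < 1" for x
    proof (cases "x \<ge> 0")
      case True
      have "(1 - x) * 1 \<le> (1 - x) * (1 + x)"
        using True x by (intro mult_left_mono) auto
      then have "1 - x \<le> u x"
        by (simp add: u_def power2_eq_square algebra_simps)
      then have "u x powr (s - 2) \<le> (1 - x) powr (s - 2)"
        using x s by (intro powr_mono2') auto
      then show ?thesis
        by (simp add: add_increasing2)
    next
      case False
      have "1 * (1 + x) \<le> (1 - x) * (1 + x)"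
        using False x by (intro mult_right_mono) auto
      then have "1 + x \<le> u x"
        by (simp add: u_def power2_eq_square algebra_simps)
      then have "u x powr (s - 2) \<le> (1 + x) powr (s - 2)"
        using x s by (intro powr_mono2') auto
      then show ?thesis
        by (simp add: add_increasing)
    qed
    have "cmod (LINT x:{-b..b}|lborel. ?E x * of_real (f2 x) / of_real (\<xi>\<^sup>2))
        \<le> (LINT x|lborel. cmod (indicator {-b..b} x *\<^sub>R (?E x * of_real (f2 x) / of_real (\<xi>\<^sup>2))))"
      unfolding set_lebesgue_integral_def by (rule integral_norm_bound)
    also have "\<dots> \<le> (LINT x|lborel. 12 * \<delta>\<^sup>2 * (indicator {-b..b} x *\<^sub>R ?g x))"
    proof (rule integral_mono)
      show "integrable lborel (\<lambda>x. cmod (indicator {-b..b} x *\<^sub>R (?E x * of_real (f2 x) / of_real (\<xi>\<^sup>2))))"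
        using set_int(2) unfolding set_integrable_def by (rule integrable_norm)
      show "integrable lborel (\<lambda>x. 12 * \<delta>\<^sup>2 * (indicator {-b..b} x *\<^sub>R ?g x))"
        using g_int by (intro integrable_mult_right) (simp add: has_bochner_integral_iff)
      fix x
      show "cmod (indicator {-b..b} x *\<^sub>R (?E x * of_real (f2 x) / of_real (\<xi>\<^sup>2))) \<le> 12 * \<delta>\<^sup>2 * (indicator {-b..b} x *\<^sub>R ?g x)"
      proof (cases "x \<in> {-b..b}")
        case True
        then have x: "\<bar>x\<bar> < 1"
          using b by auto
        have "cmod (?E x * of_real (f2 x) / of_real (\<xi>\<^sup>2)) = \<bar>f2 x\<bar> * (1 / \<xi>\<^sup>2)"
          unfolding norm_divide norm_mult E_norm norm_of_real by simp
        also have "\<dots> \<le> (12 * ?g x) * \<delta>\<^sup>2"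
          unfolding inv_\<xi> using f2_le[OF x] g_ge[OF x] by (intro mult_right_mono) auto
        finally show ?thesis
          using True by (simp add: mult_ac distrib_left)
      qed simp
    qed
    also have "\<dots> = 12 * \<delta>\<^sup>2 * (G b - G (- b))"
      using g_int by (subst integral_mult_right_zero) (simp add: has_bochner_integral_iff)
    also have "G b - G (- b) = 2 * (\<delta> powr (s - 1) - (2 - \<delta>) powr (s - 1)) / (1 - s)"
      by (simp add: G_def b_def diff_divide_distrib[symmetric])
    also have "12 * \<delta>\<^sup>2 * (2 * (\<delta> powr (s - 1) - (2 - \<delta>) powr (s - 1)) / (1 - s))
        \<le> 12 * \<delta>\<^sup>2 * (2 * \<delta> powr (s - 1) / (1 - s))"
      using s by (intro mult_left_mono divide_right_mono) auto
    also have "\<dots> = 24 / (1 - s) * (\<delta>\<^sup>2 * \<delta> powr (s - 1))"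
      by simp
    finally show ?thesis
      unfolding R2 .
  qed
  let ?k = "\<lambda>x. complex_of_real (ball_kernel s y x)"
  have k_eq: "?k x = of_real (f x)" if "\<bar>x\<bar> < 1" for x
    using that by (simp add: ball_kernel_def f_def u_def q_def divide_inverse)
  have Ek_int: "integrable lborel (\<lambda>x. ?E x * ?k x)"
    using s y by (intro fourier_kernel_integrable ball_kernel_integrable) auto
  have split: "fourier ?k \<xi> = (LINT x:{-b..b}|lborel. ?E x * ?k x) + (LINT x:-{-b..b}|lborel. ?E x * ?k x)"
  proof -
    have si: "set_integrable lborel A (\<lambda>x. ?E x * ?k x)" if "A \<in> sets borel" for A
      using Ek_int that unfolding set_integrable_def by (intro integrable_mult_indicator) auto
    have "fourier ?k \<xi> = (LINT x:({-b..b} \<union> -{-b..b})|lborel. ?E x * ?k x)"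
      by (simp add: fourier_def set_lebesgue_integral_def)
    also have "\<dots> = (LINT x:{-b..b}|lborel. ?E x * ?k x) + (LINT x:-{-b..b}|lborel. ?E x * ?k x)"
      by (intro set_integral_Un si) auto
    finally show ?thesis .
  qed
  have middle: "cmod (LINT x:{-b..b}|lborel. ?E x * ?k x) \<le> (10 + 24 / (1 - s)) * R"
  proof -
    have "(LINT x:{-b..b}|lborel. ?E x * ?k x) = (LINT x:{-b..b}|lborel. ?E x * of_real (f x))"
    proof (intro set_lebesgue_integral_cong allI impI)
      fix x assume "x \<in> {-b..b}"
      then have "\<bar>x\<bar> < 1"
        using b by auto
      then show "?E x * ?k x = ?E x * of_real (f x)"
        by (simp only: k_eq)
    qed auto
    also have "\<dots> = \<Phi> b - \<Phi> (- b) - (LINT x:{-b..b}|lborel. ?E x * of_real (f2 x) / of_real (\<xi>\<^sup>2))"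
      using FTC by (simp add: algebra_simps)
    also have "cmod \<dots> \<le> cmod (\<Phi> b) + cmod (\<Phi> (- b)) + cmod (LINT x:{-b..b}|lborel. ?E x * of_real (f2 x) / of_real (\<xi>\<^sup>2))"
      by (intro order_trans[OF norm_triangle_ineq4] add_mono norm_triangle_ineq4) simp
    also have "\<dots> \<le> 5 * R + 5 * R + 24 / (1 - s) * R"
      by (intro add_mono \<Phi>_le f2_int) auto
    finally show ?thesis
      by (simp add: algebra_simps)
  qed
  have ends: "cmod (LINT x:-{-b..b}|lborel. ?E x * ?k x) \<le> 4 * R"
  proof -
    let ?I = "\<lambda>x. indicator {-1..-b} x + indicator {b..1} x :: real"
    have I_int: "has_bochner_integral lborel (\<lambda>x. 2 * \<delta> powr s * ?I x) (2 * \<delta> powr s * (\<delta> + \<delta>))"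
    proof (intro has_bochner_integral_mult_right has_bochner_integral_add)
      show "has_bochner_integral lborel (indicator {-1..-b} :: real \<Rightarrow> real) \<delta>"
        using has_bochner_integral_real_indicator[of "{-1..-b}" lborel] b by (simp add: b_def emeasure_lborel_Icc_eq)
      show "has_bochner_integral lborel (indicator {b..1} :: real \<Rightarrow> real) \<delta>"
        using has_bochner_integral_real_indicator[of "{b..1}" lborel] b by (simp add: b_def emeasure_lborel_Icc_eq)
    qed
    have "cmod (LINT x:-{-b..b}|lborel. ?E x * ?k x) \<le> (LINT x|lborel. cmod (indicator (-{-b..b}) x *\<^sub>R (?E x * ?k x)))"
      unfolding set_lebesgue_integral_def by (rule integral_norm_bound)
    also have "\<dots> \<le> (LINT x|lborel. 2 * \<delta> powr s * ?I x)"
    proof (rule integral_mono)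
      show "integrable lborel (\<lambda>x. cmod (indicator (-{-b..b}) x *\<^sub>R (?E x * ?k x)))"
        using Ek_int by (intro integrable_norm integrable_mult_indicator) auto
      show "integrable lborel (\<lambda>x. 2 * \<delta> powr s * ?I x)"
        using I_int by (simp only: has_bochner_integral_iff)
      fix x
      show "cmod (indicator (-{-b..b}) x *\<^sub>R (?E x * ?k x)) \<le> 2 * \<delta> powr s * ?I x"
      proof (cases "x \<notin> {-b..b} \<and> \<bar>x\<bar> < 1")
        case True
        then have x: "\<bar>x\<bar> < 1" "b \<le> \<bar>x\<bar>"
          by auto
        have "b\<^sup>2 \<le> \<bar>x\<bar>\<^sup>2"
          using x b by (intro power_mono) auto
        then have "u x \<le> 2 * \<delta>"
          using u_b(1) by (simp add: u_def)
        then have "u x powr s \<le> (2 * \<delta>) powr s"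
          using s u[OF x(1)] by (intro powr_mono2) auto
        then have "\<bar>f x\<bar> \<le> 2 * \<delta> powr s"
          using f_le[OF x(1)] two_powr by linarith
        then have "cmod (?E x * ?k x) \<le> 2 * \<delta> powr s * 1"
          unfolding norm_mult E_norm k_eq[OF x(1)] norm_of_real by simp
        also have "\<dots> \<le> 2 * \<delta> powr s * ?I x"
          using True by (intro mult_left_mono) (auto simp: indicator_def abs_less_iff)
        finally show ?thesis
          using True by simp
      next
        case False
        then have "cmod (indicator (-{-b..b}) x *\<^sub>R (?E x * ?k x)) = 0"
          by (auto simp: ball_kernel_def)
        moreover have "0 \<le> 2 * \<delta> powr s * ?I x"
          by simp
        ultimately show ?thesis
          by (simp only:)
      qed
    qed
    also have "\<dots> = 2 * \<delta> powr s * (\<delta> + \<delta>)"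
      using I_int by (simp only: has_bochner_integral_iff)
    also have "\<dots> = 4 * (\<delta> * \<delta> powr s)"
      by simp
    finally show ?thesis
      unfolding R1 .
  qed
  have "cmod (fourier ?k \<xi>) \<le> (10 + 24 / (1 - s)) * R + 4 * R"
    unfolding split by (intro order_trans[OF norm_triangle_ineq] add_mono middle ends)
  also have "\<dots> = (14 + 24 / (1 - s)) * R"
    by (simp add: algebra_simps)
  finally show ?thesis
    unfolding R_eq .
qed

text \<open>
  The trivial bound for small frequencies and the decay for large ones, in one formula that is uniform
  in \<open>y\<close> and hence survives superposition over \<open>y\<close>.
\<close>

lemma ball_kernel_fourier_decay:
  assumes s: "0 < s" "s < 1" and y: "2 \<le> y"
  shows "(cmod (fourier (\<lambda>x. of_real (ball_kernel s y x)) \<xi>))\<^sup>2 \<le> (4 * (14 + 24 / (1 - s))\<^sup>2) * (1 + \<xi>\<^sup>2) powr - (1 + s)"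
proof -
  let ?k = "\<lambda>x. complex_of_real (ball_kernel s y x)"
  let ?K = "14 + 24 / (1 - s)"
  have K: "?K \<ge> 14"
    using s by simp
  have pos: "1 + \<xi>\<^sup>2 > 0"
    using zero_le_power2[of \<xi>] by linarith
  have comparison: "A powr - (1 + s) \<le> 4 * (1 + \<xi>\<^sup>2) powr - (1 + s)" if A: "A > 0" "1 + \<xi>\<^sup>2 \<le> 2 * A" for A :: real
  proof -
    have "A powr - (1 + s) \<le> ((1 + \<xi>\<^sup>2) / 2) powr - (1 + s)"
      using s pos A by (intro powr_mono2') auto
    also have "\<dots> = (1 + \<xi>\<^sup>2) powr - (1 + s) / 2 powr - (1 + s)"
      using pos by (subst powr_divide) auto
    also have "\<dots> = 2 powr (1 + s) * (1 + \<xi>\<^sup>2) powr - (1 + s)"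
      by (simp only: powr_minus_divide[of 2] divide_divide_eq_right div_by_1 mult.commute)
    also have "\<dots> \<le> 4 * (1 + \<xi>\<^sup>2) powr - (1 + s)"
    proof (intro mult_right_mono)
      have "2 powr (1 + s) \<le> 2 powr (2::real)"
        using s by (intro powr_mono) auto
      then show "2 powr (1 + s) \<le> 4"
        by simp
    qed auto
    finally show ?thesis .
  qed
  show ?thesis
  proof (cases "\<bar>\<xi>\<bar> \<ge> 1")
    case True
    have "(cmod (fourier ?k \<xi>))\<^sup>2 \<le> (?K * \<bar>\<xi>\<bar> powr - (1 + s))\<^sup>2"
      using ball_kernel_fourier_large[OF s y True] by (intro power_mono) auto
    also have "\<dots> = ?K\<^sup>2 * (\<bar>\<xi>\<bar> powr - (1 + s) * \<bar>\<xi>\<bar> powr - (1 + s))"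
      by (simp only: power_mult_distrib power2_eq_square[of "_ powr _"])
    also have "\<bar>\<xi>\<bar> powr - (1 + s) * \<bar>\<xi>\<bar> powr - (1 + s) = (\<xi>\<^sup>2) powr - (1 + s)"
    proof -
      have "\<xi>\<^sup>2 = \<bar>\<xi>\<bar> * \<bar>\<xi>\<bar>"
        by (simp add: power2_eq_square)
      then show ?thesis
        by (simp only: powr_mult abs_ge_zero)
    qed
    also have "?K\<^sup>2 * (\<xi>\<^sup>2) powr - (1 + s) \<le> ?K\<^sup>2 * (4 * (1 + \<xi>\<^sup>2) powr - (1 + s))"
    proof (intro mult_left_mono comparison)
      have "1\<^sup>2 \<le> \<bar>\<xi>\<bar>\<^sup>2"
        using True by (intro power_mono) auto
      then show "\<xi>\<^sup>2 > 0" "1 + \<xi>\<^sup>2 \<le> 2 * \<xi>\<^sup>2"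
        by auto
    qed auto
    finally show ?thesis
      by (simp only: mult.assoc mult.left_commute[of "?K\<^sup>2" 4])
  next
    case False
    have "cmod (fourier ?k \<xi>) \<le> (LINT x|lborel. cmod (?k x))"
      using s y by (intro fourier_norm_le ball_kernel_integrable) auto
    also have "\<dots> \<le> (LINT x|lborel. indicator {-1..1::real} x)"
    proof (intro integral_mono integrable_norm ball_kernel_integrable)
      show "integrable lborel (indicator {-1..1} :: real \<Rightarrow> real)"
        by (intro integrable_real_indicator) (auto simp: emeasure_lborel_Icc_eq)
      show "cmod (?k x) \<le> indicator {-1..1} x" for x
        using ball_kernel_bound[of s y x] s y by simp
    qed (use s y in auto)
    also have "\<dots> = 2"
      by simp
    finally have "cmod (fourier ?k \<xi>) \<le> ?K"
      using K by linarith
    then have "(cmod (fourier ?k \<xi>))\<^sup>2 \<le> ?K\<^sup>2 * 1 powr - (1 + s)"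
      by (simp add: power_mono)
    also have "\<dots> \<le> ?K\<^sup>2 * (4 * (1 + \<xi>\<^sup>2) powr - (1 + s))"
    proof (intro mult_left_mono comparison)
      have "\<bar>\<xi>\<bar>\<^sup>2 \<le> 1\<^sup>2"
        using False by (intro power_mono) auto
      then show "1 + \<xi>\<^sup>2 \<le> 2 * 1"
        by simp
    qed auto
    finally show ?thesis
      by (simp only: mult.assoc mult.left_commute[of "?K\<^sup>2" 4])
  qed
qed

definition ball_potential :: "real \<Rightarrow> (real \<Rightarrow> complex) \<Rightarrow> real \<Rightarrow> complex" where
  "ball_potential s h x = (LINT y|lborel. h y * of_real (ball_kernel s y x))"

context
  fixes s :: real and h :: "real \<Rightarrow> complex"
  assumes s: "0 < s" "s < 1" and h: "integrable lborel h" and h_supp: "\<And>y. y \<notin> {2..3} \<Longrightarrow> h y = 0"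
begin

lemma ball_potential_product_integrable:
  assumes F: "\<And>x. cmod (F x) \<le> B" and [measurable]: "F \<in> borel_measurable borel"
  shows "integrable (lborel \<Otimes>\<^sub>M lborel) (\<lambda>(x, y). F x * (h y * of_real (ball_kernel s y x)))"
proof (rule Bochner_Integration.integrable_bound)
  have [measurable]: "h \<in> borel_measurable borel"
    using h by auto
  show "integrable (lborel \<Otimes>\<^sub>M lborel) (\<lambda>(x, y). of_real B * indicator {-1..1::real} x * h y)"
    by (intro lborel_product_integrable integrable_mult_right indicator_interval_L1_L2 h)
  show "AE z in lborel \<Otimes>\<^sub>M lborel. norm ((\<lambda>(x, y). F x * (h y * of_real (ball_kernel s y x))) z)
      \<le> norm ((\<lambda>(x, y). of_real B * indicator {-1..1::real} x * h y) z)"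
  proof (intro AE_I2)
    fix z :: "real \<times> real"
    obtain x y where z: "z = (x, y)"
      by (cases z)
    have B: "B \<ge> 0"
      using order_trans[OF norm_ge_zero F] .
    show "norm ((\<lambda>(x, y). F x * (h y * of_real (ball_kernel s y x))) z)
      \<le> norm ((\<lambda>(x, y). of_real B * indicator {-1..1::real} x * h y) z)"
    proof (cases "y \<in> {2..3}")
      case True
      then have "\<bar>ball_kernel s y x\<bar> \<le> indicator {-1..1} x"
        using s by (intro ball_kernel_bound) auto
      then have "cmod (F x) * (cmod (h y) * \<bar>ball_kernel s y x\<bar>) \<le> B * (cmod (h y) * indicator {-1..1} x)"
        using B by (intro mult_mono F order_refl) auto
      also have "indicator {-1..1} x = cmod (indicator {-1..1} x)"
        by (simp add: indicator_def)
      finally show ?thesis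
        using B by (simp add: z norm_mult mult_ac)
    qed (simp add: z h_supp)
  qed
  show "(\<lambda>(x, y). F x * (h y * of_real (ball_kernel s y x))) \<in> borel_measurable (lborel \<Otimes>\<^sub>M lborel)"
    by measurable
qed

lemma ball_potential_Fubini:
  assumes F: "\<And>x. cmod (F x) \<le> B" and [measurable]: "F \<in> borel_measurable borel"
  shows "(LINT x|lborel. F x * ball_potential s h x) = (LINT y|lborel. h y * (LINT x|lborel. F x * of_real (ball_kernel s y x)))"
proof -
  have "(LINT x|lborel. F x * ball_potential s h x) = (LINT x|lborel. LINT y|lborel. F x * (h y * of_real (ball_kernel s y x)))"
    by (simp add: ball_potential_def)
  also have "\<dots> = (LINT y|lborel. LINT x|lborel. F x * (h y * of_real (ball_kernel s y x)))"
    by (rule lborel_pair.Fubini_integral[OF ball_potential_product_integrable[OF F assms(2)], symmetric])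
  also have "\<dots> = (LINT y|lborel. h y * (LINT x|lborel. F x * of_real (ball_kernel s y x)))"
    by (simp only: mult.left_commute[of "F _"] integral_mult_right_zero)
  finally show ?thesis .
qed

lemma ball_potential_measurable: "ball_potential s h \<in> borel_measurable borel"
proof -
  have [measurable]: "h \<in> borel_measurable borel"
    using h by auto
  have "(\<lambda>x. LINT y|lborel. h y * of_real (ball_kernel s y x)) \<in> borel_measurable borel"
    by measurable
  then show ?thesis
    by (simp add: ball_potential_def[abs_def])
qed

lemma ball_potential_eq_0: "x \<notin> {-1..1} \<Longrightarrow> ball_potential s h x = 0"
  by (auto simp: ball_potential_def ball_kernel_def)

lemma ball_potential_in_L2: "ball_potential s h \<in> L2 UNIV"
proof (rule L2_dominated[OF ball_potential_measurable indicator_interval_L1_L2(2)[of "-1" 1]])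
  fix x
  show "cmod (ball_potential s h x) \<le> (LINT y|lborel. cmod (h y)) * cmod (indicator {-1..1} x)"
  proof (cases "x \<in> {-1..1}")
    case True
    have "cmod (ball_potential s h x) \<le> (LINT y|lborel. cmod (h y * of_real (ball_kernel s y x)))"
      unfolding ball_potential_def by (rule integral_norm_bound)
    also have "\<dots> \<le> (LINT y|lborel. cmod (h y))"
    proof (rule integral_mono')
      fix y
      show "cmod (h y * of_real (ball_kernel s y x)) \<le> cmod (h y)"
      proof (cases "y \<in> {2..3}")
        case yT: True
        then have "\<bar>ball_kernel s y x\<bar> \<le> 1"
          using ball_kernel_bound[of s y x] s True by auto
        then show ?thesis
          by (simp add: norm_mult mult_left_le)
      qed (simp add: h_supp)
    qed (use h in auto)
    finally show ?thesis
      using True by simp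
  qed (simp add: ball_potential_eq_0)
qed

lemma ball_potential_in_Hs_tilde: "ball_potential s h \<in> Hs_tilde s {-1<..<1}"
proof -
  let ?C = "4 * (14 + 24 / (1 - s))\<^sup>2"
  let ?I = "LINT y|lborel. cmod (h y)"
  show ?thesis
  proof (rule Hs_tildeI_fourier_decay[where C = "?I\<^sup>2 * ?C"])
    fix \<xi> :: real
    define r where "r = sqrt (?C * (1 + \<xi>\<^sup>2) powr - (1 + s))"
    have F: "fourier (ball_potential s h) \<xi> = (LINT y|lborel. h y * fourier (\<lambda>x. of_real (ball_kernel s y x)) \<xi>)"
      unfolding fourier_def by (rule ball_potential_Fubini[where B = 1]) auto
    have "cmod (fourier (ball_potential s h) \<xi>) \<le> (LINT y|lborel. cmod (h y * fourier (\<lambda>x. of_real (ball_kernel s y x)) \<xi>))"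
      unfolding F by (rule integral_norm_bound)
    also have "\<dots> \<le> (LINT y|lborel. cmod (h y) * r)"
    proof (rule integral_mono')
      fix y
      show "cmod (h y * fourier (\<lambda>x. of_real (ball_kernel s y x)) \<xi>) \<le> cmod (h y) * r"
      proof (cases "y \<in> {2..3}")
        case True
        then show ?thesis
          using real_le_rsqrt[OF ball_kernel_fourier_decay[OF s, of y \<xi>]]
          unfolding r_def norm_mult by (intro mult_left_mono) auto
      qed (simp add: h_supp)
    next
      show "cmod (h y) * r \<ge> 0" for y
        unfolding r_def by (intro mult_nonneg_nonneg real_sqrt_ge_zero) auto
    qed (use h in auto)
    also have "\<dots> = ?I * r"
      by (rule integral_mult_left_zero)
    finally have "(cmod (fourier (ball_potential s h) \<xi>))\<^sup>2 \<le> (?I * r)\<^sup>2"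
      by (intro power_mono) auto
    also have "\<dots> = ?I\<^sup>2 * ?C * (1 + \<xi>\<^sup>2) powr - (1 + s)"
      unfolding power_mult_distrib r_def by simp
    finally show "(cmod (fourier (ball_potential s h) \<xi>))\<^sup>2 \<le> ?I\<^sup>2 * ?C * (1 + \<xi>\<^sup>2) powr - (1 + s)" .
  qed (use s ball_potential_in_L2 ball_potential_eq_0 in auto)
qed

end

section \<open>Contour integrals over the real line\<close>

lemma interior_upper_half_plane: "interior {z. Im z \<ge> 0} \<subseteq> {z. Im z > 0}"
proof
  fix z assume "z \<in> interior {z. Im z \<ge> 0}"
  then obtain e where e: "e > 0" "cball z e \<subseteq> {z. Im z \<ge> 0}"
    by (auto simp: mem_interior_cball)
  then have "z - \<i> * of_real e \<in> {z. Im z \<ge> 0}"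
    by (intro subsetD[OF e(2)]) (simp add: dist_norm norm_mult)
  then show "z \<in> {z. Im z > 0}"
    using e(1) by simp
qed

text \<open>
  Half discs: the integral over the arc of radius \<open>R\<close> is at most \<open>\<pi> R B / (1 + R\<^sup>2)\<close>. Continuity up to
  the real axis is enough for Cauchy's theorem on a convex set, so the line needs no shift.
\<close>

lemma Cauchy_upper_half_plane:
  assumes cont: "continuous_on {z. Im z \<ge> 0} F" and hol: "\<And>z. Im z > 0 \<Longrightarrow> F field_differentiable at z"
    and bound: "\<And>z. Im z \<ge> 0 \<Longrightarrow> cmod (F z) \<le> B / (1 + (cmod z)\<^sup>2)"
  shows "integrable lborel (\<lambda>x. F (of_real x))" "(LINT x|lborel. F (of_real x)) = 0"
proof -
  have pos: "1 + r\<^sup>2 > 0" for r :: real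
    using zero_le_power2[of r] by linarith
  have B: "B \<ge> 0"
    using order_trans[OF norm_ge_zero bound[of 0]] by simp
  have cont_real: "continuous_on S (\<lambda>x. F (of_real x))" for S :: "real set"
    by (intro continuous_on_compose2[OF cont] continuous_intros) auto
  then have [measurable]: "(\<lambda>x. F (of_real x)) \<in> borel_measurable borel"
    by (intro borel_measurable_continuous_onI)
  show int: "integrable lborel (\<lambda>x. F (of_real x))"
  proof (rule Bochner_Integration.integrable_bound)
    show "integrable lborel (\<lambda>x::real. B * (1 / (1 + x\<^sup>2)))"
      by (intro integrable_mult_right inverse_one_plus_sq_integrable)
    show "AE x in lborel. cmod (F (of_real x)) \<le> norm (B * (1 / (1 + x\<^sup>2)))"
    proof (intro AE_I2)
      fix x :: real
      have "cmod (F (of_real x)) \<le> B / (1 + x\<^sup>2)"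
        using bound[of "of_real x"] by simp
      also have "\<dots> = norm (B * (1 / (1 + x\<^sup>2)))"
        using B pos[of x] by simp
      finally show "cmod (F (of_real x)) \<le> norm (B * (1 / (1 + x\<^sup>2)))" .
    qed
  qed measurable
  have segment: "cmod (LINT x:{-R..R}|lborel. F (of_real x)) \<le> B * pi * (1 / R)" if R: "R > 0" for R :: real
  proof -
    let ?arc = "part_circlepath 0 R 0 pi" and ?line = "linepath (of_real (- R)) (of_real R) :: real \<Rightarrow> complex"
    have arc_sub: "path_image ?arc \<subseteq> {z. Im z \<ge> 0}"
      using R by (auto simp: path_image_part_circlepath Im_exp sin_ge_zero)
    have line_sub: "path_image ?line \<subseteq> {z. Im z \<ge> 0}"
      by (intro path_image_linepath[THEN equalityD1, THEN subset_trans] closed_segment_subset) (auto simp: convex_halfspace_Im_ge)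
    have ends: "pathfinish ?line = pathstart ?arc" "pathfinish ?arc = pathstart ?line"
      by auto
    have arc_int: "F contour_integrable_on ?arc"
      by (intro contour_integrable_continuous_part_circlepath continuous_on_subset[OF cont] arc_sub)
    have line_int: "F contour_integrable_on ?line"
      by (intro contour_integrable_continuous_linepath continuous_on_subset[OF cont]) (use line_sub in simp)
    have "(F has_contour_integral 0) (?line +++ ?arc)"
    proof (rule Cauchy_theorem_convex[OF cont convex_halfspace_Im_ge, of "{}"])
      show "F field_differentiable at x" if "x \<in> interior {z. Im z \<ge> 0} - {}" for x
        using that interior_upper_half_plane by (intro hol) auto
      show "path_image (?line +++ ?arc) \<subseteq> {z. Im z \<ge> 0}"
        using arc_sub line_sub by (intro subset_path_image_join)
    qed (use ends in \<open>auto intro: valid_path_join\<close>)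
    then have "contour_integral (?line +++ ?arc) F = 0"
      by (rule contour_integral_unique)
    moreover have "contour_integral (?line +++ ?arc) F = contour_integral ?line F + contour_integral ?arc F"
      by (rule contour_integral_join[OF line_int arc_int]) auto
    ultimately have "contour_integral ?line F + contour_integral ?arc F = 0"
      by simp
    then have "cmod (contour_integral ?line F) = cmod (contour_integral ?arc F)"
      by (metis add_eq_0_iff norm_minus_cancel)
    also have "\<dots> \<le> (B / (1 + R\<^sup>2)) * R * (pi - 0)"
    proof (rule has_contour_integral_bound_part_circlepath[OF has_contour_integral_integral[OF arc_int]])
      show "cmod (F z) \<le> B / (1 + R\<^sup>2)" if "z \<in> path_image ?arc" for z
      proof -
        have "cmod z = R"
          using that R in_path_image_part_circlepath[of z 0 R 0 pi] by simp
        then show ?thesis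
          using bound[of z] subsetD[OF arc_sub that] by simp
      qed
    qed (use B R pos[of R] in auto)
    also have "\<dots> = B * pi * (R / (1 + R\<^sup>2))"
      by simp
    also have "\<dots> \<le> B * pi * (1 / R)"
      using B R pos[of R] by (intro mult_left_mono) (auto simp: field_simps power2_eq_square)
    also have "contour_integral ?line F = integral {-R..R} (\<lambda>x. F (of_real x))"
      using R by (subst contour_integral_linepath_Reals_eq) auto
    also have "\<dots> = (LINT x:{-R..R}|lborel. F (of_real x))"
      by (intro set_borel_integral_eq_integral(2)[symmetric] borel_integrable_atLeastAtMost' cont_real)
    finally show ?thesis .
  qed
  have lim: "(\<lambda>n. LINT x:{- real n..real n}|lborel. F (of_real x)) \<longlonglongrightarrow> (LINT x|lborel. F (of_real x))"
    unfolding set_lebesgue_integral_def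
  proof (rule integral_dominated_convergence[where w = "\<lambda>x. cmod (F (of_real x))"])
    show "AE x in lborel. (\<lambda>n. indicator {- real n..real n} x *\<^sub>R F (of_real x)) \<longlonglongrightarrow> F (of_real x)"
    proof (intro AE_I2)
      fix x
      obtain N :: nat where N: "\<bar>x\<bar> \<le> real N"
        using real_arch_simple by blast
      have "\<forall>\<^sub>F n in sequentially. indicator {- real n..real n} x *\<^sub>R F (of_real x) = F (of_real x)"
        using eventually_ge_at_top[of N]
      proof eventually_elim
        case (elim n)
        then have "\<bar>x\<bar> \<le> real n"
          using N by linarith
        then show ?case
          by (simp add: abs_le_iff)
      qed
      then show "(\<lambda>n. indicator {- real n..real n} x *\<^sub>R F (of_real x)) \<longlonglongrightarrow> F (of_real x)"
        by (rule tendsto_eventually)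
    qed
  qed (use int in \<open>auto simp: indicator_def\<close>)
  have "(\<lambda>n. LINT x:{- real n..real n}|lborel. F (of_real x)) \<longlonglongrightarrow> 0"
  proof (rule Lim_null_comparison)
    show "\<forall>\<^sub>F n in sequentially. cmod (LINT x:{- real n..real n}|lborel. F (of_real x)) \<le> B * pi * (1 / real n)"
      using eventually_gt_at_top[of 0] by eventually_elim (intro segment, simp)
    have "(\<lambda>n. B * pi * (1 / real n)) \<longlonglongrightarrow> B * pi * 0"
      by (intro tendsto_intros lim_1_over_n)
    then show "(\<lambda>n. B * pi * (1 / real n)) \<longlonglongrightarrow> 0"
      by simp
  qed
  with lim show "(LINT x|lborel. F (of_real x)) = 0"
    by (rule LIMSEQ_unique)
qed

section \<open>The Laplace transform of a power\<close>

definition laplace_power :: "real \<Rightarrow> complex \<Rightarrow> complex" where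
  "laplace_power a p = (LINT \<xi>|lborel. indicator {0<..} \<xi> *\<^sub>R (of_real (\<xi> powr a) * exp (- p * of_real \<xi>)))"

lemma powr_exp_integrable:
  assumes "a \<ge> 0" "Re p > 0"
  shows "integrable lborel (\<lambda>\<xi>. indicator {0<..} \<xi> *\<^sub>R (complex_of_real (\<xi> powr a) * exp (- p * of_real \<xi>)))"
proof -
  let ?f = "\<lambda>t::real. of_real t powr (of_real (a + 1) - 1) / complex_of_real (exp (Re p * t))"
  let ?g = "\<lambda>t::real. indicator {0<..} t *\<^sub>R complex_of_real (t powr a * exp (- Re p * t))"
  have "?f absolutely_integrable_on {0<..}"
    using assms by (intro absolutely_integrable_Gamma_integral) auto
  then have "integrable lebesgue (\<lambda>t. indicator {0<..} t *\<^sub>R ?f t)"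
    by (simp add: set_integrable_def)
  also have "(\<lambda>t. indicator {0<..} t *\<^sub>R ?f t) = ?g"
  proof (intro ext)
    fix t :: real
    show "indicator {0<..} t *\<^sub>R ?f t = ?g t"
    proof (cases "t > 0")
      case True
      then have "complex_of_real t powr (of_real (a + 1) - 1) = of_real (t powr a)"
        using powr_of_real[of t a] by simp
      then show ?thesis
        using True by (simp add: exp_minus divide_inverse)
    qed simp
  qed
  finally have int: "integrable lborel ?g"
    by (subst (asm) integrable_completion) auto
  show ?thesis
  proof (rule Bochner_Integration.integrable_bound[OF int])
    show "AE \<xi> in lborel. cmod (indicator {0<..} \<xi> *\<^sub>R (complex_of_real (\<xi> powr a) * exp (- p * of_real \<xi>))) \<le> cmod (?g \<xi>)"
      by (intro AE_I2) (simp add: norm_mult norm_exp_eq_Re)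
  qed measurable
qed

lemma laplace_power_has_field_derivative:
  assumes a: "a \<ge> 0" and p: "Re p > 0"
  shows "(laplace_power a has_field_derivative - laplace_power (a + 1) p) (at p)"
proof -
  let ?f = "\<lambda>\<xi> p. indicator {0<..} \<xi> *\<^sub>R (complex_of_real (\<xi> powr a) * exp (- p * of_real \<xi>))"
  let ?D = "\<lambda>\<xi>. - (indicator {0<..} \<xi> *\<^sub>R (complex_of_real (\<xi> powr (a + 1)) * exp (- p * of_real \<xi>)))"
  let ?g = "\<lambda>\<xi>. cmod (indicator {0<..} \<xi> *\<^sub>R (complex_of_real (\<xi> powr (a + 1)) * exp (- of_real (Re p / 2) * of_real \<xi>)))"
  have re: "Re z \<ge> Re p / 2" if "z \<in> ball p (Re p / 2)" for z
  proof -
    have "Re p - Re z \<le> cmod (p - z)"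
      using complex_Re_le_cmod[of "p - z"] by simp
    then show ?thesis
      using that by (simp add: dist_norm)
  qed
  have d: "(?f \<xi> has_field_derivative - of_real \<xi> * ?f \<xi> z) (at z within S)" for \<xi> z S
    by (auto intro!: derivative_eq_intros simp: scaleR_conv_of_real)
  have pw: "of_real \<xi> * ?f \<xi> z = indicator {0<..} \<xi> *\<^sub>R (complex_of_real (\<xi> powr (a + 1)) * exp (- z * of_real \<xi>))" for \<xi> z
    by (cases "\<xi> > 0") (simp_all add: powr_add)
  have d_le: "cmod (- of_real \<xi> * ?f \<xi> z) \<le> ?g \<xi>" if "z \<in> ball p (Re p / 2)" for \<xi> z
  proof (cases "\<xi> > 0")
    case True
    have "exp (- (Re z * \<xi>)) \<le> exp (- (Re p / 2 * \<xi>))"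
      using re[OF that] True by (simp add: mult_right_mono)
    then have "\<xi> powr (a + 1) * exp (- (Re z * \<xi>)) \<le> \<xi> powr (a + 1) * exp (- (Re p / 2 * \<xi>))"
      by (intro mult_left_mono) auto
    moreover have norm_eq: "cmod (- of_real \<xi> * ?f \<xi> z) = cmod (of_real \<xi> * ?f \<xi> z)"
      unfolding norm_mult norm_minus_cancel ..
    ultimately show ?thesis
      unfolding norm_eq pw using True by (simp add: norm_mult norm_exp_eq_Re)
  qed simp
  have "((\<lambda>z. integral\<^sup>L lborel (\<lambda>\<xi>. ?f \<xi> z)) has_derivative (\<lambda>h. integral\<^sup>L lborel ?D * h)) (at p)"
  proof (rule has_derivative_integral[where r = "Re p / 2" and g = ?g and e = "\<lambda>h. h"])
    show "integrable lborel (\<lambda>\<xi>. ?f \<xi> z)" if "z \<in> ball p (Re p / 2)" for z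
      using re[OF that] p by (intro powr_exp_integrable a) auto
    show "integrable lborel ?g"
      using a p by (intro integrable_norm powr_exp_integrable) auto
    show "?D \<in> borel_measurable lborel"
      by measurable
    fix \<xi> :: real
    have D: "?D \<xi> = - of_real \<xi> * ?f \<xi> p"
      unfolding pw[symmetric] by (rule minus_mult_left)
    show "(?f \<xi> has_derivative (\<lambda>h. ?D \<xi> * h)) (at p)"
      unfolding D by (rule d[of \<xi> p UNIV, unfolded has_field_derivative_def])
    show "cmod (?D \<xi>) \<le> ?g \<xi>"
      unfolding D using p by (intro d_le) simp
    show "cmod (?f \<xi> z - ?f \<xi> p) \<le> ?g \<xi> * cmod (z - p)" if z: "z \<in> ball p (Re p / 2)" for z
      by (rule field_differentiable_bound[OF convex_ball d d_le z]) (use p in auto)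
  qed (use p in \<open>auto intro: bounded_linear_ident\<close>)
  moreover have "integral\<^sup>L lborel ?D = - laplace_power (a + 1) p"
    by (simp add: laplace_power_def)
  moreover have "(\<lambda>z. integral\<^sup>L lborel (\<lambda>\<xi>. ?f \<xi> z)) = laplace_power a"
    by (simp add: laplace_power_def[abs_def])
  ultimately show ?thesis
    by (simp only: has_field_derivative_def)
qed

lemma laplace_power_real:
  assumes "a \<ge> 0" "r > 0"
  shows "laplace_power a (of_real r) = of_real (r powr - (a + 1)) * laplace_power a 1"
proof -
  let ?f = "\<lambda>\<xi>. indicator {0<..} \<xi> *\<^sub>R (complex_of_real (\<xi> powr a) * exp (- of_real r * of_real \<xi>))"
  have "laplace_power a (of_real r) = \<bar>1 / r\<bar> *\<^sub>R (LINT \<xi>|lborel. ?f (0 + (1 / r) * \<xi>))"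
    unfolding laplace_power_def using assms by (intro lborel_integral_real_affine) auto
  also have "(LINT \<xi>|lborel. ?f (0 + (1 / r) * \<xi>))
      = (LINT \<xi>|lborel. of_real (r powr - a) * (indicator {0<..} \<xi> *\<^sub>R (complex_of_real (\<xi> powr a) * exp (- 1 * of_real \<xi>))))"
  proof (intro Bochner_Integration.integral_cong refl)
    fix \<xi> :: real
    show "?f (0 + (1 / r) * \<xi>) = of_real (r powr - a) * (indicator {0<..} \<xi> *\<^sub>R (complex_of_real (\<xi> powr a) * exp (- 1 * of_real \<xi>)))"
    proof (cases "\<xi> > 0")
      case True
      then have "(1 / r * \<xi>) powr a = r powr - a * \<xi> powr a"
        using assms by (simp add: powr_mult powr_divide powr_minus_divide)
      then show ?thesis
        using True assms by simp
    qed (use assms in \<open>simp add: zero_less_divide_iff\<close>)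
  qed
  also have "\<dots> = of_real (r powr - a) * laplace_power a 1"
    unfolding laplace_power_def by (rule integral_mult_right_zero)
  also have "\<bar>1 / r\<bar> *\<^sub>R (of_real (r powr - a) * laplace_power a 1) = of_real (r powr - (a + 1)) * laplace_power a 1"
    using assms by (simp add: scaleR_conv_of_real powr_diff powr_minus_divide field_simps powr_add)
  finally show ?thesis .
qed

text \<open>The scaling rule on the positive axis extends to the half plane by the identity theorem.\<close>

lemma laplace_power_eq:
  assumes a: "a \<ge> 0" and p: "Re p > 0"
  shows "laplace_power a p = laplace_power a 1 * p powr of_real (- (a + 1))"
proof -
  let ?S = "{z. Re z > 0}"
  have "laplace_power a p - laplace_power a 1 * p powr of_real (- (a + 1)) = 0"
  proof (rule analytic_continuation[where f = "\<lambda>p. laplace_power a p - laplace_power a 1 * p powr of_real (- (a + 1))"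
        and S = ?S and U = "of_real ` {0<..}" and \<xi> = 1])
    show "(\<lambda>p. laplace_power a p - laplace_power a 1 * p powr of_real (- (a + 1))) holomorphic_on ?S"
    proof (intro holomorphic_intros)
      show "laplace_power a holomorphic_on ?S"
        unfolding holomorphic_on_def
        using laplace_power_has_field_derivative[OF a] field_differentiable_at_within field_differentiable_def by blast
    qed (auto simp: complex_nonpos_Reals_iff)
    show "open ?S"
      by (rule open_halfspace_Re_gt)
    show "connected ?S"
      by (rule convex_connected[OF convex_halfspace_Re_gt])
    show "(1::complex) islimpt of_real ` {0<..}"
      unfolding islimpt_approachable
    proof (intro allI impI)
      fix e :: real assume "e > 0"
      then show "\<exists>x'\<in>of_real ` {0<..}. x' \<noteq> (1::complex) \<and> dist x' 1 < e"
        by (intro bexI[of _ "of_real (1 + e / 2)"] imageI) (simp_all add: dist_norm norm_divide)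
    qed
    show "laplace_power a z - laplace_power a 1 * z powr of_real (- (a + 1)) = 0" if z: "z \<in> of_real ` {0<..}" for z
    proof -
      obtain r where r: "z = of_real r" "r > 0"
        using z by auto
      have "z powr of_real (- (a + 1)) = of_real (r powr - (a + 1))"
        unfolding r(1) using r(2) by (simp add: powr_of_real del: of_real_minus of_real_add minus_add_distrib)
      then show ?thesis
        using laplace_power_real[OF a r(2)] r by simp
    qed
  qed (use p in auto)
  then show ?thesis
    by simp
qed

section \<open>The half-line transform and its boundary values\<close>

text \<open>
  The positive frequencies of \<open>\<bar>\<xi>\<bar>\<^bsup>2s\<^esup> \<phi>\<^sup>^\<close>. Their inverse transform, up to the factor \<open>2 \<pi>\<close>, extends to the
  upper half plane as \<open>half_transform\<close>.
\<close>

definition half_weight :: "real \<Rightarrow> (real \<Rightarrow> complex) \<Rightarrow> real \<Rightarrow> complex" where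
  "half_weight s \<phi> \<xi> = indicator {0<..} \<xi> *\<^sub>R (of_real (\<xi> powr (2 * s)) * fourier \<phi> \<xi>)"

definition half_transform :: "real \<Rightarrow> (real \<Rightarrow> complex) \<Rightarrow> complex \<Rightarrow> complex" where
  "half_transform s \<phi> z = (LINT \<xi>|lborel. half_weight s \<phi> \<xi> * exp (\<i> * z * of_real \<xi>))"

definition riesz_integral :: "real \<Rightarrow> (real \<Rightarrow> complex) \<Rightarrow> complex \<Rightarrow> complex" where
  "riesz_integral s \<phi> z = (LINT t|lborel. \<phi> t * (- \<i> * (z - of_real t)) powr of_real (- (2 * s + 1)))"

text \<open>
  The two powers form the branch of \<open>(1 - z\<^sup>2)\<^sup>s\<close> in the upper half plane that is real on \<open>(-1, 1)\<close>. Writing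
  them with \<open>-i (z - 1)\<close> and \<open>-i (z + 1)\<close>, whose real parts are \<open>Im z\<close>, keeps the principal branch holomorphic on
  the open half plane and continuous up to the axis, the branch points included.
\<close>

definition cut_function :: "real \<Rightarrow> (real \<Rightarrow> complex) \<Rightarrow> complex \<Rightarrow> complex" where
  "cut_function s \<phi> z = (- \<i> * (z - 1)) powr of_real s * (- \<i> * (z + 1)) powr of_real s * half_transform s \<phi> z"

lemma powr_imaginary_axis:
  assumes r: "r \<noteq> 0"
  shows "(- \<i> * complex_of_real r) powr of_real a
    = of_real (\<bar>r\<bar> powr a) * exp (- \<i> * of_real (sgn r * (pi * a / 2)))"
proof -
  have Ln: "Ln (- \<i> * complex_of_real r) = of_real (ln \<bar>r\<bar>) - \<i> * of_real (sgn r * (pi / 2))"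
  proof (cases "r > 0")
    case True
    then show ?thesis
      using Ln_times_of_real[OF True, of "- \<i>"] Ln_of_real[OF True] by (simp add: mult.commute)
  next
    case False
    then have "- r > 0"
      using r by simp
    then show ?thesis
      using Ln_times_of_real[of "- r" \<i>] Ln_of_real[of "- r"] by (simp add: mult.commute)
  qed
  have powr: "complex_of_real (\<bar>r\<bar> powr a) = exp (of_real a * of_real (ln \<bar>r\<bar>))"
    using r by (simp add: powr_def exp_of_real[symmetric])
  show ?thesis
    unfolding powr_def[of "- \<i> * complex_of_real r"] Ln powr mult_exp_exp using r by (simp add: algebra_simps)
qed

text \<open>
  Smoothness of \<open>\<phi>\<close> enters only through the decay of its transform. These hypotheses are stable under
  \<open>t \<mapsto> -t\<close>, which exchanges positive and negative frequencies; thus statements about the lower half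
  plane are statements about the reflected function in the upper one.
\<close>

locale rapid_transform =
  fixes s :: real and \<phi> :: "real \<Rightarrow> complex" and C :: real
  assumes s: "0 < s" "s < 1" and integrable: "integrable lborel \<phi>"
    and supp: "\<And>x. x \<notin> {-1..1} \<Longrightarrow> \<phi> x = 0"
    and decay: "\<And>\<xi>. (1 + \<xi>\<^sup>2) ^ 3 * cmod (fourier \<phi> \<xi>) \<le> C"
begin

lemma measurable_phi [measurable]: "\<phi> \<in> borel_measurable borel"
  using integrable by auto

lemma measurable_fourier [measurable]: "fourier \<phi> \<in> borel_measurable borel"
  by (rule fourier_measurable[OF integrable])

lemma measurable_half_weight [measurable]: "half_weight s \<phi> \<in> borel_measurable borel"
  unfolding half_weight_def[abs_def] by measurable

lemma half_weight_bound: "(1 + \<xi>\<^sup>2) * cmod (half_weight s \<phi> \<xi>) \<le> C * (1 / (1 + \<xi>\<^sup>2))"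
proof -
  have pos: "1 + \<xi>\<^sup>2 > 0"
    using zero_le_power2[of \<xi>] by linarith
  have C: "C \<ge> 0"
    using order_trans[OF _ decay[of 0]] by simp
  show ?thesis
  proof (cases "\<xi> > 0")
    case True
    have "\<xi> powr (2 * s) \<le> (1 + \<xi>\<^sup>2) powr s"
      using abs_powr_le[of s \<xi>] s True by simp
    also have "\<dots> \<le> (1 + \<xi>\<^sup>2) powr 1"
      using s by (intro powr_mono) auto
    also have "\<dots> = 1 + \<xi>\<^sup>2"
      using pos by simp
    finally have p: "\<xi> powr (2 * s) \<le> 1 + \<xi>\<^sup>2" .
    have "(1 + \<xi>\<^sup>2) * cmod (half_weight s \<phi> \<xi>) = \<xi> powr (2 * s) * ((1 + \<xi>\<^sup>2) * cmod (fourier \<phi> \<xi>))"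
      using True by (simp add: half_weight_def norm_mult)
    also have "\<dots> \<le> (1 + \<xi>\<^sup>2) * ((1 + \<xi>\<^sup>2) * cmod (fourier \<phi> \<xi>))"
      using p by (intro mult_right_mono) auto
    also have "\<dots> = ((1 + \<xi>\<^sup>2) ^ 3 * cmod (fourier \<phi> \<xi>)) * (1 / (1 + \<xi>\<^sup>2))"
      using pos by (simp add: power3_eq_cube)
    also have "\<dots> \<le> C * (1 / (1 + \<xi>\<^sup>2))"
      using pos by (intro mult_right_mono decay) auto
    finally show ?thesis .
  qed (use C pos in \<open>simp add: half_weight_def\<close>)
qed

lemma half_weight_integrable:
  "integrable lborel (half_weight s \<phi>)" "integrable lborel (\<lambda>\<xi>. \<bar>\<xi>\<bar> * cmod (half_weight s \<phi> \<xi>))"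
proof -
  have dom: "integrable lborel (\<lambda>\<xi>::real. C * (1 / (1 + \<xi>\<^sup>2)))"
    by (intro integrable_mult_right inverse_one_plus_sq_integrable)
  have le: "cmod (half_weight s \<phi> \<xi>) \<le> C * (1 / (1 + \<xi>\<^sup>2))" "\<bar>\<xi>\<bar> * cmod (half_weight s \<phi> \<xi>) \<le> C * (1 / (1 + \<xi>\<^sup>2))" for \<xi>
  proof -
    have "1 * cmod (half_weight s \<phi> \<xi>) \<le> (1 + \<xi>\<^sup>2) * cmod (half_weight s \<phi> \<xi>)"
      by (intro mult_right_mono) auto
    then show "cmod (half_weight s \<phi> \<xi>) \<le> C * (1 / (1 + \<xi>\<^sup>2))"
      using half_weight_bound[of \<xi>] by linarith
    have "\<bar>\<xi>\<bar> \<le> 1 + \<xi>\<^sup>2"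
      using sum_squares_bound[of "\<bar>\<xi>\<bar>" 1] zero_le_power2[of \<xi>] by simp
    then have "\<bar>\<xi>\<bar> * cmod (half_weight s \<phi> \<xi>) \<le> (1 + \<xi>\<^sup>2) * cmod (half_weight s \<phi> \<xi>)"
      by (intro mult_right_mono) auto
    then show "\<bar>\<xi>\<bar> * cmod (half_weight s \<phi> \<xi>) \<le> C * (1 / (1 + \<xi>\<^sup>2))"
      using half_weight_bound[of \<xi>] by linarith
  qed
  show "integrable lborel (half_weight s \<phi>)"
    by (rule Bochner_Integration.integrable_bound[OF dom])
      (measurable, intro AE_I2 order_trans[OF le(1)], simp only: real_norm_def abs_ge_self)
  show "integrable lborel (\<lambda>\<xi>. \<bar>\<xi>\<bar> * cmod (half_weight s \<phi> \<xi>))"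
  proof (rule Bochner_Integration.integrable_bound[OF dom])
    show "AE \<xi> in lborel. norm (\<bar>\<xi>\<bar> * cmod (half_weight s \<phi> \<xi>)) \<le> norm (C * (1 / (1 + \<xi>\<^sup>2)))"
    proof (intro AE_I2)
      fix \<xi> :: real
      have "norm (\<bar>\<xi>\<bar> * cmod (half_weight s \<phi> \<xi>)) = \<bar>\<xi>\<bar> * cmod (half_weight s \<phi> \<xi>)"
        by simp
      also have "\<dots> \<le> norm (C * (1 / (1 + \<xi>\<^sup>2)))"
        using le(2)[of \<xi>] unfolding real_norm_def by linarith
      finally show "norm (\<bar>\<xi>\<bar> * cmod (half_weight s \<phi> \<xi>)) \<le> norm (C * (1 / (1 + \<xi>\<^sup>2)))" .
    qed
  qed measurable
qed

lemma half_kernel_norm_le: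
  assumes "Im z \<ge> 0"
  shows "cmod (half_weight s \<phi> \<xi> * exp (\<i> * z * of_real \<xi>)) \<le> cmod (half_weight s \<phi> \<xi>)"
proof (cases "\<xi> > 0")
  case True
  then have "cmod (exp (\<i> * z * of_real \<xi>)) \<le> 1"
    using assms by (simp add: norm_exp_eq_Re)
  then show ?thesis
    by (simp add: norm_mult mult_left_le)
qed (simp add: half_weight_def)

lemma half_kernel_integrable:
  assumes "Im z \<ge> 0"
  shows "integrable lborel (\<lambda>\<xi>. half_weight s \<phi> \<xi> * exp (\<i> * z * of_real \<xi>))"
  by (rule Bochner_Integration.integrable_bound[OF half_weight_integrable(1)])
    (measurable, intro AE_I2 half_kernel_norm_le assms)

lemma half_transform_tendsto:
  assumes "\<And>n. Im (u n) \<ge> 0" "u \<longlonglongrightarrow> z"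
  shows "(\<lambda>n. half_transform s \<phi> (u n)) \<longlonglongrightarrow> half_transform s \<phi> z"
  unfolding half_transform_def
proof (rule integral_dominated_convergence[where w = "\<lambda>\<xi>. cmod (half_weight s \<phi> \<xi>)"])
  show "AE \<xi> in lborel. (\<lambda>n. half_weight s \<phi> \<xi> * exp (\<i> * u n * of_real \<xi>)) \<longlonglongrightarrow> half_weight s \<phi> \<xi> * exp (\<i> * z * of_real \<xi>)"
    by (intro AE_I2 tendsto_intros assms)
  show "AE \<xi> in lborel. cmod (half_weight s \<phi> \<xi> * exp (\<i> * u n * of_real \<xi>)) \<le> cmod (half_weight s \<phi> \<xi>)" for n
    by (intro AE_I2 half_kernel_norm_le assms)
qed (use half_weight_integrable(1) in \<open>measurable, auto\<close>)

lemma half_transform_continuous_on: "continuous_on {z. Im z \<ge> 0} (half_transform s \<phi>)"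
  unfolding continuous_on_sequentially comp_def using half_transform_tendsto by auto

lemma half_transform_field_differentiable:
  assumes z0: "Im z0 > 0"
  shows "half_transform s \<phi> field_differentiable at z0"
proof -
  let ?f = "\<lambda>\<xi> z. half_weight s \<phi> \<xi> * exp (\<i> * z * of_real \<xi>)"
  let ?D = "\<lambda>\<xi>. \<i> * of_real \<xi> * ?f \<xi> z0"
  have im: "Im z \<ge> 0" if "z \<in> ball z0 (Im z0)" for z
  proof -
    have "Im z0 - Im z \<le> cmod (z0 - z)"
      using abs_Im_le_cmod[of "z0 - z"] by simp
    then show ?thesis
      using that by (simp add: dist_norm)
  qed
  have d: "(?f \<xi> has_field_derivative \<i> * of_real \<xi> * ?f \<xi> z) (at z within S)" for \<xi> z S
    by (auto intro!: derivative_eq_intros)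
  have d_le: "cmod (\<i> * of_real \<xi> * ?f \<xi> z) \<le> \<bar>\<xi>\<bar> * cmod (half_weight s \<phi> \<xi>)" if "z \<in> ball z0 (Im z0)" for \<xi> z
  proof -
    have "cmod (\<i> * of_real \<xi> * ?f \<xi> z) = \<bar>\<xi>\<bar> * cmod (?f \<xi> z)"
      by (simp only: norm_mult[of _ "?f \<xi> z"]) (simp add: norm_mult)
    also have "\<dots> \<le> \<bar>\<xi>\<bar> * cmod (half_weight s \<phi> \<xi>)"
      by (intro mult_left_mono half_kernel_norm_le im that) auto
    finally show ?thesis .
  qed
  have "((\<lambda>z. integral\<^sup>L lborel (\<lambda>\<xi>. ?f \<xi> z)) has_derivative (\<lambda>h. integral\<^sup>L lborel ?D * h)) (at z0)"
  proof (rule has_derivative_integral[where r = "Im z0" and g = "\<lambda>\<xi>. \<bar>\<xi>\<bar> * cmod (half_weight s \<phi> \<xi>)" and e = "\<lambda>h. h"])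
    show "integrable lborel (\<lambda>\<xi>. ?f \<xi> z)" if "z \<in> ball z0 (Im z0)" for z
      by (intro half_kernel_integrable im that)
    show "?D \<in> borel_measurable lborel"
      by measurable
    fix \<xi> :: real
    show "(?f \<xi> has_derivative (\<lambda>h. ?D \<xi> * h)) (at z0)"
      by (rule d[of \<xi> z0 UNIV, unfolded has_field_derivative_def])
    show "cmod (?D \<xi>) \<le> \<bar>\<xi>\<bar> * cmod (half_weight s \<phi> \<xi>)"
      using z0 by (intro d_le) simp
    show "cmod (?f \<xi> z - ?f \<xi> z0) \<le> \<bar>\<xi>\<bar> * cmod (half_weight s \<phi> \<xi>) * cmod (z - z0)" if z: "z \<in> ball z0 (Im z0)" for z
      by (rule field_differentiable_bound[OF convex_ball d d_le z]) (use z0 in auto)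
  qed (use z0 half_weight_integrable in \<open>auto intro: bounded_linear_ident\<close>)
  then have "(half_transform s \<phi> has_field_derivative integral\<^sup>L lborel ?D) (at z0)"
    by (simp only: has_field_derivative_def half_transform_def[abs_def])
  then show ?thesis
    by (auto simp: field_differentiable_def)
qed

text \<open>Carrying out the \<open>\<xi>\<close>-integral first turns the half-line transform into a Riesz integral.\<close>

lemma half_transform_eq_riesz:
  assumes z: "Im z > 0"
  shows "half_transform s \<phi> z = laplace_power (2 * s) 1 * riesz_integral s \<phi> z"
proof -
  let ?G = "\<lambda>\<xi>. indicator {0<..} \<xi> *\<^sub>R (complex_of_real (\<xi> powr (2 * s)) * exp (- (- \<i> * z) * of_real \<xi>))"
  have G: "integrable lborel ?G"
    using z s by (intro powr_exp_integrable) auto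
  have FG: "fourier ?G t = laplace_power (2 * s) 1 * (- \<i> * (z - of_real t)) powr of_real (- (2 * s + 1))" for t
  proof -
    have "fourier ?G t = laplace_power (2 * s) (- \<i> * (z - of_real t))"
      unfolding fourier_def laplace_power_def
    proof (intro Bochner_Integration.integral_cong refl)
      fix \<xi> :: real
      have "exp (- \<i> * complex_of_real (t * \<xi>)) * exp (- (- \<i> * z) * of_real \<xi>) = exp (- (- \<i> * (z - of_real t)) * of_real \<xi>)"
        unfolding mult_exp_exp by (simp add: algebra_simps)
      then show "exp (- \<i> * complex_of_real (t * \<xi>)) * ?G \<xi>
          = indicator {0<..} \<xi> *\<^sub>R (of_real (\<xi> powr (2 * s)) * exp (- (- \<i> * (z - of_real t)) * of_real \<xi>))"
        by (simp only: mult_scaleR_right mult.left_commute[of "exp (- \<i> * complex_of_real (t * \<xi>))"])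
    qed
    also have "\<dots> = laplace_power (2 * s) 1 * (- \<i> * (z - of_real t)) powr of_real (- (2 * s + 1))"
      using z s by (intro laplace_power_eq) auto
    finally show ?thesis .
  qed
  have "half_transform s \<phi> z = (LINT \<xi>|lborel. fourier \<phi> \<xi> * ?G \<xi>)"
    unfolding half_transform_def half_weight_def by (simp add: mult_ac)
  also have "\<dots> = (LINT t|lborel. \<phi> t * fourier ?G t)"
    by (rule fourier_mult_formula[OF integrable G])
  also have "\<dots> = laplace_power (2 * s) 1 * riesz_integral s \<phi> z"
    unfolding FG riesz_integral_def mult.left_commute[of "\<phi> _"] by (rule integral_mult_right_zero)
  finally show ?thesis .
qed

lemma riesz_kernel_norm_le:
  assumes "\<And>t. t \<in> {-1..1} \<Longrightarrow> r \<le> cmod (z - of_real t)" "r > 0"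
  shows "cmod (\<phi> t * (- \<i> * (z - of_real t)) powr of_real (- (2 * s + 1))) \<le> cmod (\<phi> t) * r powr - (2 * s + 1)"
proof (cases "t \<in> {-1..1}")
  case True
  have "cmod ((- \<i> * (z - of_real t)) powr of_real (- (2 * s + 1))) = cmod (z - of_real t) powr - (2 * s + 1)"
    by (subst norm_powr_real_powr') (simp_all add: norm_mult del: of_real_minus of_real_add)
  also have "\<dots> \<le> r powr - (2 * s + 1)"
    using assms True s by (intro powr_mono2') auto
  finally show ?thesis
    unfolding norm_mult[of "\<phi> t"] by (intro mult_left_mono) auto
qed (simp add: supp)

lemma riesz_integral_norm_le:
  assumes "\<And>t. t \<in> {-1..1} \<Longrightarrow> r \<le> cmod (z - of_real t)" "r > 0"
  shows "cmod (riesz_integral s \<phi> z) \<le> (LINT t|lborel. cmod (\<phi> t)) * r powr - (2 * s + 1)"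
proof -
  have "cmod (riesz_integral s \<phi> z) \<le> (LINT t|lborel. cmod (\<phi> t * (- \<i> * (z - of_real t)) powr of_real (- (2 * s + 1))))"
    unfolding riesz_integral_def by (rule integral_norm_bound)
  also have "\<dots> \<le> (LINT t|lborel. cmod (\<phi> t) * r powr - (2 * s + 1))"
    using integrable by (intro integral_mono' riesz_kernel_norm_le assms) auto
  also have "\<dots> = (LINT t|lborel. cmod (\<phi> t)) * r powr - (2 * s + 1)"
    by (rule integral_mult_left_zero)
  finally show ?thesis .
qed

text \<open>
  Off the support of \<open>\<phi>\<close>, the Riesz integral is continuous up to the real axis as well.
\<close>

lemma half_transform_eq_riesz_real:
  assumes x: "\<bar>x\<bar> > 1"
  shows "half_transform s \<phi> (of_real x) = laplace_power (2 * s) 1 * riesz_integral s \<phi> (of_real x)"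
proof -
  define u where "u n = of_real x + \<i> * of_real (null_scale n)" for n
  have Im_u: "Im (u n) > 0" for n
    using null_scale_pos by (simp add: u_def)
  have u: "u \<longlonglongrightarrow> of_real x"
  proof -
    have "(\<lambda>n. of_real x + \<i> * of_real (null_scale n)) \<longlonglongrightarrow> of_real x + \<i> * of_real 0"
      by (intro tendsto_intros null_scale_tendsto)
    then show ?thesis
      by (simp add: u_def[abs_def])
  qed
  have dist: "\<bar>x\<bar> - 1 \<le> cmod (u n - of_real t)" if "t \<in> {-1..1}" for t n
  proof -
    have "\<bar>x\<bar> - 1 \<le> \<bar>Re (u n - of_real t)\<bar>"
      using that x by (auto simp: u_def)
    also have "\<dots> \<le> cmod (u n - of_real t)"
      by (rule abs_Re_le_cmod)
    finally show ?thesis .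
  qed
  have "(\<lambda>n. riesz_integral s \<phi> (u n)) \<longlonglongrightarrow> riesz_integral s \<phi> (of_real x)"
    unfolding riesz_integral_def
  proof (rule integral_dominated_convergence[where w = "\<lambda>t. cmod (\<phi> t) * (\<bar>x\<bar> - 1) powr - (2 * s + 1)"])
    show "integrable lborel (\<lambda>t. cmod (\<phi> t) * (\<bar>x\<bar> - 1) powr - (2 * s + 1))"
      using integrable by simp
    show "AE t in lborel. (\<lambda>n. \<phi> t * (- \<i> * (u n - of_real t)) powr of_real (- (2 * s + 1)))
        \<longlonglongrightarrow> \<phi> t * (- \<i> * (of_real x - of_real t)) powr of_real (- (2 * s + 1))"
    proof (intro AE_I2)
      fix t
      show "(\<lambda>n. \<phi> t * (- \<i> * (u n - of_real t)) powr of_real (- (2 * s + 1)))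
        \<longlonglongrightarrow> \<phi> t * (- \<i> * (of_real x - of_real t)) powr of_real (- (2 * s + 1))"
      proof (cases "t \<in> {-1..1}")
        case True
        then have "x \<noteq> t"
          using x by auto
        then have "- \<i> * (complex_of_real x - of_real t) \<notin> \<real>\<^sub>\<le>\<^sub>0"
          by (auto simp: complex_nonpos_Reals_iff)
        then show ?thesis
          by (intro tendsto_intros u disjI1)
      qed (simp add: supp)
    qed
    show "AE t in lborel. cmod (\<phi> t * (- \<i> * (u n - of_real t)) powr of_real (- (2 * s + 1)))
        \<le> cmod (\<phi> t) * (\<bar>x\<bar> - 1) powr - (2 * s + 1)" for n
      using x by (intro AE_I2 riesz_kernel_norm_le dist) auto
  qed measurable
  then have "(\<lambda>n. laplace_power (2 * s) 1 * riesz_integral s \<phi> (u n)) \<longlonglongrightarrow> laplace_power (2 * s) 1 * riesz_integral s \<phi> (of_real x)"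
    by (intro tendsto_intros)
  moreover have "(\<lambda>n. half_transform s \<phi> (u n)) \<longlonglongrightarrow> half_transform s \<phi> (of_real x)"
    using Im_u by (intro half_transform_tendsto u) (simp add: less_imp_le)
  ultimately show ?thesis
    unfolding half_transform_eq_riesz[OF Im_u] using LIMSEQ_unique by blast
qed

lemma half_transform_norm_le:
  assumes "Im z \<ge> 0" "cmod z \<ge> 2"
  shows "cmod (half_transform s \<phi> z) \<le> cmod (laplace_power (2 * s) 1) * (LINT t|lborel. cmod (\<phi> t)) * (cmod z - 1) powr - (2 * s + 1)"
proof -
  have eq: "half_transform s \<phi> z = laplace_power (2 * s) 1 * riesz_integral s \<phi> z"
  proof (cases "Im z > 0")
    case False
    then have z: "z = of_real (Re z)"
      using assms(1) by (simp add: complex_eq_iff)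
    then have "cmod z = \<bar>Re z\<bar>"
      by (metis norm_of_real)
    then have "\<bar>Re z\<bar> > 1"
      using assms(2) by linarith
    from half_transform_eq_riesz_real[OF this] z show ?thesis
      by simp
  qed (rule half_transform_eq_riesz)
  have "cmod (riesz_integral s \<phi> z) \<le> (LINT t|lborel. cmod (\<phi> t)) * (cmod z - 1) powr - (2 * s + 1)"
  proof (rule riesz_integral_norm_le)
    show "cmod z - 1 \<le> cmod (z - of_real t)" if "t \<in> {-1..1}" for t
    proof -
      have "cmod (complex_of_real t) \<le> 1"
        using that by (simp add: abs_le_iff)
      then show ?thesis
        using norm_triangle_ineq2[of z "of_real t"] by linarith
    qed
  qed (use assms in auto)
  then show ?thesis
    unfolding eq norm_mult mult.assoc by (intro mult_left_mono) auto
qed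

lemma cut_function_continuous_on: "continuous_on {z. Im z \<ge> 0} (cut_function s \<phi>)"
  unfolding cut_function_def[abs_def] using s
  by (intro continuous_intros half_transform_continuous_on) auto

lemma cut_function_field_differentiable:
  assumes "Im z > 0" shows "cut_function s \<phi> field_differentiable at z"
proof -
  have nonpos: "- \<i> * (z - 1) \<notin> \<real>\<^sub>\<le>\<^sub>0" "- \<i> * (z + 1) \<notin> \<real>\<^sub>\<le>\<^sub>0"
    using assms by (auto simp: complex_nonpos_Reals_iff)
  have pw: "(\<lambda>z. (- \<i> * (z + c)) powr of_real s) field_differentiable at z" if "- \<i> * (z + c) \<notin> \<real>\<^sub>\<le>\<^sub>0" for c
    unfolding field_differentiable_def using that by (auto intro!: exI derivative_eq_intros)
  show ?thesis
    unfolding cut_function_def[abs_def]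
    using pw[of "-1"] pw[of 1] nonpos
    by (intro field_differentiable_mult half_transform_field_differentiable assms) auto
qed

text \<open>
  The growth \<open>\<bar>z\<bar>\<^bsup>2s\<^esup>\<close> of the powers is outweighed by the decay \<open>\<bar>z\<bar>\<^bsup>-2s-1\<^esup>\<close> of the Riesz integral.
\<close>

lemma cut_function_bound: "\<exists>B. \<forall>z. Im z \<ge> 0 \<longrightarrow> cmod (cut_function s \<phi> z) * (1 + cmod z) \<le> B"
proof -
  let ?S = "{z. Im z \<ge> 0} \<inter> cball 0 2"
  have "compact ?S"
    by (intro closed_Int_compact closed_halfspace_Im_ge compact_cball)
  moreover have "continuous_on ?S (cut_function s \<phi>)"
    by (rule continuous_on_subset[OF cut_function_continuous_on]) auto
  ultimately have "bounded (cut_function s \<phi> ` ?S)"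
    by (intro compact_imp_bounded compact_continuous_image)
  then obtain B1 where "\<forall>y \<in> cut_function s \<phi> ` ?S. cmod y \<le> B1"
    unfolding bounded_iff by blast
  then have B1: "cmod (cut_function s \<phi> z) \<le> B1" if "z \<in> ?S" for z
    using that by blast
  define M where "M = cmod (laplace_power (2 * s) 1) * (LINT t|lborel. cmod (\<phi> t))"
  have M: "M \<ge> 0"
    unfolding M_def by (intro mult_nonneg_nonneg integral_nonneg_AE) auto
  have B1_nonneg: "B1 \<ge> 0"
    using order_trans[OF norm_ge_zero B1[of 0]] by simp
  have "cmod (cut_function s \<phi> z) * (1 + cmod z) \<le> max (B1 * 3) (27 * M)" if z: "Im z \<ge> 0" for z
  proof (cases "cmod z \<le> 2")
    case True
    then have "cmod (cut_function s \<phi> z) * (1 + cmod z) \<le> B1 * 3"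
      using z B1_nonneg by (intro mult_mono B1) auto
    then show ?thesis
      by simp
  next
    case False
    define r where "r = cmod z - 1"
    have r: "r \<ge> 1" "cmod z + 1 \<le> 3 * r"
      using False by (auto simp: r_def)
    have E: "cmod ((- \<i> * (z + c)) powr of_real s) \<le> (3 * r) powr s" if "cmod c = 1" for c
    proof -
      have "cmod ((- \<i> * (z + c)) powr of_real s) = cmod (z + c) powr s"
        by (subst norm_powr_real_powr') (simp_all add: norm_mult)
      also have "\<dots> \<le> (3 * r) powr s"
        using s r(2) that norm_triangle_ineq[of z c] by (intro powr_mono2) auto
      finally show ?thesis .
    qed
    have "cmod (cut_function s \<phi> z) \<le> (3 * r) powr s * (3 * r) powr s * (M * r powr - (2 * s + 1))"
      unfolding cut_function_def norm_mult
    proof (intro mult_mono)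
      show "cmod ((- \<i> * (z - 1)) powr of_real s) \<le> (3 * r) powr s"
        using E[of "-1"] by simp
      show "cmod ((- \<i> * (z + 1)) powr of_real s) \<le> (3 * r) powr s"
        using E[of 1] by simp
      show "cmod (half_transform s \<phi> z) \<le> M * r powr - (2 * s + 1)"
        using half_transform_norm_le[OF z] False unfolding M_def r_def by simp
    qed auto
    also have "\<dots> = 3 powr (2 * s) * M * (r powr (2 * s) * r powr - (2 * s + 1))"
    proof -
      have "(3 * r) powr s * (3 * r) powr s = (3 * r) powr (2 * s)"
        by (simp flip: powr_add)
      then show ?thesis
        using r by (simp add: powr_mult)
    qed
    also have "r powr (2 * s) * r powr - (2 * s + 1) = 1 / r"
      unfolding powr_add[symmetric] using r by (simp add: powr_minus_divide)
    also have "3 powr (2 * s) * M * (1 / r) \<le> 9 * M * (1 / r)"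
    proof (intro mult_right_mono)
      have "3 powr (2 * s) \<le> 3 powr (2::real)"
        using s by (intro powr_mono) auto
      then show "3 powr (2 * s) \<le> 9"
        by simp
    qed (use M r in auto)
    finally have "cmod (cut_function s \<phi> z) * (1 + cmod z) \<le> 9 * M * (1 / r) * (3 * r)"
      using r M by (intro mult_mono) auto
    also have "\<dots> = 27 * M"
      using r by simp
    finally show ?thesis
      by simp
  qed
  then show ?thesis
    by blast
qed

lemma cut_function_Cauchy:
  assumes w: "Im w < 0"
  shows "integrable lborel (\<lambda>x. cut_function s \<phi> (of_real x) / (of_real x - w))"
    and "(LINT x|lborel. cut_function s \<phi> (of_real x) / (of_real x - w)) = 0"
proof -
  obtain B where B: "\<And>z. Im z \<ge> 0 \<Longrightarrow> cmod (cut_function s \<phi> z) * (1 + cmod z) \<le> B"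
    using cut_function_bound by blast
  define c where "c = (1 + cmod w) / (- Im w) + 1"
  have c: "c > 0"
    unfolding c_def using w by (intro add_nonneg_pos divide_nonneg_pos) auto
  have ne: "z - w \<noteq> 0" if "Im z \<ge> 0" for z
    using that w by auto
  let ?F = "\<lambda>z. cut_function s \<phi> z / (z - w)"
  have cont: "continuous_on {z. Im z \<ge> 0} ?F"
    using ne by (intro continuous_intros cut_function_continuous_on) auto
  have diff: "?F field_differentiable at z" if "Im z > 0" for z
    using that ne[of z] by (intro field_differentiable_divide cut_function_field_differentiable derivative_intros) auto
  have bound: "cmod (?F z) \<le> (B * c) / (1 + (cmod z)\<^sup>2)" if z: "Im z \<ge> 0" for z
  proof -
    have B0: "B \<ge> 0"
      using order_trans[OF _ B[OF z]] by simp
    have zw: "cmod (z - w) > 0"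
      using ne[OF z] by simp
    have "1 + cmod z \<le> (1 + cmod w) + cmod (z - w)"
      using norm_triangle_ineq[of w "z - w"] by simp
    also have "1 + cmod w \<le> (1 + cmod w) / (- Im w) * cmod (z - w)"
    proof -
      have "- Im w \<le> cmod (z - w)"
        using abs_Im_le_cmod[of "z - w"] z w by simp
      then have "(1 + cmod w) / (- Im w) * (- Im w) \<le> (1 + cmod w) / (- Im w) * cmod (z - w)"
        using w by (intro mult_left_mono divide_nonneg_pos) auto
      then show ?thesis
        using w by simp
    qed
    finally have zc: "1 + cmod z \<le> c * cmod (z - w)"
      by (simp add: c_def algebra_simps)
    have "cmod (?F z) * (1 + (cmod z)\<^sup>2) \<le> cmod (?F z) * ((1 + cmod z) * (1 + cmod z))"
      by (intro mult_left_mono) (auto simp: power2_eq_square algebra_simps)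
    also have "\<dots> \<le> cmod (?F z) * ((1 + cmod z) * (c * cmod (z - w)))"
      using zc by (intro mult_left_mono) auto
    also have "\<dots> = cmod (cut_function s \<phi> z) * (1 + cmod z) * c"
      using zw by (simp add: norm_divide)
    also have "\<dots> \<le> B * c"
      using c by (intro mult_right_mono B z) auto
    finally show ?thesis
      using zero_le_power2[of "cmod z"] by (subst pos_le_divide_eq) linarith+
  qed
  show "integrable lborel (\<lambda>x. cut_function s \<phi> (of_real x) / (of_real x - w))"
    by (rule Cauchy_upper_half_plane(1)[OF cont diff bound])
  show "(LINT x|lborel. cut_function s \<phi> (of_real x) / (of_real x - w)) = 0"
    by (rule Cauchy_upper_half_plane(2)[OF cont diff bound])
qed

end

section \<open>The Poisson identity\<close>

text \<open>
  On the real line, this is \<open>2 \<pi> (-\<Delta>)\<^sup>s \<phi>\<close>, split into positive and negative frequencies.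
\<close>

definition two_sided_transform :: "real \<Rightarrow> (real \<Rightarrow> complex) \<Rightarrow> real \<Rightarrow> complex" where
  "two_sided_transform s \<phi> x
    = half_transform s \<phi> (of_real x) + half_transform s (\<lambda>t. \<phi> (- t)) (of_real (- x))"

definition real_riesz_integral :: "real \<Rightarrow> (real \<Rightarrow> complex) \<Rightarrow> real \<Rightarrow> complex" where
  "real_riesz_integral s \<phi> x = (LINT t|lborel. \<phi> t * of_real (\<bar>x - t\<bar> powr - (2 * s + 1)))"

lemma real_riesz_integral_reflect: "real_riesz_integral s (\<lambda>t. \<phi> (- t)) (- x) = real_riesz_integral s \<phi> x"
proof -
  have "\<bar>- x - t\<bar> = \<bar>x - - t\<bar>" for t
    by simp
  then have "real_riesz_integral s (\<lambda>t. \<phi> (- t)) (- x) = (LINT t|lborel. \<phi> (- t) * of_real (\<bar>x - - t\<bar> powr - (2 * s + 1)))"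
    by (simp only: real_riesz_integral_def)
  also have "\<dots> = real_riesz_integral s \<phi> x"
    unfolding real_riesz_integral_def
    by (subst (2) lborel_integral_real_affine[where c = "-1" and t = 0]) auto
  finally show ?thesis .
qed

context rapid_transform
begin

lemma reflected: "rapid_transform s (\<lambda>t. \<phi> (- t)) C"
proof
  show "Bochner_Integration.integrable lborel (\<lambda>t. \<phi> (- t))"
    using lborel_integrable_real_affine[OF integrable, of "-1" 0] by simp
  show "\<phi> (- x) = 0" if "x \<notin> {-1..1}" for x
    using that by (intro supp) auto
  show "(1 + \<xi>\<^sup>2) ^ 3 * cmod (fourier (\<lambda>t. \<phi> (- t)) \<xi>) \<le> C" for \<xi>
    using decay[of "- \<xi>"] by (simp add: fourier_reflect)
qed (use s in auto)

lemma riesz_integral_real: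
  assumes x: "\<bar>x\<bar> > 1"
  shows "riesz_integral s \<phi> (of_real x)
    = exp (\<i> * of_real (sgn x * (pi * (s + 1/2)))) * real_riesz_integral s \<phi> x"
  unfolding riesz_integral_def real_riesz_integral_def integral_mult_right_zero[symmetric]
proof (intro Bochner_Integration.integral_cong refl)
  fix t
  show "\<phi> t * (- \<i> * (of_real x - of_real t)) powr of_real (- (2 * s + 1))
      = exp (\<i> * of_real (sgn x * (pi * (s + 1/2)))) * (\<phi> t * of_real (\<bar>x - t\<bar> powr - (2 * s + 1)))"
  proof (cases "t \<in> {-1..1}")
    case True
    then have r: "x - t \<noteq> 0" "sgn (x - t) = sgn x"
      using x by (auto simp: sgn_if)
    have "- \<i> * complex_of_real (sgn x * (pi * - (2 * s + 1) / 2)) = \<i> * of_real (sgn x * (pi * (s + 1/2)))"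
      by (simp add: field_simps)
    then show ?thesis
      using powr_imaginary_axis[OF r(1), of "- (2 * s + 1)"] by (simp only: r(2) of_real_diff mult_ac)
  qed (simp add: supp)
qed

lemma cut_function_inside:
  assumes x: "\<bar>x\<bar> < 1"
  shows "cut_function s \<phi> (of_real x) = of_real ((1 - x\<^sup>2) powr s) * half_transform s \<phi> (of_real x)"
proof -
  have r: "x - 1 \<noteq> 0" "x + 1 \<noteq> 0" "sgn (x - 1) = - 1" "sgn (x + 1) = 1"
    using x by (auto simp: sgn_if)
  have p: "(1 - x\<^sup>2) powr s = \<bar>x - 1\<bar> powr s * \<bar>x + 1\<bar> powr s"
  proof -
    have "\<bar>x - 1\<bar> = 1 - x" "\<bar>x + 1\<bar> = 1 + x"
      using x by auto
    then have "1 - x\<^sup>2 = \<bar>x - 1\<bar> * \<bar>x + 1\<bar>"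
      by (simp add: power2_eq_square algebra_simps)
    then show ?thesis
      by (simp only: powr_mult abs_ge_zero)
  qed
  have e: "exp (- \<i> * of_real (- 1 * (pi * s / 2))) * exp (- \<i> * of_real (1 * (pi * s / 2))) = 1"
    unfolding mult_exp_exp by simp
  have "cut_function s \<phi> (of_real x) = of_real (\<bar>x - 1\<bar> powr s * \<bar>x + 1\<bar> powr s)
      * (exp (- \<i> * of_real (- 1 * (pi * s / 2))) * exp (- \<i> * of_real (1 * (pi * s / 2)))) * half_transform s \<phi> (of_real x)"
    using powr_imaginary_axis[OF r(1), of s] powr_imaginary_axis[OF r(2), of s]
    by (simp only: cut_function_def r of_real_diff of_real_add of_real_1 of_real_mult mult_ac)
  then show ?thesis
    by (simp only: e p mult_1_right)
qed

text \<open>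
  Each power contributes the phase \<open>- sgn x * \<pi> s / 2\<close> and the Riesz integral \<open>sgn x * \<pi> (s + 1/2)\<close>. The sum
  \<open>sgn x * \<pi> / 2\<close> is odd in \<open>x\<close>, so that the cut function of the reflected \<open>\<phi>\<close> at \<open>-x\<close> is the negative.
\<close>

lemma cut_function_outside:
  assumes x: "\<bar>x\<bar> > 1"
  shows "cut_function s \<phi> (of_real x)
    = \<i> * of_real (sgn x * (x\<^sup>2 - 1) powr s) * laplace_power (2 * s) 1 * real_riesz_integral s \<phi> x"
proof -
  have r: "x - 1 \<noteq> 0" "x + 1 \<noteq> 0" "sgn (x - 1) = sgn x" "sgn (x + 1) = sgn x"
    using x by (auto simp: sgn_if)
  have p: "(x\<^sup>2 - 1) powr s = \<bar>x - 1\<bar> powr s * \<bar>x + 1\<bar> powr s"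
  proof -
    have "1\<^sup>2 < \<bar>x\<bar>\<^sup>2"
      using x by (intro power_strict_mono) auto
    then have "x\<^sup>2 - 1 = \<bar>(x - 1) * (x + 1)\<bar>"
      by (simp add: power2_eq_square algebra_simps)
    then show ?thesis
      by (simp only: powr_mult abs_mult abs_ge_zero)
  qed
  let ?e = "exp (- \<i> * of_real (sgn x * (pi * s / 2)))"
  have e: "?e * ?e * exp (\<i> * of_real (sgn x * (pi * (s + 1/2)))) = \<i> * of_real (sgn x)"
  proof -
    have "- \<i> * complex_of_real (sgn x * (pi * s / 2)) + - \<i> * of_real (sgn x * (pi * s / 2))
        + \<i> * of_real (sgn x * (pi * (s + 1/2))) = \<i> * of_real (sgn x * (pi / 2))"
      by (simp add: field_simps)
    then show ?thesis
      unfolding mult_exp_exp using x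
      by (auto simp: sgn_if cis_conv_exp[symmetric] exp_minus simp flip: of_real_divide)
  qed
  have "cut_function s \<phi> (of_real x) = of_real (\<bar>x - 1\<bar> powr s * \<bar>x + 1\<bar> powr s)
      * (?e * ?e * exp (\<i> * of_real (sgn x * (pi * (s + 1/2))))) * laplace_power (2 * s) 1 * real_riesz_integral s \<phi> x"
    using powr_imaginary_axis[OF r(1), of s] powr_imaginary_axis[OF r(2), of s]
    by (simp only: cut_function_def half_transform_eq_riesz_real[OF x] riesz_integral_real[OF x]
        r of_real_diff of_real_add of_real_1 of_real_mult mult_ac)
  then show ?thesis
    unfolding e p by (simp only: of_real_mult mult_ac)
qed

lemma cut_function_endpoint:
  assumes "\<bar>x\<bar> = 1" shows "cut_function s \<phi> (of_real x) = 0"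
proof -
  have "x = 1 \<or> x = - 1"
    using assms by linarith
  then show ?thesis
    by (auto simp: cut_function_def)
qed

lemma half_transform_real_norm_le:
  "cmod (half_transform s \<phi> (of_real x)) \<le> (LINT \<xi>|lborel. cmod (half_weight s \<phi> \<xi>))"
proof -
  have "cmod (half_transform s \<phi> (of_real x)) \<le> (LINT \<xi>|lborel. cmod (half_weight s \<phi> \<xi> * exp (\<i> * of_real x * of_real \<xi>)))"
    unfolding half_transform_def by (rule integral_norm_bound)
  also have "\<dots> \<le> (LINT \<xi>|lborel. cmod (half_weight s \<phi> \<xi>))"
    by (intro integral_mono' half_kernel_norm_le integrable_norm half_weight_integrable) auto
  finally show ?thesis .
qed

lemma cut_function_real_continuous: "continuous_on UNIV (\<lambda>x. cut_function s \<phi> (of_real x))"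
  by (intro continuous_on_compose2[OF cut_function_continuous_on] continuous_intros) auto

lemma half_transform_real_continuous: "continuous_on UNIV (\<lambda>x. half_transform s \<phi> (of_real x))"
  by (intro continuous_on_compose2[OF half_transform_continuous_on] continuous_intros) auto

lemma two_sided_transform_bounded: "\<exists>B. \<forall>x. cmod (two_sided_transform s \<phi> x) \<le> B"
proof -
  interpret R: rapid_transform s "\<lambda>t. \<phi> (- t)" C
    by (rule reflected)
  show ?thesis
    unfolding two_sided_transform_def
    using norm_triangle_le[OF add_mono[OF half_transform_real_norm_le R.half_transform_real_norm_le]] by blast
qed

lemma two_sided_transform_measurable: "two_sided_transform s \<phi> \<in> borel_measurable borel"
proof -
  interpret R: rapid_transform s "\<lambda>t. \<phi> (- t)" C
    by (rule reflected)
  have "continuous_on UNIV (two_sided_transform s \<phi>)"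
    unfolding two_sided_transform_def[abs_def]
    by (intro continuous_on_add half_transform_real_continuous
        continuous_on_compose2[OF R.half_transform_real_continuous, of UNIV "\<lambda>x. - x"] continuous_intros) auto
  then show ?thesis
    by (rule borel_measurable_continuous_onI)
qed

text \<open>
  On \<open>\<bar>x\<bar> > 1\<close> the boundary values of the cut function from above and below cancel, so that
  Cauchy's theorem in the two half planes, added up, only sees the interval \<open>(-1, 1)\<close> and the
  singularity at \<open>y\<close>. The latter appears as a Poisson kernel when \<open>y\<close> is approached from
  both sides.
\<close>

theorem two_sided_transform_poisson:
  assumes y: "y > 1"
  shows "of_real (sin (pi * s) / pi) * (LINT x|lborel. two_sided_transform s \<phi> x * of_real (ball_kernel s y x))
    = - of_real ((y\<^sup>2 - 1) powr s) * two_sided_transform s \<phi> y"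
proof -
  interpret R: rapid_transform s "\<lambda>t. \<phi> (- t)" C
    by (rule reflected)
  define K where "K x = cut_function s \<phi> (of_real x)" for x :: real
  define K' where "K' x = cut_function s (\<lambda>t. \<phi> (- t)) (of_real (- x))" for x :: real
  define S where "S x = K x + K' x" for x
  define D where "D x = K x - K' x" for x
  let ?L = "laplace_power (2 * s) 1" and ?G = "real_riesz_integral s \<phi> y" and ?Y = "(y\<^sup>2 - 1) powr s"
  have cont_K: "continuous_on UNIV K"
    unfolding K_def[abs_def] by (rule cut_function_real_continuous)
  have cont_K': "continuous_on UNIV K'"
    unfolding K'_def[abs_def]
    by (intro continuous_on_compose2[OF R.cut_function_real_continuous, of UNIV "\<lambda>x. - x"] continuous_intros) auto
  have [measurable]: "K \<in> borel_measurable borel" "K' \<in> borel_measurable borel"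
    using cont_K cont_K' borel_measurable_continuous_onI by auto
  obtain B where B: "\<And>z. Im z \<ge> 0 \<Longrightarrow> cmod (cut_function s \<phi> z) * (1 + cmod z) \<le> B"
    using cut_function_bound by blast
  obtain B' where B': "\<And>z. Im z \<ge> 0 \<Longrightarrow> cmod (cut_function s (\<lambda>t. \<phi> (- t)) z) * (1 + cmod z) \<le> B'"
    using R.cut_function_bound by blast
  have bound: "cmod (K x) \<le> B" "cmod (K' x) \<le> B'" for x
  proof -
    have le: "a \<le> b" if "a * (1 + c) \<le> b" "0 \<le> a" "0 \<le> c" for a b c :: real
      using that(1) mult_nonneg_nonneg[OF that(2,3)] by (simp add: distrib_left)
    show "cmod (K x) \<le> B"
      unfolding K_def by (rule le[OF B]) auto
    show "cmod (K' x) \<le> B'"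
      unfolding K'_def by (rule le[OF B']) auto
  qed
  have S_inside: "S x = of_real ((1 - x\<^sup>2) powr s) * two_sided_transform s \<phi> x" if "\<bar>x\<bar> < 1" for x
    using cut_function_inside[OF that] R.cut_function_inside[of "- x"] that
    by (simp add: S_def K_def K'_def two_sided_transform_def distrib_left)
  have K'_outside: "K' x = - K x" if "\<bar>x\<bar> > 1" for x
    using cut_function_outside[OF that] R.cut_function_outside[of "- x"] that
    by (simp add: K_def K'_def real_riesz_integral_reflect sgn_minus)
  have S_outside: "S x = 0" if "\<not> \<bar>x\<bar> < 1" for x
  proof (cases "\<bar>x\<bar> = 1")
    case True
    then show ?thesis
      using cut_function_endpoint[of x] R.cut_function_endpoint[of "- x"] by (simp add: S_def K_def K'_def)
  qed (use that in \<open>simp add: S_def K'_outside\<close>)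
  let ?q = "\<lambda>n x. (x - y)\<^sup>2 + (null_scale n)\<^sup>2"
  let ?a = "\<lambda>n x. (x - y) / ?q n x"
  have q_pos: "?q n x > 0" for n x
    using null_scale_pos[of n] by (intro add_nonneg_pos) auto
  have a_le: "\<bar>?a n x\<bar> \<le> 1 / (y - 1)" if "\<bar>x\<bar> < 1" for n x
  proof -
    have xy: "y - x \<ge> y - 1"
      using that by auto
    have "\<bar>?a n x\<bar> \<le> \<bar>x - y\<bar> / (x - y)\<^sup>2"
      unfolding abs_divide using xy y q_pos[where n = n and x = x] by (intro divide_left_mono mult_pos_pos) auto
    also have "\<dots> = 1 / (y - x)"
      using xy y by (simp add: power2_eq_square divide_simps abs_if) (simp add: algebra_simps)
    also have "\<dots> \<le> 1 / (y - 1)"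
      using xy y by (intro divide_left_mono mult_pos_pos) auto
    finally show ?thesis .
  qed
  have Sa_le: "cmod (S x * of_real (?a n x)) \<le> cmod (of_real ((B + B') / (y - 1)) * indicator {-1..1} x)" for n x
  proof (cases "\<bar>x\<bar> < 1")
    case True
    have "cmod (S x) \<le> B + B'"
      unfolding S_def by (intro norm_triangle_le add_mono bound)
    then have "cmod (S x) * \<bar>?a n x\<bar> \<le> (B + B') * (1 / (y - 1))"
      using order_trans[OF norm_ge_zero bound(1)] order_trans[OF norm_ge_zero bound(2)] a_le[OF True]
      by (intro mult_mono) auto
    also have "\<dots> \<le> cmod (complex_of_real ((B + B') / (y - 1)))"
      by (simp only: norm_of_real times_divide_eq_right mult_1_right abs_ge_self)
    finally show ?thesis
      using True by (simp only: norm_mult norm_of_real) (auto simp: abs_less_iff)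
  qed (simp add: S_outside)
  have ind_int: "integrable lborel (\<lambda>x::real. of_real ((B + B') / (y - 1)) * indicator {-1..1} x :: complex)"
    by (intro integrable_mult_right indicator_interval_L1_L2)
  have Sa_int: "integrable lborel (\<lambda>x. S x * of_real (?a n x))" for n
    by (rule Bochner_Integration.integrable_bound[OF ind_int])
      (unfold S_def, measurable, fold S_def, intro AE_I2 Sa_le)
  have D_int: "integrable lborel (\<lambda>x. of_real (poisson_kernel (null_scale n) (x - y)) * D x)" for n
  proof (rule Bochner_Integration.integrable_bound)
    show "integrable lborel (\<lambda>x. poisson_kernel (null_scale n) (x - y) * (B + B'))"
      using poisson_kernel_integral[OF null_scale_pos] by (intro integrable_mult_left) (simp add: has_bochner_integral_iff)
    show "AE x in lborel. cmod (of_real (poisson_kernel (null_scale n) (x - y)) * D x) \<le> norm (poisson_kernel (null_scale n) (x - y) * (B + B'))"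
    proof (intro AE_I2)
      fix x
      have "cmod (D x) \<le> B + B'"
        unfolding D_def by (intro order_trans[OF norm_triangle_ineq4] add_mono bound)
      then show "cmod (of_real (poisson_kernel (null_scale n) (x - y)) * D x) \<le> norm (poisson_kernel (null_scale n) (x - y) * (B + B'))"
        unfolding norm_mult norm_of_real real_norm_def abs_mult by (intro mult_left_mono) auto
    qed
  qed (unfold D_def, measurable)
  have eq: "(LINT x|lborel. S x * of_real (?a n x))
      = \<i> * (LINT x|lborel. of_real (poisson_kernel (null_scale n) (x - y)) * D x)" for n
  proof -
    \<comment> \<open>Both poles lie below the axis; reflecting the second integral puts its pole at \<open>y\<close> shifted upwards.\<close>
    let ?w = "of_real y - \<i> * of_real (null_scale n)"
    let ?w' = "of_real (- y) - \<i> * of_real (null_scale n)"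
    have w: "Im ?w < 0" "Im ?w' < 0"
      using null_scale_pos by auto
    let ?k = "\<lambda>x. K x / (of_real x - ?w)"
    let ?k' = "\<lambda>x. K' x / (of_real (- x) - ?w')"
    have k: "integrable lborel ?k" "(LINT x|lborel. ?k x) = 0"
      using cut_function_Cauchy[OF w(1)] by (simp_all add: K_def)
    have k': "integrable lborel ?k'" "(LINT x|lborel. ?k' x) = 0"
      using lborel_integrable_real_affine[OF R.cut_function_Cauchy(1)[OF w(2)], of "-1" 0]
        lborel_integral_real_affine[of "-1" "\<lambda>x. cut_function s (\<lambda>t. \<phi> (- t)) (of_real x) / (of_real x - ?w')" 0]
        R.cut_function_Cauchy(2)[OF w(2)]
      by (simp_all add: K'_def)
    have pointwise: "S x * of_real (?a n x) - \<i> * (of_real (poisson_kernel (null_scale n) (x - y)) * D x) = ?k x - ?k' x" for x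
    proof -
      define u where "u = x - y"
      define d where "d = null_scale n"
      have d: "d > 0"
        by (simp add: d_def null_scale_pos)
      have ne: "complex_of_real u + \<i> * of_real d \<noteq> 0" "complex_of_real u - \<i> * of_real d \<noteq> 0"
        using d by (auto simp: complex_eq_iff)
      have q: "complex_of_real (u\<^sup>2 + d\<^sup>2) = (of_real u + \<i> * of_real d) * (of_real u - \<i> * of_real d)"
        by (simp add: algebra_simps power2_eq_square)
      have e1: "of_real x - ?w = of_real u + \<i> * of_real d"
        by (simp add: u_def d_def)
      have e2: "of_real (- x) - ?w' = - (of_real u - \<i> * of_real d)"
        by (simp add: u_def d_def)
      have r1: "1 / (complex_of_real u + \<i> * of_real d) = (of_real u - \<i> * of_real d) / of_real (u\<^sup>2 + d\<^sup>2)"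
        unfolding q using ne by simp
      have r2: "1 / (complex_of_real u - \<i> * of_real d) = (of_real u + \<i> * of_real d) / of_real (u\<^sup>2 + d\<^sup>2)"
        unfolding q using ne by simp
      have "?k x - ?k' x = K x * (1 / (of_real u + \<i> * of_real d)) + K' x * (1 / (of_real u - \<i> * of_real d))"
        unfolding e1 e2 by (simp only: minus_divide_right[symmetric] diff_minus_eq_add times_divide_eq_right mult_1_right)
      also have "\<dots> = S x * (of_real u / of_real (u\<^sup>2 + d\<^sup>2)) - \<i> * (of_real d / of_real (u\<^sup>2 + d\<^sup>2) * D x)"
        unfolding r1 r2 S_def D_def by (simp add: algebra_simps add_divide_distrib diff_divide_distrib)
      finally show ?thesis
        by (simp add: u_def d_def poisson_kernel_def)
    qed
    have "(LINT x|lborel. S x * of_real (?a n x)) - \<i> * (LINT x|lborel. of_real (poisson_kernel (null_scale n) (x - y)) * D x)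
        = (LINT x|lborel. S x * of_real (?a n x) - \<i> * (of_real (poisson_kernel (null_scale n) (x - y)) * D x))"
      using Sa_int D_int by (subst Bochner_Integration.integral_diff) auto
    also have "\<dots> = (LINT x|lborel. ?k x - ?k' x)"
      unfolding pointwise ..
    also have "\<dots> = 0"
      using k k' by (subst Bochner_Integration.integral_diff) auto
    finally show ?thesis
      by simp
  qed
  have lim1: "(\<lambda>n. LINT x|lborel. S x * of_real (?a n x)) \<longlonglongrightarrow> (LINT x|lborel. S x * of_real (1 / (x - y)))"
  proof (rule integral_dominated_convergence[where w = "\<lambda>x. cmod (of_real ((B + B') / (y - 1)) * indicator {-1..1} x)"])
    show "AE x in lborel. (\<lambda>n. S x * of_real (?a n x)) \<longlonglongrightarrow> S x * of_real (1 / (x - y))"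
    proof (intro AE_I2)
      fix x
      show "(\<lambda>n. S x * of_real (?a n x)) \<longlonglongrightarrow> S x * of_real (1 / (x - y))"
      proof (cases "\<bar>x\<bar> < 1")
        case True
        then have "x \<noteq> y"
          using y by auto
        then have "(\<lambda>n. S x * of_real (?a n x)) \<longlonglongrightarrow> S x * of_real ((x - y) / ((x - y)\<^sup>2 + 0\<^sup>2))"
          by (intro tendsto_intros null_scale_tendsto) auto
        then show ?thesis
          using \<open>x \<noteq> y\<close> by (simp add: power2_eq_square)
      qed (simp add: S_outside)
    qed
    show "AE x in lborel. cmod (S x * of_real (?a n x)) \<le> cmod (of_real ((B + B') / (y - 1)) * indicator {-1..1} x)" for n
      by (intro AE_I2 Sa_le)
    show "integrable lborel (\<lambda>x::real. cmod (of_real ((B + B') / (y - 1)) * indicator {-1..1} x))"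
      by (intro integrable_norm ind_int)
  qed (unfold S_def, measurable)
  have lim2: "(\<lambda>n. LINT x|lborel. of_real (poisson_kernel (null_scale n) (x - y)) * D x) \<longlonglongrightarrow> of_real pi * D y"
  proof (rule poisson_kernel_approx_identity[where B = "B + B'"])
    show "cmod (D x) \<le> B + B'" for x
      unfolding D_def by (intro order_trans[OF norm_triangle_ineq4] add_mono bound)
    have "continuous_on UNIV D"
      unfolding D_def[abs_def] by (intro continuous_on_diff cont_K cont_K')
    then show "isCont D y"
      by (simp add: continuous_on_eq_continuous_at)
  qed (unfold D_def, measurable, auto intro: null_scale_pos null_scale_tendsto)
  have "(LINT x|lborel. S x * of_real (1 / (x - y))) = \<i> * (of_real pi * D y)"
    using lim1 tendsto_mult[OF tendsto_const lim2, of \<i>] unfolding eq by (rule LIMSEQ_unique)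
  moreover have "S x * of_real (1 / (x - y)) = - (two_sided_transform s \<phi> x * of_real (ball_kernel s y x))" for x
  proof (cases "\<bar>x\<bar> < 1")
    case True
    then have "1 / (x - y) = - (1 / (y - x))"
      using y by (simp add: divide_simps)
    then show ?thesis
      using True by (simp add: S_inside ball_kernel_def mult_ac)
  qed (simp add: S_outside ball_kernel_def)
  ultimately have main: "- (LINT x|lborel. two_sided_transform s \<phi> x * of_real (ball_kernel s y x)) = \<i> * (of_real pi * D y)"
    by simp
  have "D y = 2 * K y"
    using K'_outside[of y] y by (simp add: D_def)
  then have Dy: "D y = 2 * (\<i> * of_real ?Y * ?L * ?G)"
    using cut_function_outside[of y] y by (simp add: K_def)
  have "two_sided_transform s \<phi> y
      = (exp (\<i> * of_real (pi * (s + 1/2))) + exp (- \<i> * of_real (pi * (s + 1/2)))) * (?L * ?G)"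
    using half_transform_eq_riesz_real[of y] R.half_transform_eq_riesz_real[of "- y"]
      riesz_integral_real[of y] R.riesz_integral_real[of "- y"] y
    by (simp add: two_sided_transform_def real_riesz_integral_reflect algebra_simps)
  also have "exp (\<i> * of_real (pi * (s + 1/2))) + exp (- \<i> * of_real (pi * (s + 1/2))) = 2 * cos (of_real (pi * (s + 1/2)))"
    by (simp add: cos_exp_eq)
  also have "cos (complex_of_real (pi * (s + 1/2))) = of_real (cos (pi * (s + 1/2)))"
    by (rule cos_of_real)
  also have "cos (pi * (s + 1/2)) = - sin (pi * s)"
    using cos_add[of "pi * s" "pi / 2"] by (simp add: distrib_left)
  finally have psi: "two_sided_transform s \<phi> y = - 2 * of_real (sin (pi * s)) * (?L * ?G)"
    by simp
  have "(LINT x|lborel. two_sided_transform s \<phi> x * of_real (ball_kernel s y x)) = - (\<i> * (of_real pi * D y))"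
    using main by (simp only: minus_equation_iff[of "LINT x|lborel. _ x"] neg_equal_iff_equal)
  also have "\<dots> = 2 * of_real pi * of_real ?Y * (?L * ?G)"
    unfolding Dy by (simp add: mult_ac)
  finally show ?thesis
    unfolding psi by simp
qed

text \<open>
  The transform of \<open>f\<close> is moved to the factor \<open>\<bar>\<xi>\<bar>\<^bsup>2s\<^esup> \<phi>\<^sup>^(-\<xi>)\<close>, which is integrable.
\<close>

lemma frac_laplacian_eq_integral:
  assumes f: "f \<in> L2 UNIV" and f_supp: "\<And>x. x \<notin> {- real N..real N} \<Longrightarrow> f x = 0"
  shows "frac_laplacian s f \<phi> = (LINT x|lborel. f x * two_sided_transform s \<phi> x) / of_real (2 * pi)"
proof -
  interpret R: rapid_transform s "\<lambda>t. \<phi> (- t)" C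
    by (rule reflected)
  have f_int: "integrable lborel f"
    using L2_compact_support_integrable[OF f] f_supp by blast
  have [measurable]: "fourier f \<in> borel_measurable borel" "fourier_L2 f \<in> borel_measurable borel"
    using fourier_measurable[OF f_int] fourier_L2_in_L2[OF f] by auto
  let ?W = "\<lambda>\<xi>. complex_of_real (\<bar>\<xi>\<bar> powr (2 * s)) * fourier \<phi> (- \<xi>)"
  have W: "?W \<xi> = half_weight s (\<lambda>t. \<phi> (- t)) \<xi> + half_weight s \<phi> (- \<xi>)" for \<xi>
    by (cases "\<xi> > 0"; cases "\<xi> = 0") (auto simp: half_weight_def fourier_reflect)
  have refl_int: "integrable lborel (\<lambda>\<xi>. half_weight s \<phi> (- \<xi>))"
    using lborel_integrable_real_affine[OF half_weight_integrable(1), of "-1" 0] by simp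
  have W_int: "integrable lborel ?W"
    unfolding W by (intro Bochner_Integration.integrable_add R.half_weight_integrable refl_int)
  have FW: "fourier ?W x = two_sided_transform s \<phi> x" for x
  proof -
    have "fourier ?W x = (LINT \<xi>|lborel. exp (- \<i> * of_real (x * \<xi>)) * half_weight s (\<lambda>t. \<phi> (- t)) \<xi>)
        + (LINT \<xi>|lborel. exp (- \<i> * of_real (x * \<xi>)) * half_weight s \<phi> (- \<xi>))"
      unfolding W unfolding fourier_def distrib_left
      by (intro Bochner_Integration.integral_add fourier_kernel_integrable R.half_weight_integrable refl_int)
    also have "(LINT \<xi>|lborel. exp (- \<i> * of_real (x * \<xi>)) * half_weight s \<phi> (- \<xi>)) = half_transform s \<phi> (of_real x)"
      unfolding half_transform_def
      by (subst lborel_integral_real_affine[where c = "-1" and t = 0]) (auto simp: mult_ac)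
    also have "(LINT \<xi>|lborel. exp (- \<i> * of_real (x * \<xi>)) * half_weight s (\<lambda>t. \<phi> (- t)) \<xi>) = half_transform s (\<lambda>t. \<phi> (- t)) (of_real (- x))"
      unfolding half_transform_def by (simp add: mult_ac)
    finally show ?thesis
      by (simp add: two_sided_transform_def)
  qed
  have [measurable]: "?W \<in> borel_measurable borel"
    using W_int by auto
  have "(LINT \<xi>|lborel. complex_of_real (\<bar>\<xi>\<bar> powr (2 * s)) * fourier_L2 f \<xi> * fourier \<phi> (- \<xi>))
      = (LINT \<xi>|lborel. fourier_L2 f \<xi> * ?W \<xi>)"
    by (simp only: mult_ac)
  also have "\<dots> = (LINT \<xi>|lborel. fourier f \<xi> * ?W \<xi>)"
    using fourier_L2_eq_fourier[OF f, of N, OF f_supp] by (intro integral_cong_AE) auto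
  also have "\<dots> = (LINT x|lborel. f x * fourier ?W x)"
    by (rule fourier_mult_formula[OF f_int W_int])
  finally show ?thesis
    unfolding FW frac_laplacian_def by simp
qed

end

lemma test_function_rapid_transform:
  assumes "0 < s" "s < 1" "\<phi> \<in> test_functions {-1<..<1}"
  obtains C where "rapid_transform s \<phi> C"
proof -
  obtain C where "\<And>\<xi>. (1 + \<xi>\<^sup>2) ^ 3 * cmod (fourier \<phi> \<xi>) \<le> C"
    using test_function_fourier_decay[OF assms(3), of 3] by blast
  moreover have "\<phi> x = 0" if "x \<notin> {-1..1}" for x
    using that by (intro test_function_eq_0[OF assms(3)]) auto
  ultimately have "rapid_transform s \<phi> C"
    using assms test_function_L1_L2(1)[OF assms(3)] by unfold_locales auto
  then show ?thesis
    by (rule that)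
qed

section \<open>The solution operator\<close>

text \<open>
  A truncation at \<open>\<epsilon> < 1\<close> removes nothing, because \<open>[2, 3]\<close> has distance \<open>1\<close> from \<open>[-1, 1]\<close>.
\<close>

lemma hilbert_trunc_eq_integral:
  assumes x: "x \<in> {-1..1}"
  shows "hilbert_trunc f x = (LINT y|lborel. zero_ext {2..3} f y / of_real (x - y))"
proof -
  have "((\<lambda>\<epsilon>. LINT y:{y. \<bar>x - y\<bar> > \<epsilon>}|lborel. zero_ext {2..3} f y / of_real (x - y))
      \<longlongrightarrow> (LINT y|lborel. zero_ext {2..3} f y / of_real (x - y))) (at_right 0)"
  proof (rule tendsto_eventually)
    have "\<forall>\<^sub>F \<epsilon> in at_right 0. \<epsilon> < (1::real)"
      by (rule order_tendstoD(2)[OF tendsto_ident_at]) simp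
    then show "\<forall>\<^sub>F \<epsilon> in at_right 0. (LINT y:{y. \<bar>x - y\<bar> > \<epsilon>}|lborel. zero_ext {2..3} f y / of_real (x - y))
        = (LINT y|lborel. zero_ext {2..3} f y / of_real (x - y))"
    proof eventually_elim
      case (elim \<epsilon>)
      have "indicator {y. \<bar>x - y\<bar> > \<epsilon>} y *\<^sub>R (zero_ext {2..3} f y / of_real (x - y)) = zero_ext {2..3} f y / of_real (x - y)" for y
        using x elim by (cases "y \<in> {2..3}") (auto simp: zero_ext_def indicator_def)
      then show ?case
        by (simp only: set_lebesgue_integral_def)
    qed
  qed
  then have "hilbert (zero_ext {2..3} f) x = (LINT y|lborel. zero_ext {2..3} f y / of_real (x - y))"
    unfolding hilbert_def by (intro tendsto_Lim) auto
  then show ?thesis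
    using x by (simp add: hilbert_trunc_def)
qed

definition poisson_density :: "real \<Rightarrow> (real \<Rightarrow> complex) \<Rightarrow> real \<Rightarrow> complex" where
  "poisson_density s g y = of_real (poisson_const s * (y\<^sup>2 - 1) powr - s) * zero_ext {2..3} g y"

lemma poisson_density_integrable:
  assumes s: "0 < s" and g: "g \<in> L2 {2..3}"
  shows "integrable lborel (poisson_density s g)"
proof (rule L2_compact_support_integrable[where a = 2 and b = 3])
  have [measurable]: "zero_ext {2..3} g \<in> borel_measurable borel"
    by (rule zero_ext_measurable[OF g])
  show "poisson_density s g \<in> L2 UNIV"
  proof (rule L2_dominated[OF _ zero_ext_in_L2[OF g], where C = "\<bar>poisson_const s\<bar>"])
    show "poisson_density s g \<in> borel_measurable borel"
      unfolding poisson_density_def[abs_def] by measurable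
    show "cmod (poisson_density s g y) \<le> \<bar>poisson_const s\<bar> * cmod (zero_ext {2..3} g y)" for y
    proof (cases "y \<in> {2..3}")
      case True
      then have "2\<^sup>2 \<le> y\<^sup>2"
        by (intro power_mono) auto
      then have "(y\<^sup>2 - 1) powr - s \<le> 1 powr - s"
        using s by (intro powr_mono2') auto
      then have "\<bar>poisson_const s\<bar> * (y\<^sup>2 - 1) powr - s * cmod (zero_ext {2..3} g y) \<le> \<bar>poisson_const s\<bar> * 1 * cmod (zero_ext {2..3} g y)"
        by (intro mult_right_mono mult_left_mono) auto
      then show ?thesis
        by (simp add: poisson_density_def norm_mult abs_mult)
    qed (auto simp: poisson_density_def zero_ext_def)
  qed
qed (auto simp: poisson_density_def zero_ext_def)

text \<open>
  By Fubini, the equation splits into one identity for each \<open>y\<close>, which is \<open>two_sided_transform_poisson\<close>.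
\<close>

lemma poisson_potential_solves:
  assumes s: "0 < s" "s < 1" and g: "g \<in> L2 {2..3}" and \<phi>: "\<phi> \<in> test_functions {-1<..<1}"
  shows "frac_laplacian s (ball_potential s (poisson_density s g)) \<phi> = - frac_laplacian s (zero_ext {2..3} g) \<phi>"
proof -
  obtain C where "rapid_transform s \<phi> C"
    using test_function_rapid_transform[OF s \<phi>] .
  then interpret rapid_transform s \<phi> C .
  let ?h = "poisson_density s g" and ?\<psi> = "two_sided_transform s \<phi>"
  have h_supp: "?h y = 0" if "y \<notin> {2..3}" for y
    using that by (auto simp: poisson_density_def zero_ext_def)
  note h = poisson_density_integrable[OF s(1) g]
  obtain B where B: "\<And>x. cmod (?\<psi> x) \<le> B"
    using two_sided_transform_bounded by blast
  have "(LINT x|lborel. ball_potential s ?h x * ?\<psi> x) = (LINT x|lborel. ?\<psi> x * ball_potential s ?h x)"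
    by (simp only: mult.commute)
  also have "\<dots> = (LINT y|lborel. ?h y * (LINT x|lborel. ?\<psi> x * of_real (ball_kernel s y x)))"
    by (rule ball_potential_Fubini[OF s h h_supp B two_sided_transform_measurable])
  also have "\<dots> = (LINT y|lborel. - (zero_ext {2..3} g y * ?\<psi> y))"
  proof (intro Bochner_Integration.integral_cong refl)
    fix y
    show "?h y * (LINT x|lborel. ?\<psi> x * of_real (ball_kernel s y x)) = - (zero_ext {2..3} g y * ?\<psi> y)"
    proof (cases "y \<in> {2..3}")
      case True
      then have y: "y > 1"
        by auto
      have "1\<^sup>2 < y\<^sup>2"
        using y by (intro power_strict_mono) auto
      then have p: "(y\<^sup>2 - 1) powr - s * (y\<^sup>2 - 1) powr s = 1"
        by (simp flip: powr_add)
      have "?h y * (LINT x|lborel. ?\<psi> x * of_real (ball_kernel s y x))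
          = zero_ext {2..3} g y * of_real ((y\<^sup>2 - 1) powr - s) * (of_real (sin (pi * s) / pi) * (LINT x|lborel. ?\<psi> x * of_real (ball_kernel s y x)))"
        by (simp only: poisson_density_def poisson_const_def of_real_mult mult_ac)
      also have "\<dots> = zero_ext {2..3} g y * of_real ((y\<^sup>2 - 1) powr - s) * (- of_real ((y\<^sup>2 - 1) powr s) * ?\<psi> y)"
        by (simp only: two_sided_transform_poisson[OF y])
      also have "\<dots> = - (of_real ((y\<^sup>2 - 1) powr - s * (y\<^sup>2 - 1) powr s) * (zero_ext {2..3} g y * ?\<psi> y))"
        by simp
      finally show ?thesis
        unfolding p by simp
    qed (auto simp: poisson_density_def zero_ext_def)
  qed
  also have "\<dots> = - (LINT y|lborel. zero_ext {2..3} g y * ?\<psi> y)"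
    by simp
  finally have main: "(LINT x|lborel. ball_potential s ?h x * ?\<psi> x) = - (LINT y|lborel. zero_ext {2..3} g y * ?\<psi> y)" .
  have "ball_potential s ?h x = 0" if "x \<notin> {- real 1..real 1}" for x
    using ball_potential_eq_0[OF s h h_supp, of x] that by simp
  then have 1: "frac_laplacian s (ball_potential s ?h) \<phi> = (LINT x|lborel. ball_potential s ?h x * ?\<psi> x) / of_real (2 * pi)"
    by (intro frac_laplacian_eq_integral[where N = 1] ball_potential_in_L2[OF s h h_supp])
  have 2: "frac_laplacian s (zero_ext {2..3} g) \<phi> = (LINT x|lborel. zero_ext {2..3} g x * ?\<psi> x) / of_real (2 * pi)"
    by (intro frac_laplacian_eq_integral[where N = 3] zero_ext_in_L2 g) (auto simp: zero_ext_def)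
  show ?thesis
    unfolding 1 2 main by simp
qed

theorem lemma5p1:
  fixes s :: real and g :: "real \<Rightarrow> complex"
  assumes "0 < s" and "s < 1"
    and "g \<in> L2 {2..3}"
  shows "AE x\<in>{-1..1} in lborel.
    A0 s g x =
      - complex_of_real (poisson_const s * (1 - x\<^sup>2) powr s)
        * hilbert_trunc (\<lambda>y. complex_of_real ((y\<^sup>2 - 1) powr (- s)) * g y) x"
proof -
  let ?h = "poisson_density s g"
  let ?v = "ball_potential s ?h"
  let ?F = "\<lambda>y. complex_of_real ((y\<^sup>2 - 1) powr (- s)) * g y"
  have h: "integrable lborel ?h"
    by (rule poisson_density_integrable[OF assms(1,3)])
  have h_supp: "?h y = 0" if "y \<notin> {2..3}" for y
    using that by (auto simp: poisson_density_def zero_ext_def)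
  have v: "?v \<in> Hs_tilde s {-1<..<1}"
    by (rule ball_potential_in_Hs_tilde[OF assms(1,2) h h_supp])
  have "is_solution s g (\<lambda>x. zero_ext {2..3} g x + ?v x)"
    unfolding is_solution_def using v poisson_potential_solves[OF assms] by blast
  then have "is_solution s g (SOME u. is_solution s g u)"
    by (rule someI[of "is_solution s g"])
  then obtain w where w: "w \<in> Hs_tilde s {-1<..<1}" "(SOME u. is_solution s g u) = (\<lambda>x. zero_ext {2..3} g x + w x)"
      "\<And>\<phi>. \<phi> \<in> test_functions {-1<..<1} \<Longrightarrow> frac_laplacian s w \<phi> = - frac_laplacian s (zero_ext {2..3} g) \<phi>"
    unfolding is_solution_def by blast
  have "AE x in lborel. w x = ?v x"
    using assms w poisson_potential_solves[OF assms]
    by (intro Hs_tilde_frac_laplacian_unique[OF _ _ w(1) v]) auto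
  then show ?thesis
  proof eventually_elim
    case (elim x)
    show ?case
    proof
      assume x: "x \<in> {-1..1}"
      have "A0 s g x = ?v x"
        using x elim by (simp add: A0_def w(2) zero_ext_def)
      also have "\<dots> = (LINT y|lborel. - of_real (poisson_const s * (1 - x\<^sup>2) powr s) * (zero_ext {2..3} ?F y / of_real (x - y)))"
        unfolding ball_potential_def
      proof (intro Bochner_Integration.integral_cong refl)
        fix y
        show "?h y * of_real (ball_kernel s y x) = - of_real (poisson_const s * (1 - x\<^sup>2) powr s) * (zero_ext {2..3} ?F y / of_real (x - y))"
        proof (cases "\<bar>x\<bar> < 1 \<and> y \<in> {2..3}")
          case True
          then have "1 / (x - y) = - (1 / (y - x))"
            by (auto simp: divide_simps)
          then have r: "z / complex_of_real (x - y) = - (z / of_real (y - x))" for z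
            by (metis minus_diff_eq minus_divide_right of_real_minus)
          show ?thesis
            unfolding r using True by (simp add: poisson_density_def ball_kernel_def zero_ext_def)
        next
          case False
          then show ?thesis
          proof (cases "y \<in> {2..3}")
            case True
            with False x have "\<bar>x\<bar> = 1"
              by auto
            then have "x\<^sup>2 = 1"
              by (metis one_power2 power2_abs)
            then show ?thesis
              using \<open>\<bar>x\<bar> = 1\<close> by (simp add: ball_kernel_def)
          qed (auto simp: poisson_density_def zero_ext_def)
        qed
      qed
      also have "\<dots> = - of_real (poisson_const s * (1 - x\<^sup>2) powr s) * (LINT y|lborel. zero_ext {2..3} ?F y / of_real (x - y))"
        by (rule integral_mult_right_zero)
      also have "\<dots> = - of_real (poisson_const s * (1 - x\<^sup>2) powr s) * hilbert_trunc ?F x"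
        by (simp only: hilbert_trunc_eq_integral[OF x])
      finally show "A0 s g x = - complex_of_real (poisson_const s * (1 - x\<^sup>2) powr s) * hilbert_trunc ?F x" .
    qed
  qed
qed

end
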